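(* Let $M$ be a manifold admitting a torsion-free connection $D$, a function $f:M\to\mathbb{R}_{>0}$ such that $h=Ddf$ is a pseudo-Riemannian metric (if $D$ is flat, $h$ is called a pseudo-Hessian metric), and a free $\mathbb{R}_{>0}$-action $m:\mathbb{R}_{>0}\times M\to M$. Set $m_\lambda=m(\lambda,\cdot)$ for $\lambda>0$. Suppose the following. - The function $f$ is homogeneous of degree $\alpha\in\mathbb{R}$: $m_\lambda^*f=\lambda^\alpha f$ for any $\lambda>0$. - The action of $\mathbb{R}_{>0}$ preserves $D$: $D_{(m_\lambda)_*A}((m_\lambda)_*B)=(m_\lambda)_*(D_AB)$ for any $\lambda>0$ and vector fields $A,B\in\mathfrak{X}(M)$. - For the vector field $P\in\mathfrak{X}(M)$ generated by the $\mathbb{R}_{>0}$-action, $D_AP=A$ for any $A\in TM$. Then $\alpha\neq0,1$. Moreover, the pairs $\left(\frac{Ddf}{\alpha-1},f\right)$ and $(-f\,Dd\log f,f)$ are homogeneous pairs of degree $\alpha$. In particular, for any $l>0$ and any smooth function $v:\mathbb{R}_{>0}\to\mathbb{R}_{>0}$ there are isometries $$(M,(v\circ f)Ddf)\cong\left(\mathbb{R}_{>0}\times M_l,\ \frac{\alpha-1}{\alpha}\cdot\frac{v(r)}{r}dr^2+\frac{rv(r)}{l}h_l\right),$$ $$(M,-(v\circ f)Dd(\log f))\cong\left(\mathbb{R}_{>0}\times M_l,\ \frac1\alpha\cdot\frac{v(r)}{r^2}dr^2-\frac{v(r)}{l}h_l\right),$$ where $h_l$ is the induced pseudo-Riemannian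 metric on $M_l=f^{-1}(l)\subset M$ from $h=Ddf$.
   Context: The vector field generated by the action is $P_x=\frac{d}{dt}m(e^t,x)|_{t=0}$. For a pseudo-Riemannian metric $g$ on $M$, a smooth function $f:M\to\mathbb{R}_{>0}$ and $\alpha\in\mathbb{R}-\{0\}$, the pair $(g,f)$ is called a homogeneous pair of degree $\alpha$ if $m_\lambda^*g=\lambda^\alpha g$ and $m_\lambda^*f=\lambda^\alpha f$ for all $\lambda>0$, and $g(P,\cdot)=df$. For a function $u$ on $M$, $Ddu$ denotes the Hessian of $u$ with respect to $D$. The coordinate on the factor $\mathbb{R}_{>0}$ is denoted $r$.
   Formalization: It is additionally assumed that the form h_l induced from h=Ddf on each M_l is nondegenerate; without this α=0 can occur (f=x/y on the open positive quadrant with scaling and the flat connection), and for α≠0 it follows from the other hypotheses. *)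

theory Defs
  imports "HOL-Analysis.Analysis"
begin

section \<open>Smooth functions between Euclidean spaces\<close>

text \<open>Only meant for open sets, on which these are the usual classes of k times continuously
  differentiable and of smooth functions (for a finite-dimensional domain).\<close>

primrec Ck_on :: "nat \<Rightarrow> 'b::real_normed_vector set \<Rightarrow> ('b \<Rightarrow> 'c::real_normed_vector) \<Rightarrow> bool" where
  "Ck_on 0 S f = continuous_on S f"
| "Ck_on (Suc k) S f =
    ((\<forall>x\<in>S. f differentiable (at x)) \<and> (\<forall>v. Ck_on k S (\<lambda>x. frechet_derivative f (at x) v)))"

definition smooth_on :: "'b::real_normed_vector set \<Rightarrow> ('b \<Rightarrow> 'c::real_normed_vector) \<Rightarrow> bool" where
  "smooth_on S f \<longleftrightarrow> (\<forall>k. Ck_on k S f)"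

section \<open>Manifolds and smooth maps\<close>

text \<open>The points of a manifold are the elements of a Hausdorff, second countable type, and its
  smooth structure is given by an atlas indexed by the points: \<open>\<kappa> p\<close> is a chart (domain and
  coordinate map) around \<open>p\<close>, the preferred chart at \<open>p\<close>. The tangent space at \<open>p\<close> is represented
  by the model space \<open>'e\<close> through the preferred chart at \<open>p\<close>, so that a tangent vector is an
  element of \<open>'e\<close> and a vector field a function \<open>'a \<Rightarrow> 'e\<close>.\<close>

type_synonym ('a, 'e) charts = "'a \<Rightarrow> 'a set \<times> ('a \<Rightarrow> 'e)"

definition chart_dom :: "('a, 'e) charts \<Rightarrow> 'a \<Rightarrow> 'a set" where
  "chart_dom \<kappa> p = fst (\<kappa> p)"

definition coord :: "('a, 'e) charts \<Rightarrow> 'a \<Rightarrow> 'a \<Rightarrow> 'e" where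
  "coord \<kappa> p = snd (\<kappa> p)"

definition coord_inv :: "('a, 'e) charts \<Rightarrow> 'a \<Rightarrow> 'e \<Rightarrow> 'a" where
  "coord_inv \<kappa> p = inv_into (chart_dom \<kappa> p) (coord \<kappa> p)"

definition smooth_manifold ::
  "('a::{t2_space, second_countable_topology}, 'e::euclidean_space) charts \<Rightarrow> bool" where
  "smooth_manifold \<kappa> \<longleftrightarrow>
    (\<forall>p. p \<in> chart_dom \<kappa> p \<and> open (chart_dom \<kappa> p) \<and> open (coord \<kappa> p ` chart_dom \<kappa> p) \<and>
         homeomorphism (chart_dom \<kappa> p) (coord \<kappa> p ` chart_dom \<kappa> p) (coord \<kappa> p) (coord_inv \<kappa> p)) \<and>
    (\<forall>p q. smooth_on (coord \<kappa> p ` (chart_dom \<kappa> p \<inter> chart_dom \<kappa> q)) (coord \<kappa> q \<circ> coord_inv \<kappa> p))"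

definition vec_charts :: "('e, 'e) charts" where
  "vec_charts = (\<lambda>_. (UNIV, \<lambda>x. x))"

definition prod_charts :: "('a, 'e) charts \<Rightarrow> ('b, 'd) charts \<Rightarrow> ('a \<times> 'b, 'e \<times> 'd) charts" where
  "prod_charts \<kappa> \<kappa>' = (\<lambda>(p, q). (chart_dom \<kappa> p \<times> chart_dom \<kappa>' q, map_prod (coord \<kappa> p) (coord \<kappa>' q)))"

text \<open>Smoothness on an arbitrary subset \<open>S\<close> means that there are local smooth extensions to
  neighbourhoods in the ambient manifold. For open \<open>S\<close> and for embedded submanifolds \<open>S\<close> this is
  the usual smoothness with respect to the induced smooth structure.\<close>

definition smooth_map_on ::
  "'a::topological_space set \<Rightarrow> ('a, 'e::euclidean_space) charts \<Rightarrow>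
    ('b::topological_space, 'd::euclidean_space) charts \<Rightarrow> ('a \<Rightarrow> 'b) \<Rightarrow> bool" where
  "smooth_map_on S \<kappa> \<kappa>' F \<longleftrightarrow>
    (\<forall>p\<in>S. \<exists>W G. open W \<and> p \<in> W \<and> W \<subseteq> chart_dom \<kappa> p \<and> (\<forall>q\<in>W \<inter> S. G q = F q) \<and>
       G ` W \<subseteq> chart_dom \<kappa>' (F p) \<and>
       smooth_on (coord \<kappa> p ` W) (coord \<kappa>' (F p) \<circ> G \<circ> coord_inv \<kappa> p))"

abbreviation smooth_fun ::
  "('a::topological_space, 'e::euclidean_space) charts \<Rightarrow> ('a \<Rightarrow> real) \<Rightarrow> bool" where
  "smooth_fun \<kappa> u \<equiv> smooth_map_on UNIV \<kappa> vec_charts u"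

text \<open>The tangent map at \<open>p\<close>, between the tangent spaces at \<open>p\<close> and \<open>F p\<close>.\<close>

definition tangent_map ::
  "('a, 'e::real_normed_vector) charts \<Rightarrow> ('b, 'd::real_normed_vector) charts \<Rightarrow>
    ('a \<Rightarrow> 'b) \<Rightarrow> 'a \<Rightarrow> 'e \<Rightarrow> 'd" where
  "tangent_map \<kappa> \<kappa>' F p =
    frechet_derivative (coord \<kappa>' (F p) \<circ> F \<circ> coord_inv \<kappa> p) (at (coord \<kappa> p p))"

text \<open>The differential \<open>du\<close> at \<open>p\<close>; thus the derivative \<open>X u\<close> of \<open>u\<close> along a vector field \<open>X\<close>
  is \<open>\<lambda>p. differential \<kappa> u p (X p)\<close>.\<close>

definition differential :: "('a, 'e::real_normed_vector) charts \<Rightarrow> ('a \<Rightarrow> real) \<Rightarrow> 'a \<Rightarrow> 'e \<Rightarrow> real" where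
  "differential \<kappa> u = tangent_map \<kappa> vec_charts u"

abbreviation deriv_along ::
  "('a, 'e::real_normed_vector) charts \<Rightarrow> ('a \<Rightarrow> 'e) \<Rightarrow> ('a \<Rightarrow> real) \<Rightarrow> 'a \<Rightarrow> real" where
  "deriv_along \<kappa> X u \<equiv> (\<lambda>p. differential \<kappa> u p (X p))"

text \<open>Smooth vector fields: the components with respect to every chart are smooth.\<close>

definition vector_field :: "('a, 'e::euclidean_space) charts \<Rightarrow> ('a \<Rightarrow> 'e) \<Rightarrow> bool" where
  "vector_field \<kappa> X \<longleftrightarrow>
    (\<forall>q. smooth_on (coord \<kappa> q ` chart_dom \<kappa> q)
      (\<lambda>y. tangent_map \<kappa> vec_charts (coord \<kappa> q) (coord_inv \<kappa> q y) (X (coord_inv \<kappa> q y))))"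

text \<open>For a diffeomorphism \<open>F\<close> of the manifold.\<close>

definition pushforward :: "('a, 'e::real_normed_vector) charts \<Rightarrow> ('a \<Rightarrow> 'a) \<Rightarrow> ('a \<Rightarrow> 'e) \<Rightarrow> 'a \<Rightarrow> 'e" where
  "pushforward \<kappa> F X q = tangent_map \<kappa> \<kappa> F (inv F q) (X (inv F q))"

section \<open>Connections and Hessians\<close>

text \<open>\<open>D p a Y\<close> is the covariant derivative of the vector field \<open>Y\<close> in the direction of the tangent
  vector \<open>a\<close> at \<open>p\<close>.\<close>

type_synonym ('a, 'e) covariant_derivative = "'a \<Rightarrow> 'e \<Rightarrow> ('a \<Rightarrow> 'e) \<Rightarrow> 'e"

definition cov :: "('a, 'e) covariant_derivative \<Rightarrow> ('a \<Rightarrow> 'e) \<Rightarrow> ('a \<Rightarrow> 'e) \<Rightarrow> 'a \<Rightarrow> 'e" where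
  "cov D X Y p = D p (X p) Y"

definition connection ::
  "('a::topological_space, 'e::euclidean_space) charts \<Rightarrow> ('a, 'e) covariant_derivative \<Rightarrow> bool" where
  "connection \<kappa> D \<longleftrightarrow>
    (\<forall>X Y. vector_field \<kappa> X \<and> vector_field \<kappa> Y \<longrightarrow> vector_field \<kappa> (cov D X Y)) \<and>
    (\<forall>Y p. vector_field \<kappa> Y \<longrightarrow> linear (\<lambda>a. D p a Y)) \<and>
    (\<forall>Y Z p a. vector_field \<kappa> Y \<and> vector_field \<kappa> Z \<longrightarrow>
       D p a (\<lambda>q. Y q + Z q) = D p a Y + D p a Z) \<and>
    (\<forall>u Y p a. smooth_fun \<kappa> u \<and> vector_field \<kappa> Y \<longrightarrow>
       D p a (\<lambda>q. u q *\<^sub>R Y q) = differential \<kappa> u p a *\<^sub>R Y p + u p *\<^sub>R D p a Y)"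

definition lie_bracket ::
  "('a, 'e::real_normed_vector) charts \<Rightarrow> ('a \<Rightarrow> 'e) \<Rightarrow> ('a \<Rightarrow> 'e) \<Rightarrow> ('a \<Rightarrow> real) \<Rightarrow> 'a \<Rightarrow> real" where
  "lie_bracket \<kappa> X Y u p =
    deriv_along \<kappa> X (deriv_along \<kappa> Y u) p - deriv_along \<kappa> Y (deriv_along \<kappa> X u) p"

text \<open>The Lie bracket is a derivation of the smooth functions, so the identity
  \<open>D\<^sub>X Y - D\<^sub>Y X = [X, Y]\<close> is read as an equality of derivations.\<close>

definition torsion_free ::
  "('a::topological_space, 'e::euclidean_space) charts \<Rightarrow> ('a, 'e) covariant_derivative \<Rightarrow> bool" where
  "torsion_free \<kappa> D \<longleftrightarrow>
    (\<forall>X Y u. vector_field \<kappa> X \<and> vector_field \<kappa> Y \<and> smooth_fun \<kappa> u \<longrightarrow>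
       deriv_along \<kappa> (\<lambda>p. cov D X Y p - cov D Y X p) u = lie_bracket \<kappa> X Y u)"

text \<open>The Hessian \<open>Ddu\<close> as a tensor: \<open>(Ddu)(a, Y) = (D\<^sub>a du)(Y) = a (Y u) - du (D\<^sub>a Y)\<close>,
  which depends on \<open>Y\<close> only through its value \<open>b\<close> at \<open>p\<close>.\<close>

definition hessian ::
  "('a, 'e::euclidean_space) charts \<Rightarrow> ('a, 'e) covariant_derivative \<Rightarrow> ('a \<Rightarrow> real) \<Rightarrow>
    'a \<Rightarrow> 'e \<Rightarrow> 'e \<Rightarrow> real" where
  "hessian \<kappa> D u p a b =
    (THE c. \<forall>Y. vector_field \<kappa> Y \<and> Y p = b \<longrightarrow>
       c = differential \<kappa> (deriv_along \<kappa> Y u) p a - differential \<kappa> u p (D p a Y))"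

section \<open>Metrics\<close>

definition pseudo_riemannian ::
  "('a::topological_space, 'e::euclidean_space) charts \<Rightarrow> ('a \<Rightarrow> 'e \<Rightarrow> 'e \<Rightarrow> real) \<Rightarrow> bool" where
  "pseudo_riemannian \<kappa> g \<longleftrightarrow>
    (\<forall>p. bilinear (g p)) \<and> (\<forall>p a b. g p a b = g p b a) \<and>
    (\<forall>p a. (\<forall>b. g p a b = 0) \<longrightarrow> a = 0) \<and>
    (\<forall>X Y. vector_field \<kappa> X \<and> vector_field \<kappa> Y \<longrightarrow> smooth_fun \<kappa> (\<lambda>p. g p (X p) (Y p)))"

definition pullback_metric ::
  "('a, 'e::real_normed_vector) charts \<Rightarrow> ('b, 'd::real_normed_vector) charts \<Rightarrow> ('a \<Rightarrow> 'b) \<Rightarrow>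
    ('b \<Rightarrow> 'd \<Rightarrow> 'd \<Rightarrow> real) \<Rightarrow> 'a \<Rightarrow> 'e \<Rightarrow> 'e \<Rightarrow> real" where
  "pullback_metric \<kappa> \<kappa>' F g p a b = g (F p) (tangent_map \<kappa> \<kappa>' F p a) (tangent_map \<kappa> \<kappa>' F p b)"

section \<open>Hypersurfaces\<close>

text \<open>A subset that is locally the zero set of a smooth function with nonvanishing differential.\<close>

definition embedded_hypersurface ::
  "('a::topological_space, 'e::euclidean_space) charts \<Rightarrow> 'a set \<Rightarrow> bool" where
  "embedded_hypersurface \<kappa> S \<longleftrightarrow>
    (\<forall>p\<in>S. \<exists>W u. open W \<and> p \<in> W \<and> smooth_map_on W \<kappa> (vec_charts :: (real, real) charts) u \<and>
       (\<forall>q\<in>W. \<exists>a. differential \<kappa> u q a \<noteq> 0) \<and> S \<inter> W = {q\<in>W. u q = 0})"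

text \<open>The vectors tangent to \<open>S\<close> are the velocities of the smooth curves of the ambient manifold
  lying in \<open>S\<close>.\<close>

definition tangent_space ::
  "('a::topological_space, 'e::euclidean_space) charts \<Rightarrow> 'a set \<Rightarrow> 'a \<Rightarrow> 'e set" where
  "tangent_space \<kappa> S p =
    {a. \<exists>\<epsilon>>0. \<exists>c::real \<Rightarrow> 'a. smooth_map_on {-\<epsilon><..<\<epsilon>} vec_charts \<kappa> c \<and> c ` {-\<epsilon><..<\<epsilon>} \<subseteq> S \<and>
       c 0 = p \<and> a = tangent_map vec_charts \<kappa> c 0 1}"

text \<open>Restriction of \<open>g\<close> to the vectors tangent to \<open>S\<close>, with the value 0 elsewhere.\<close>

definition induced_metric ::
  "('a::topological_space, 'e::euclidean_space) charts \<Rightarrow> 'a set \<Rightarrow> ('a \<Rightarrow> 'e \<Rightarrow> 'e \<Rightarrow> real) \<Rightarrow>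
    'a \<Rightarrow> 'e \<Rightarrow> 'e \<Rightarrow> real" where
  "induced_metric \<kappa> S g p a b =
    (if p \<in> S \<and> a \<in> tangent_space \<kappa> S p \<and> b \<in> tangent_space \<kappa> S p then g p a b else 0)"

definition nondegenerate_on ::
  "('a::topological_space, 'e::euclidean_space) charts \<Rightarrow> 'a set \<Rightarrow> ('a \<Rightarrow> 'e \<Rightarrow> 'e \<Rightarrow> real) \<Rightarrow> bool" where
  "nondegenerate_on \<kappa> S g \<longleftrightarrow>
    (\<forall>p\<in>S. \<forall>a\<in>tangent_space \<kappa> S p. (\<forall>b\<in>tangent_space \<kappa> S p. g p a b = 0) \<longrightarrow> a = 0)"

text \<open>The metric \<open>\<phi>(r) dr\<^sup>2 + \<psi>(r) g\<close> on the product of the half-line and a manifold.\<close>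

definition warped_metric ::
  "(real \<Rightarrow> real) \<Rightarrow> (real \<Rightarrow> real) \<Rightarrow> ('a \<Rightarrow> 'e \<Rightarrow> 'e \<Rightarrow> real) \<Rightarrow>
    real \<times> 'a \<Rightarrow> real \<times> 'e \<Rightarrow> real \<times> 'e \<Rightarrow> real" where
  "warped_metric \<phi> \<psi> g = (\<lambda>(r, x) (s, a) (t, b). \<phi> r * (s * t) + \<psi> r * g x a b)"

text \<open>An isometry of \<open>(M, g)\<close> onto \<open>(S, g')\<close>, where \<open>M\<close> is the whole manifold with atlas \<open>\<kappa>\<close> and
  \<open>S\<close> a submanifold of the manifold with atlas \<open>\<kappa>'\<close>: a diffeomorphism pulling \<open>g'\<close> back to \<open>g\<close>.
  The metric \<open>g'\<close> is only evaluated on vectors tangent to \<open>S\<close>.\<close>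

definition isometry_onto ::
  "('a::topological_space, 'e::euclidean_space) charts \<Rightarrow> ('a \<Rightarrow> 'e \<Rightarrow> 'e \<Rightarrow> real) \<Rightarrow>
    ('b::topological_space, 'd::euclidean_space) charts \<Rightarrow> 'b set \<Rightarrow> ('b \<Rightarrow> 'd \<Rightarrow> 'd \<Rightarrow> real) \<Rightarrow>
    ('a \<Rightarrow> 'b) \<Rightarrow> bool" where
  "isometry_onto \<kappa> g \<kappa>' S g' F \<longleftrightarrow>
    bij_betw F UNIV S \<and> smooth_map_on UNIV \<kappa> \<kappa>' F \<and> smooth_map_on S \<kappa>' \<kappa> (inv F) \<and>
    pullback_metric \<kappa> \<kappa>' F g' = g"

section \<open>Actions of the positive reals\<close>

definition smooth_action ::
  "('a::topological_space, 'e::euclidean_space) charts \<Rightarrow> (real \<Rightarrow> 'a \<Rightarrow> 'a) \<Rightarrow> bool" where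
  "smooth_action \<kappa> m \<longleftrightarrow>
    smooth_map_on ({0<..} \<times> UNIV) (prod_charts vec_charts \<kappa>) \<kappa> (\<lambda>(c, p). m c p) \<and>
    (\<forall>p. m 1 p = p) \<and> (\<forall>c>0. \<forall>c'>0. \<forall>p. m (c * c') p = m c (m c' p))"

definition free_action :: "(real \<Rightarrow> 'a \<Rightarrow> 'a) \<Rightarrow> bool" where
  "free_action m \<longleftrightarrow> (\<forall>c>0. \<forall>p. m c p = p \<longrightarrow> c = 1)"

text \<open>The velocity of the curve at 0 is a tangent vector at \<open>m (exp 0) p = p\<close>.\<close>

definition generating_field ::
  "('a, 'e::real_normed_vector) charts \<Rightarrow> (real \<Rightarrow> 'a \<Rightarrow> 'a) \<Rightarrow> 'a \<Rightarrow> 'e" where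
  "generating_field \<kappa> m p = tangent_map vec_charts \<kappa> (\<lambda>t. m (exp t) p) 0 1"

definition homogeneous_fun :: "(real \<Rightarrow> 'a \<Rightarrow> 'a) \<Rightarrow> real \<Rightarrow> ('a \<Rightarrow> real) \<Rightarrow> bool" where
  "homogeneous_fun m \<alpha> f \<longleftrightarrow> (\<forall>c>0. \<forall>p. f (m c p) = c powr \<alpha> * f p)"

definition preserves_connection ::
  "('a::topological_space, 'e::euclidean_space) charts \<Rightarrow> (real \<Rightarrow> 'a \<Rightarrow> 'a) \<Rightarrow>
    ('a, 'e) covariant_derivative \<Rightarrow> bool" where
  "preserves_connection \<kappa> m D \<longleftrightarrow>
    (\<forall>c>0. \<forall>A B. vector_field \<kappa> A \<and> vector_field \<kappa> B \<longrightarrow>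
       cov D (pushforward \<kappa> (m c) A) (pushforward \<kappa> (m c) B) = pushforward \<kappa> (m c) (cov D A B))"

definition homogeneous_pair ::
  "('a::topological_space, 'e::euclidean_space) charts \<Rightarrow> (real \<Rightarrow> 'a \<Rightarrow> 'a) \<Rightarrow> real \<Rightarrow>
    ('a \<Rightarrow> 'e \<Rightarrow> 'e \<Rightarrow> real) \<Rightarrow> ('a \<Rightarrow> real) \<Rightarrow> bool" where
  "homogeneous_pair \<kappa> m \<alpha> g f \<longleftrightarrow>
    \<alpha> \<noteq> 0 \<and> pseudo_riemannian \<kappa> g \<and> smooth_fun \<kappa> f \<and> (\<forall>p. f p > 0) \<and>
    (\<forall>c>0. pullback_metric \<kappa> \<kappa> (m c) g = (\<lambda>p a b. c powr \<alpha> * g p a b)) \<and>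
    homogeneous_fun m \<alpha> f \<and>
    (\<forall>p. g p (generating_field \<kappa> m p) = differential \<kappa> f p)"

text \<open>In the theorem, \<open>h\<^sub>l\<close> being a pseudo-Riemannian metric on the level set \<open>M\<^sub>l\<close> is a hypothesis
  (nondegeneracy of the induced form for all \<open>l > 0\<close>). Without it \<open>\<alpha> = 0\<close> is possible: take
  \<open>f (x, y) = x / y\<close> on the open positive quadrant, with the standard flat connection and the action by
  scalar multiplication; the determinant of the Hessian is \<open>-1 / y^4\<close>. For \<open>\<alpha> \<noteq> 0\<close> the
  hypothesis follows from the others.\<close>

end

theory Submission
  imports Defs
begin

text \<open>The identities \<open>D P = id\<close> and \<open>df(P) = \<alpha> f\<close> give \<open>h(P, \<cdot>) = (\<alpha> - 1) df\<close> for \<open>h = Ddf\<close>. As \<open>P\<close> has no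
  zeros, nondegeneracy of \<open>h\<close> excludes \<open>\<alpha> = 1\<close>; if \<open>\<alpha> = 0\<close>, then \<open>P\<close> is tangent to the level sets and
  orthogonal to them, which nondegeneracy of \<open>h\<^sub>l\<close> excludes. Otherwise the flow of \<open>P\<close> moves every
  point to the level \<open>l\<close>. It rescales \<open>h\<close> like \<open>f\<close>, so the resulting projection \<open>\<pi>\<close> satisfies
  \<open>\<pi>\<^sup>* h = (l / f) (h - (\<alpha> - 1) / (\<alpha> f) df\<^sup>2)\<close>. Hence \<open>p \<mapsto> (f p, \<pi> p)\<close> is the isometry in both
  cases, where \<open>Dd log f = h / f - df\<^sup>2 / f\<^sup>2\<close> is used in the second.\<close>

section \<open>Calculus of smooth functions\<close>

text \<open>Much of the work comes from the encoding. A tangent vector is written in the preferred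
  chart of its own base point, so smooth dependence on the point becomes visible only in one fixed
  chart. Connections act on global fields, and torsion, brackets and derivations are tested on
  global functions, so local coordinate computations are globalised by cutoffs; this is what the
  bump functions are for. \<open>hessian\<close> is a definite description over all fields with a
  given value, and can be evaluated only once the expression is known to be tensorial in the field.
  The level set has no atlas of its own: smoothness on it means ambient extensions, and its tangent
  vectors are velocities of curves; hence the inverse of the isometry is given by a formula that
  makes sense around the level set. Finally, P is given only pointwise, as a velocity: its
  smoothness comes from the joint smoothness of the action in both arguments, the absence of zeros
  from freeness.\<close>

lemma Ck_on_subset: "Ck_on k S f \<Longrightarrow> T \<subseteq> S \<Longrightarrow> Ck_on k T f"
  by (induction k arbitrary: f) (auto intro: continuous_on_subset)

text \<open>\<open>frechet_derivative\<close> is a choice among all derivatives. Functions that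
  agree near \<open>x\<close> have the same derivatives there, so the choices coincide, even if
  there is nothing to choose from.\<close>

lemma frechet_derivative_cong_open:
  assumes "open S" "x \<in> S" "\<And>y. y \<in> S \<Longrightarrow> f y = g y"
  shows "frechet_derivative f (at x) = frechet_derivative g (at x)"
proof -
  have "(f has_derivative D) (at x) \<longleftrightarrow> (g has_derivative D) (at x)" for D
    using has_derivative_transform_within_open[OF _ assms(1,2), of f D UNIV g]
      has_derivative_transform_within_open[OF _ assms(1,2), of g D UNIV f] assms(3) by auto
  then show ?thesis
    by (simp add: frechet_derivative_def)
qed

lemma differentiable_cong_open:
  assumes "open S" "x \<in> S" "\<And>y. y \<in> S \<Longrightarrow> f y = g y" "f differentiable (at x)"
  shows "g differentiable (at x)"
  using has_derivative_transform_within_open[OF _ assms(1,2), of f _ UNIV g] assms(3,4)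
  unfolding differentiable_def by auto

lemma Ck_on_cong:
  assumes "open S" "\<And>y. y \<in> S \<Longrightarrow> f y = g y" "Ck_on k S f"
  shows "Ck_on k S g"
  using assms(2,3)
proof (induction k arbitrary: f g)
  case 0
  then show ?case
    by (auto cong: continuous_on_cong)
next
  case (Suc k)
  have "g differentiable (at x)" if "x \<in> S" for x
    using Suc.prems(2) that by (intro differentiable_cong_open[OF assms(1) that Suc.prems(1)]) auto
  moreover have "Ck_on k S (\<lambda>x. frechet_derivative g (at x) v)" for v
  proof (rule Suc.IH)
    show "Ck_on k S (\<lambda>x. frechet_derivative f (at x) v)"
      using Suc.prems(2) by simp
    show "frechet_derivative f (at x) v = frechet_derivative g (at x) v" if "x \<in> S" for x
      by (rule arg_cong[where f = "\<lambda>D. D v", OF frechet_derivative_cong_open[OF assms(1) that Suc.prems(1)]])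
  qed
  ultimately show ?case by simp
qed

text \<open>Derivatives are taken at points, not within \<open>S\<close>, so shrinking to a
  neighbourhood changes none of the iterated derivatives.\<close>

lemma Ck_on_local:
  assumes "\<And>x. x \<in> S \<Longrightarrow> \<exists>T. open T \<and> x \<in> T \<and> Ck_on k T f"
  shows "Ck_on k S f"
  using assms
proof (induction k arbitrary: f)
  case 0
  then show ?case
    using continuous_on_eq_continuous_at
    by (fastforce intro!: continuous_at_imp_continuous_on)
next
  case (Suc k)
  have "f differentiable (at x)" if "x \<in> S" for x
    using Suc.prems[OF that] by auto
  moreover have "Ck_on k S (\<lambda>x. frechet_derivative f (at x) v)" for v
    using Suc.prems by (intro Suc.IH) fastforce
  ultimately show ?case by simp
qed

lemma Ck_on_Suc_lower: "Ck_on (Suc k) S f \<Longrightarrow> Ck_on k S f"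
proof (induction k arbitrary: f)
  case 0
  then show ?case
    by (auto intro!: continuous_at_imp_continuous_on differentiable_imp_continuous_within)
next
  case (Suc k)
  have "Ck_on k S (\<lambda>x. frechet_derivative f (at x) v)" for v
    using Suc.prems by (intro Suc.IH) simp
  with Suc.prems show ?case by simp
qed

text \<open>\<open>Ck_on\<close> is phrased with \<open>frechet_derivative\<close>; here any formula
  \<open>f'\<close> for the derivative may replace it. As \<open>S\<close> is open, agreement on
  \<open>S\<close> passes on to the further derivatives.\<close>

lemma Ck_on_SucI:
  assumes "open S" "\<And>x. x \<in> S \<Longrightarrow> (f has_derivative f' x) (at x)"
    and "\<And>v. Ck_on k S (\<lambda>x. f' x v)"
  shows "Ck_on (Suc k) S f"
proof -
  have "Ck_on k S (\<lambda>x. frechet_derivative f (at x) v)" for v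
    using assms frechet_derivative_at[OF assms(2)]
    by (intro Ck_on_cong[OF assms(1) _ assms(3)[of v]]) metis
  then show ?thesis
    using assms by (auto simp: differentiable_def)
qed

lemma Ck_on_SucD:
  assumes "Ck_on (Suc k) S f" "x \<in> S"
  shows "(f has_derivative frechet_derivative f (at x)) (at x)"
  using assms frechet_derivative_works by auto

section \<open>Closure of the C^k classes under algebraic operations and composition\<close>

lemma Ck_on_const: "Ck_on k S (\<lambda>x. c)"
  by (induction k arbitrary: c) auto

lemma Ck_on_bounded_linear_compose:
  assumes "open S" "bounded_linear L" "Ck_on k S f"
  shows "Ck_on k S (\<lambda>x. L (f x))"
  using assms(3)
proof (induction k arbitrary: f)
  case 0
  then show ?case
    using bounded_linear.continuous_on[OF assms(2)] by simp
next
  case (Suc k)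
  show ?case
  proof (rule Ck_on_SucI[OF assms(1)])
    show "((\<lambda>x. L (f x)) has_derivative (\<lambda>v. L (frechet_derivative f (at x) v))) (at x)"
      if "x \<in> S" for x
      using bounded_linear.has_derivative[OF assms(2) Ck_on_SucD[OF Suc.prems that]] .
  qed (use Suc in auto)
qed

lemma Ck_on_id: "Ck_on k S (\<lambda>x. x)"
proof (cases k)
  case (Suc j)
  then show ?thesis
    by (auto simp: Ck_on_const)
qed simp

lemma Ck_on_add:
  assumes "open S" "Ck_on k S f" "Ck_on k S g"
  shows "Ck_on k S (\<lambda>x. f x + g x)"
  using assms(2,3)
proof (induction k arbitrary: f g)
  case 0
  then show ?case by (simp add: continuous_on_add)
next
  case (Suc k)
  show ?case
    using Suc by (intro Ck_on_SucI[OF assms(1)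
      has_derivative_add[OF Ck_on_SucD[OF Suc.prems(1)] Ck_on_SucD[OF Suc.prems(2)]]]) auto
qed

lemma Ck_on_sum:
  assumes "open S" "\<And>i. i \<in> I \<Longrightarrow> Ck_on k S (f i)"
  shows "Ck_on k S (\<lambda>x. \<Sum>i\<in>I. f i x)"
  using assms(2) by (induction I rule: infinite_finite_induct) (simp_all add: Ck_on_const Ck_on_add[OF assms(1)])

text \<open>The product rule leaves one factor undifferentiated, so the induction also needs that a
  C^(k+1) factor is C^k.\<close>

lemma Ck_on_bounded_bilinear:
  assumes "open S" "bounded_bilinear B" "Ck_on k S f" "Ck_on k S g"
  shows "Ck_on k S (\<lambda>x. B (f x) (g x))"
  using assms(3,4)
proof (induction k arbitrary: f g)
  case 0
  then show ?case
    using bounded_bilinear.continuous_on[OF assms(2)] by simp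
next
  case (Suc k)
  show ?case
  proof (rule Ck_on_SucI[OF assms(1)])
    show "((\<lambda>x. B (f x) (g x)) has_derivative
        (\<lambda>v. B (f x) (frechet_derivative g (at x) v) + B (frechet_derivative f (at x) v) (g x))) (at x)"
      if "x \<in> S" for x
      using bounded_bilinear.FDERIV[OF assms(2) Ck_on_SucD[OF Suc.prems(1) that] Ck_on_SucD[OF Suc.prems(2) that]] .
    show "Ck_on k S (\<lambda>x. B (f x) (frechet_derivative g (at x) v) + B (frechet_derivative f (at x) v) (g x))" for v
      using Suc Ck_on_Suc_lower[OF Suc.prems(1)] Ck_on_Suc_lower[OF Suc.prems(2)]
      by (intro Ck_on_add[OF assms(1)] Suc.IH) auto
  qed
qed

lemma Ck_on_Pair:
  assumes "open S" "Ck_on k S f" "Ck_on k S g"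
  shows "Ck_on k S (\<lambda>x. (f x, g x))"
  using assms(2,3)
proof (induction k arbitrary: f g)
  case 0
  then show ?case by (simp add: continuous_on_Pair)
next
  case (Suc k)
  show ?case
    using Suc by (intro Ck_on_SucI[OF assms(1)
      has_derivative_Pair[OF Ck_on_SucD[OF Suc.prems(1)] Ck_on_SucD[OF Suc.prems(2)]]]) auto
qed

lemma linear_expand_Basis:
  fixes L :: "'b::euclidean_space \<Rightarrow> 'c::real_vector"
  assumes "linear L"
  shows "L v = (\<Sum>b\<in>Basis. (v \<bullet> b) *\<^sub>R L b)"
proof -
  have "L v = L (\<Sum>b\<in>Basis. (v \<bullet> b) *\<^sub>R b)"
    by (simp add: euclidean_representation)
  also have "\<dots> = (\<Sum>b\<in>Basis. (v \<bullet> b) *\<^sub>R L b)"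
    by (simp add: linear_sum[OF assms] linear_cmul[OF assms])
  finally show ?thesis .
qed

text \<open>In the chain rule the derivative of \<open>g\<close> is applied to a direction that
  varies with \<open>x\<close>, while \<open>Ck_on\<close> controls fixed directions only. Expanding
  the direction in \<open>Basis\<close> gives a finite sum of products; this is why the middle space
  is Euclidean.\<close>

lemma Ck_on_compose:
  fixes f :: "'a::real_normed_vector \<Rightarrow> 'b::euclidean_space" and g :: "'b \<Rightarrow> 'c::real_normed_vector"
  assumes "open S" "open T" "f ` S \<subseteq> T" "Ck_on k S f" "Ck_on k T g"
  shows "Ck_on k S (\<lambda>x. g (f x))"
  using assms(4,5)
proof (induction k arbitrary: g)
  case 0
  then show ?case
    using assms(3) continuous_on_compose2[of T g S f] by auto
next
  case (Suc k)
  let ?f' = "\<lambda>x. frechet_derivative f (at x)" and ?g' = "\<lambda>y. frechet_derivative g (at y)"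
  show ?case
  proof (rule Ck_on_SucI[OF assms(1)])
    fix x assume x: "x \<in> S"
    have g: "(g has_derivative ?g' (f x)) (at (f x))"
      using x assms(3) Ck_on_SucD[OF Suc.prems(2)] by auto
    have "?g' (f x) (?f' x v) = (\<Sum>b\<in>Basis. (?f' x v \<bullet> b) *\<^sub>R ?g' (f x) b)" for v
      using linear_expand_Basis[OF has_derivative_linear[OF g]] .
    then show "((\<lambda>x. g (f x)) has_derivative (\<lambda>v. \<Sum>b\<in>Basis. (?f' x v \<bullet> b) *\<^sub>R ?g' (f x) b)) (at x)"
      using has_derivative_compose[OF Ck_on_SucD[OF Suc.prems(1) x] g] by simp
  next
    fix v
    have "Ck_on k S (\<lambda>x. ?g' (f x) b)" for b
      using Suc.prems Ck_on_Suc_lower[OF Suc.prems(1)] by (intro Suc.IH) auto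
    moreover have "Ck_on k S (\<lambda>x. ?f' x v \<bullet> b)" for b
      using Suc.prems by (intro Ck_on_bounded_linear_compose[OF assms(1) bounded_linear_inner_left]) auto
    ultimately show "Ck_on k S (\<lambda>x. \<Sum>b\<in>Basis. (?f' x v \<bullet> b) *\<^sub>R ?g' (f x) b)"
      by (intro Ck_on_sum Ck_on_bounded_bilinear[OF _ bounded_bilinear_scaleR] assms(1))
  qed
qed

section \<open>Smooth functions: the C^k results for all k at once\<close>

lemma smooth_onD: "smooth_on S f \<Longrightarrow> Ck_on k S f"
  by (simp add: smooth_on_def)

lemma smooth_on_subset: "smooth_on S f \<Longrightarrow> T \<subseteq> S \<Longrightarrow> smooth_on T f"
  by (auto simp: smooth_on_def intro: Ck_on_subset)

lemma smooth_on_cong: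
  "open S \<Longrightarrow> smooth_on S f \<Longrightarrow> (\<And>y. y \<in> S \<Longrightarrow> g y = f y) \<Longrightarrow> smooth_on S g"
  unfolding smooth_on_def by (intro allI Ck_on_cong[of S f g]) auto

lemma smooth_on_local:
  "(\<And>x. x \<in> S \<Longrightarrow> \<exists>T. open T \<and> x \<in> T \<and> smooth_on T f) \<Longrightarrow> smooth_on S f"
  unfolding smooth_on_def by (intro allI Ck_on_local) blast

lemma smooth_on_imp_continuous_on: "smooth_on S f \<Longrightarrow> continuous_on S f"
  using smooth_onD[of S f 0] by simp

lemma smooth_on_has_derivative:
  "smooth_on S f \<Longrightarrow> x \<in> S \<Longrightarrow> (f has_derivative frechet_derivative f (at x)) (at x)"
  using Ck_on_SucD[OF smooth_onD] by blast

lemma smooth_on_linear_derivative: "smooth_on S f \<Longrightarrow> x \<in> S \<Longrightarrow> linear (frechet_derivative f (at x))"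
  using smooth_on_has_derivative has_derivative_linear by blast

lemma smooth_on_frechet_derivative: "smooth_on S f \<Longrightarrow> smooth_on S (\<lambda>x. frechet_derivative f (at x) v)"
  unfolding smooth_on_def by (metis Ck_on.simps(2))

lemma smooth_on_const: "smooth_on S (\<lambda>x. c)"
  by (simp add: smooth_on_def Ck_on_const)

lemma smooth_on_id: "smooth_on S (\<lambda>x. x)"
  by (simp add: smooth_on_def Ck_on_id)

lemma smooth_on_add: "open S \<Longrightarrow> smooth_on S f \<Longrightarrow> smooth_on S g \<Longrightarrow> smooth_on S (\<lambda>x. f x + g x)"
  by (simp add: smooth_on_def Ck_on_add)

lemma smooth_on_sum: "open S \<Longrightarrow> (\<And>i. i \<in> I \<Longrightarrow> smooth_on S (f i)) \<Longrightarrow> smooth_on S (\<lambda>x. \<Sum>i\<in>I. f i x)"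
  by (simp add: smooth_on_def Ck_on_sum)

lemma smooth_on_Pair: "open S \<Longrightarrow> smooth_on S f \<Longrightarrow> smooth_on S g \<Longrightarrow> smooth_on S (\<lambda>x. (f x, g x))"
  by (simp add: smooth_on_def Ck_on_Pair)

lemma smooth_on_bounded_linear_compose:
  "open S \<Longrightarrow> bounded_linear L \<Longrightarrow> smooth_on S f \<Longrightarrow> smooth_on S (\<lambda>x. L (f x))"
  by (simp add: smooth_on_def Ck_on_bounded_linear_compose)

lemma smooth_on_bounded_bilinear:
  "open S \<Longrightarrow> bounded_bilinear B \<Longrightarrow> smooth_on S f \<Longrightarrow> smooth_on S g \<Longrightarrow> smooth_on S (\<lambda>x. B (f x) (g x))"
  by (simp add: smooth_on_def Ck_on_bounded_bilinear)

lemmas smooth_on_scaleR = smooth_on_bounded_bilinear[OF _ bounded_bilinear_scaleR]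
lemmas smooth_on_mult = smooth_on_bounded_bilinear[OF _ bounded_bilinear_mult]
lemmas smooth_on_inner_right = smooth_on_bounded_linear_compose[OF _ bounded_linear_inner_left]

lemma smooth_on_diff:
  assumes "open S" "smooth_on S f" "smooth_on S g"
  shows "smooth_on S (\<lambda>x. f x - g x)"
  using smooth_on_add[OF assms(1,2) smooth_on_bounded_linear_compose[OF assms(1) _ assms(3), of uminus]]
  by (simp add: bounded_linear_minus bounded_linear_ident)

lemma smooth_on_compose:
  fixes f :: "'a::real_normed_vector \<Rightarrow> 'b::euclidean_space"
  shows "open S \<Longrightarrow> open T \<Longrightarrow> f ` S \<subseteq> T \<Longrightarrow> smooth_on S f \<Longrightarrow> smooth_on T g \<Longrightarrow> smooth_on S (\<lambda>x. g (f x))"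
  by (simp add: smooth_on_def Ck_on_compose)

text \<open>Both the point and the direction vary, so the direction is expanded in
  \<open>Basis\<close> as in the chain rule. This is the chart form of differentiating a function
  along a field.\<close>

lemma smooth_on_frechet_derivative_apply:
  fixes f :: "'b::euclidean_space \<Rightarrow> 'c::real_normed_vector"
  assumes "open S" "open T" "smooth_on T f" "smooth_on S u" "u ` S \<subseteq> T" "smooth_on S X"
  shows "smooth_on S (\<lambda>x. frechet_derivative f (at (u x)) (X x))"
proof -
  have "smooth_on S (\<lambda>x. \<Sum>b\<in>Basis. (X x \<bullet> b) *\<^sub>R frechet_derivative f (at (u x)) b)"
    by (intro smooth_on_sum smooth_on_scaleR smooth_on_inner_right
        smooth_on_compose[OF assms(1,2,5,4) smooth_on_frechet_derivative] assms)
  then show ?thesis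
    using assms
    by (elim smooth_on_cong[OF assms(1)])
       (auto intro!: linear_expand_Basis smooth_on_linear_derivative[OF assms(3)])
qed

section \<open>Smoothness of exp, inverse and ln\<close>

lemma smooth_on_exp: "smooth_on (S::real set) exp"
proof -
  have "Ck_on k UNIV (exp :: real \<Rightarrow> real)" for k
  proof (induction k)
    case (Suc k)
    have "Ck_on k UNIV (\<lambda>x. v * exp x :: real)" for v
      using Ck_on_bounded_linear_compose[OF _ bounded_linear_mult_right Suc] by simp
    then show ?case
      by (intro Ck_on_SucI[where f' = "\<lambda>x v. v * exp x"]) (auto intro!: derivative_eq_intros)
  qed (simp add: continuous_on_exp)
  then show ?thesis
    using smooth_on_subset[of UNIV exp S] by (simp add: smooth_on_def)
qed

text \<open>The derivative of \<open>inverse\<close> is a product of copies of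
  \<open>inverse\<close> and a constant, so the induction feeds on itself.\<close>

lemma smooth_on_inverse: "smooth_on (- {0::real}) inverse"
proof -
  have "Ck_on k (- {0}) (inverse :: real \<Rightarrow> real)" for k
  proof (induction k)
    case (Suc k)
    have "Ck_on k (- {0}) (\<lambda>x. (inverse x * inverse x) * (- v) :: real)" for v
      using Suc by (intro Ck_on_bounded_bilinear[OF _ bounded_bilinear_mult] Ck_on_const) auto
    then show ?case
      by (intro Ck_on_SucI[where f' = "\<lambda>x v. (inverse x * inverse x) * (- v)"])
         (auto intro!: derivative_eq_intros)
  qed (auto intro!: continuous_intros)
  then show ?thesis
    by (simp add: smooth_on_def)
qed

text \<open>One differentiation leads to \<open>inverse\<close>, whose smoothness is known, so a
  case distinction on the order replaces an induction.\<close>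

lemma smooth_on_ln: "smooth_on {0<..} (ln :: real \<Rightarrow> real)"
proof -
  have "Ck_on k {0<..} (ln :: real \<Rightarrow> real)" for k
  proof (cases k)
    case (Suc j)
    have "smooth_on {0::real<..} inverse"
      using smooth_on_inverse by (rule smooth_on_subset) auto
    then have "Ck_on j {0<..} (\<lambda>x. v * inverse x :: real)" for v
      by (intro Ck_on_bounded_linear_compose[OF _ bounded_linear_mult_right] smooth_onD) auto
    then show ?thesis unfolding Suc
      by (intro Ck_on_SucI[where f' = "\<lambda>x v. v * inverse x"])
         (auto intro!: derivative_eq_intros simp: divide_inverse)
  qed (auto intro!: continuous_intros)
  then show ?thesis
    by (simp add: smooth_on_def)
qed

subsection \<open>Bump functions\<close>

text \<open>The derivatives of \<open>exp (- 1 / t)\<close>, extended by zero to \<open>t \<le> 0\<close>, stay in this family.\<close>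

definition flat_exp :: "real poly \<Rightarrow> real \<Rightarrow> real" where
  "flat_exp q t = (if t > 0 then poly q (inverse t) * exp (- inverse t) else 0)"

lemma poly_times_exp_minus_tendsto_0:
  "((\<lambda>s::real. poly q s * exp (- s)) \<longlongrightarrow> 0) at_top"
proof -
  have "((\<lambda>s. \<Sum>i\<le>degree q. coeff q i * (s ^ i / exp s)) \<longlongrightarrow> (\<Sum>i\<le>degree q. coeff q i * 0)) at_top"
    by (intro tendsto_sum tendsto_mult_left tendsto_power_div_exp_0)
  then show ?thesis
    by (simp add: poly_altdef sum_distrib_right exp_minus divide_inverse mult.assoc)
qed

lemma flat_exp_tendsto_0: "(flat_exp q \<longlongrightarrow> 0) (at 0)"
proof -
  have "(flat_exp q \<longlongrightarrow> 0) (at_right 0)"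
  proof (rule Lim_transform_eventually)
    show "((\<lambda>t. poly q (inverse t) * exp (- inverse t)) \<longlongrightarrow> 0) (at_right 0)"
      using filterlim_compose[OF poly_times_exp_minus_tendsto_0 filterlim_inverse_at_top_right] .
    show "\<forall>\<^sub>F t in at_right 0. poly q (inverse t) * exp (- inverse t) = flat_exp q t"
      by (auto simp: flat_exp_def eventually_at_filter)
  qed
  moreover have "(flat_exp q \<longlongrightarrow> 0) (at_left 0)"
    by (rule Lim_transform_eventually[OF tendsto_const]) (auto simp: flat_exp_def eventually_at_filter)
  ultimately show ?thesis
    by (simp add: filterlim_split_at_real)
qed

text \<open>With s = 1 / t, the derivative of q(s) exp(-s) with respect to t is s^2 (q - q')(s)
  exp(-s); the polynomial \<open>[:0, 0, 1:]\<close> is the factor s^2.\<close>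

lemma flat_exp_has_real_derivative:
  "(flat_exp q has_real_derivative flat_exp ([:0, 0, 1:] * (q - pderiv q)) t) (at t)"
proof -
  consider "t > 0" | "t < 0" | "t = 0" by linarith
  then show ?thesis
  proof cases
    case 1
    have "((\<lambda>t. poly q (inverse t) * exp (- inverse t)) has_real_derivative
        flat_exp ([:0, 0, 1:] * (q - pderiv q)) t) (at t)"
      using 1 by (auto intro!: derivative_eq_intros poly_DERIV[THEN DERIV_chain2]
          simp: flat_exp_def algebra_simps power2_eq_square)
    then show ?thesis
      using 1 by (elim has_field_derivative_transform_within_open[where S = "{0<..}"]) (auto simp: flat_exp_def)
  next
    case 2
    have "((\<lambda>t. 0) has_real_derivative flat_exp ([:0, 0, 1:] * (q - pderiv q)) t) (at t)"
      using 2 by (simp add: flat_exp_def)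
    then show ?thesis
      using 2 by (elim has_field_derivative_transform_within_open[where S = "{..<0}"]) (auto simp: flat_exp_def)
  next
    case 3
    \<comment> \<open>Dividing by t multiplies the polynomial in 1 / t by \<open>[:0, 1:]\<close>,
      so the difference quotient at 0 is again a member of the family.\<close>
    have "((\<lambda>t. flat_exp q t / t) \<longlongrightarrow> 0) (at 0)"
      by (rule Lim_transform_eventually[OF flat_exp_tendsto_0[of "[:0, 1:] * q"]])
         (auto simp: flat_exp_def eventually_at_filter field_simps)
    then show ?thesis
      using 3 by (simp add: has_field_derivative_iff flat_exp_def)
  qed
qed

lemma smooth_on_flat_exp: "smooth_on UNIV (flat_exp q)"
proof -
  have "Ck_on k UNIV (flat_exp q)" for k
  proof (induction k arbitrary: q)
    case 0
    show ?case
      using DERIV_continuous_on[OF has_field_derivative_at_within[OF flat_exp_has_real_derivative]] by simp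
  next
    case (Suc k)
    show ?case
    proof (rule Ck_on_SucI)
      show "(flat_exp q has_derivative (*) (flat_exp ([:0, 0, 1:] * (q - pderiv q)) t)) (at t)" for t
        using flat_exp_has_real_derivative by (simp add: has_field_derivative_def)
      show "Ck_on k UNIV (\<lambda>t. flat_exp ([:0, 0, 1:] * (q - pderiv q)) t * v)" for v
        by (rule Ck_on_bounded_linear_compose[OF open_UNIV bounded_linear_mult_left Suc])
    qed simp
  qed
  then show ?thesis
    by (simp add: smooth_on_def)
qed

lemma ex_smooth_bump:
  fixes x\<^sub>0 :: "'e::euclidean_space"
  assumes "r > 0"
  obtains \<beta> :: "'e \<Rightarrow> real" where "smooth_on UNIV \<beta>" "\<beta> x\<^sub>0 = 1" "\<And>x. x \<notin> cball x\<^sub>0 r \<Longrightarrow> \<beta> x = 0"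
proof
  \<comment> \<open>\<open>flat_exp 1\<close> is exp(-1 / t) for t > 0 and zero otherwise. The
    squared norm, written as an inner product, is smooth everywhere, and the argument is positive
    exactly inside the ball of radius \<open>r\<close>.\<close>
  define \<gamma> where "\<gamma> x = flat_exp 1 (r\<^sup>2 - (x - x\<^sub>0) \<bullet> (x - x\<^sub>0))" for x
  have pos: "\<gamma> x\<^sub>0 > 0"
    using assms by (simp add: \<gamma>_def flat_exp_def)
  show "smooth_on UNIV (\<lambda>x. \<gamma> x * inverse (\<gamma> x\<^sub>0))"
    unfolding \<gamma>_def
    by (intro smooth_on_mult smooth_on_const smooth_on_compose[OF _ _ _ _ smooth_on_flat_exp] smooth_on_diff
        smooth_on_bounded_bilinear[OF _ bounded_bilinear_inner] smooth_on_id) auto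
  show "\<gamma> x\<^sub>0 * inverse (\<gamma> x\<^sub>0) = 1"
    using pos by simp
  fix x assume "x \<notin> cball x\<^sub>0 r"
  then have "r < norm (x - x\<^sub>0)"
    by (simp add: dist_norm norm_minus_commute)
  then have "r\<^sup>2 < (x - x\<^sub>0) \<bullet> (x - x\<^sub>0)"
    using assms by (simp add: power2_norm_eq_inner[symmetric] power_strict_mono)
  then show "\<gamma> x * inverse (\<gamma> x\<^sub>0) = 0"
    by (simp add: \<gamma>_def flat_exp_def)
qed

section \<open>Smooth maps between manifolds\<close>

subsection \<open>Charts\<close>

lemma chart_dom_mem: "smooth_manifold \<kappa> \<Longrightarrow> p \<in> chart_dom \<kappa> p"
  and open_chart_dom: "smooth_manifold \<kappa> \<Longrightarrow> open (chart_dom \<kappa> p)"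
  and homeomorphism_chart: "smooth_manifold \<kappa> \<Longrightarrow>
    homeomorphism (chart_dom \<kappa> p) (coord \<kappa> p ` chart_dom \<kappa> p) (coord \<kappa> p) (coord_inv \<kappa> p)"
  and smooth_transition: "smooth_manifold \<kappa> \<Longrightarrow>
    smooth_on (coord \<kappa> p ` (chart_dom \<kappa> p \<inter> chart_dom \<kappa> q)) (coord \<kappa> q \<circ> coord_inv \<kappa> p)"
  by (auto simp: smooth_manifold_def)

lemma coord_inv_coord: "smooth_manifold \<kappa> \<Longrightarrow> q \<in> chart_dom \<kappa> p \<Longrightarrow> coord_inv \<kappa> p (coord \<kappa> p q) = q"
  using homeomorphism_apply1[OF homeomorphism_chart] .

lemma open_coord_image:
  assumes "smooth_manifold \<kappa>" "open W" "W \<subseteq> chart_dom \<kappa> p"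
  shows "open (coord \<kappa> p ` W)"
proof -
  have "openin (top_of_set (coord \<kappa> p ` chart_dom \<kappa> p)) (coord \<kappa> p ` W)"
    using assms by (intro homeomorphism_imp_open_map[OF homeomorphism_chart]) (auto simp: openin_open)
  moreover have "open (coord \<kappa> p ` chart_dom \<kappa> p)"
    using assms(1) by (simp add: smooth_manifold_def)
  ultimately show ?thesis
    by (simp add: openin_open_eq)
qed

lemma continuous_on_coord: "smooth_manifold \<kappa> \<Longrightarrow> continuous_on (chart_dom \<kappa> p) (coord \<kappa> p)"
  using homeomorphism_cont1[OF homeomorphism_chart] .

lemma continuous_on_coord_inv:
  "smooth_manifold \<kappa> \<Longrightarrow> continuous_on (coord \<kappa> p ` chart_dom \<kappa> p) (coord_inv \<kappa> p)"
  using homeomorphism_cont2[OF homeomorphism_chart] .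

lemma vec_charts_simps [simp]:
  "chart_dom vec_charts x = UNIV" "coord vec_charts x = (\<lambda>x. x)" "coord_inv vec_charts x = (\<lambda>x. x)"
  by (simp_all add: chart_dom_def coord_def coord_inv_def vec_charts_def fun_eq_iff inv_into_f_eq)

lemma smooth_manifold_vec_charts: "smooth_manifold (vec_charts :: ('e::euclidean_space, 'e) charts)"
  by (auto simp: smooth_manifold_def homeomorphism_def comp_def smooth_on_id)

lemma chart_dom_prod: "chart_dom (prod_charts \<kappa> \<kappa>') (p, q) = chart_dom \<kappa> p \<times> chart_dom \<kappa>' q"
  and coord_prod: "coord (prod_charts \<kappa> \<kappa>') (p, q) = map_prod (coord \<kappa> p) (coord \<kappa>' q)"
  by (simp_all add: chart_dom_def coord_def prod_charts_def)

text \<open>\<open>coord_inv\<close> is an \<open>inv_into\<close>, with unspecified values outside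
  the image of the chart; hence it splits into factors at images of chart points.\<close>

lemma coord_inv_prod_coord:
  assumes "smooth_manifold \<kappa>" "smooth_manifold \<kappa>'" "x \<in> chart_dom \<kappa> p" "y \<in> chart_dom \<kappa>' q"
  shows "coord_inv (prod_charts \<kappa> \<kappa>') (p, q) (coord \<kappa> p x, coord \<kappa>' q y) = (x, y)"
proof -
  have "inj_on (map_prod (coord \<kappa> p) (coord \<kappa>' q)) (chart_dom \<kappa> p \<times> chart_dom \<kappa>' q)"
    using assms(1,2) by (intro map_prod_inj_on inj_on_inverseI[where g = "coord_inv \<kappa> p"]
        inj_on_inverseI[where g = "coord_inv \<kappa>' q"] coord_inv_coord)
  from inv_into_f_f[OF this, of "(x, y)"] show ?thesis
    using assms(3,4) by (simp add: coord_inv_def chart_dom_prod coord_prod)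
qed

lemma smooth_manifold_prod_charts:
  assumes M: "smooth_manifold \<kappa>" and M': "smooth_manifold \<kappa>'"
  shows "smooth_manifold (prod_charts \<kappa> \<kappa>')"
  unfolding smooth_manifold_def
proof (intro conjI allI)
  fix pq :: "'a \<times> 'c"
  obtain p q where pq: "pq = (p, q)" by force
  let ?d = "chart_dom \<kappa> p \<times> chart_dom \<kappa>' q"
  have img: "map_prod (coord \<kappa> p) (coord \<kappa>' q) ` ?d = coord \<kappa> p ` chart_dom \<kappa> p \<times> coord \<kappa>' q ` chart_dom \<kappa>' q"
    by (auto simp: map_prod_def image_def)
  show "pq \<in> chart_dom (prod_charts \<kappa> \<kappa>') pq" "open (chart_dom (prod_charts \<kappa> \<kappa>') pq)"
    "open (coord (prod_charts \<kappa> \<kappa>') pq ` chart_dom (prod_charts \<kappa> \<kappa>') pq)"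
    by (auto simp: pq chart_dom_prod coord_prod img intro!: open_Times open_coord_image chart_dom_mem
        open_chart_dom M M')
  have "continuous_on (coord \<kappa> p ` chart_dom \<kappa> p \<times> coord \<kappa>' q ` chart_dom \<kappa>' q)
      (\<lambda>x. (coord_inv \<kappa> p (fst x), coord_inv \<kappa>' q (snd x)))"
    by (intro continuous_on_Pair continuous_on_compose2[OF continuous_on_coord_inv[OF M]]
        continuous_on_compose2[OF continuous_on_coord_inv[OF M']] continuous_on_fst continuous_on_snd continuous_on_id)
       auto
  then have inv: "continuous_on (map_prod (coord \<kappa> p) (coord \<kappa>' q) ` ?d) (coord_inv (prod_charts \<kappa> \<kappa>') pq)"
    unfolding img pq by (rule continuous_on_eq) (auto simp: coord_inv_prod_coord coord_inv_coord M M')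
  have "continuous_on ?d (\<lambda>x. (coord \<kappa> p (fst x), coord \<kappa>' q (snd x)))"
    by (intro continuous_on_Pair continuous_on_compose2[OF continuous_on_coord[OF M]]
        continuous_on_compose2[OF continuous_on_coord[OF M']] continuous_on_fst continuous_on_snd continuous_on_id)
       auto
  then have "continuous_on ?d (map_prod (coord \<kappa> p) (coord \<kappa>' q))"
    by (rule continuous_on_eq) auto
  with inv show "homeomorphism (chart_dom (prod_charts \<kappa> \<kappa>') pq)
      (coord (prod_charts \<kappa> \<kappa>') pq ` chart_dom (prod_charts \<kappa> \<kappa>') pq)
      (coord (prod_charts \<kappa> \<kappa>') pq) (coord_inv (prod_charts \<kappa> \<kappa>') pq)"
    unfolding chart_dom_prod coord_prod pq
    by (intro homeomorphismI) (auto simp: coord_inv_prod_coord M M')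
next
  fix pq pq' :: "'a \<times> 'c"
  obtain p q p' q' where pq: "pq = (p, q)" "pq' = (p', q')" by (metis surj_pair)
  let ?U = "coord \<kappa> p ` (chart_dom \<kappa> p \<inter> chart_dom \<kappa> p')"
  let ?V = "coord \<kappa>' q ` (chart_dom \<kappa>' q \<inter> chart_dom \<kappa>' q')"
  have o: "open ?U" "open ?V"
    by (auto intro!: open_coord_image open_Int open_chart_dom M M')
  have img: "map_prod (coord \<kappa> p) (coord \<kappa>' q) ` ((chart_dom \<kappa> p \<times> chart_dom \<kappa>' q) \<inter> (chart_dom \<kappa> p' \<times> chart_dom \<kappa>' q')) = ?U \<times> ?V"
    by (auto simp: image_iff)
  have "smooth_on (?U \<times> ?V) (\<lambda>x. ((coord \<kappa> p' \<circ> coord_inv \<kappa> p) (fst x), (coord \<kappa>' q' \<circ> coord_inv \<kappa>' q) (snd x)))"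
    using o by (intro smooth_on_Pair open_Times smooth_on_compose[OF _ o(1) _ _ smooth_transition[OF M]]
        smooth_on_compose[OF _ o(2) _ _ smooth_transition[OF M']]
        smooth_on_bounded_linear_compose[OF _ bounded_linear_fst] smooth_on_bounded_linear_compose[OF _ bounded_linear_snd]
        smooth_on_id) auto
  then show "smooth_on (coord (prod_charts \<kappa> \<kappa>') pq ` (chart_dom (prod_charts \<kappa> \<kappa>') pq \<inter> chart_dom (prod_charts \<kappa> \<kappa>') pq'))
      (coord (prod_charts \<kappa> \<kappa>') pq' \<circ> coord_inv (prod_charts \<kappa> \<kappa>') pq)"
    unfolding pq chart_dom_prod coord_prod img
    using o by (elim smooth_on_cong[rotated]) (auto simp: coord_inv_prod_coord coord_inv_coord M M' intro!: open_Times)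
qed

subsection \<open>Smooth maps\<close>

lemma smooth_map_onE:
  assumes "smooth_map_on S \<kappa> \<kappa>' F" "p \<in> S"
  obtains W G where "open W" "p \<in> W" "W \<subseteq> chart_dom \<kappa> p" "\<And>q. q \<in> W \<Longrightarrow> q \<in> S \<Longrightarrow> G q = F q"
    "G ` W \<subseteq> chart_dom \<kappa>' (F p)" "smooth_on (coord \<kappa> p ` W) (coord \<kappa>' (F p) \<circ> G \<circ> coord_inv \<kappa> p)"
proof -
  from assms have "\<exists>W G. open W \<and> p \<in> W \<and> W \<subseteq> chart_dom \<kappa> p \<and> (\<forall>q\<in>W \<inter> S. G q = F q) \<and>
       G ` W \<subseteq> chart_dom \<kappa>' (F p) \<and> smooth_on (coord \<kappa> p ` W) (coord \<kappa>' (F p) \<circ> G \<circ> coord_inv \<kappa> p)"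
    unfolding smooth_map_on_def by (rule bspec)
  then show thesis
    by (elim exE conjE) (rule that; auto)
qed

lemma smooth_map_onI:
  assumes "\<And>p. p \<in> S \<Longrightarrow> \<exists>W G. open W \<and> p \<in> W \<and> W \<subseteq> chart_dom \<kappa> p \<and> (\<forall>q\<in>W \<inter> S. G q = F q) \<and>
       G ` W \<subseteq> chart_dom \<kappa>' (F p) \<and> smooth_on (coord \<kappa> p ` W) (coord \<kappa>' (F p) \<circ> G \<circ> coord_inv \<kappa> p)"
  shows "smooth_map_on S \<kappa> \<kappa>' F"
  unfolding smooth_map_on_def using assms by (rule ballI)

lemma smooth_map_on_cong_subset:
  assumes "smooth_map_on S \<kappa> \<kappa>' F" "T \<subseteq> S" "\<And>p. p \<in> T \<Longrightarrow> G p = F p"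
  shows "smooth_map_on T \<kappa> \<kappa>' G"
proof (rule smooth_map_onI)
  fix p assume p: "p \<in> T"
  then have "p \<in> S" using assms(2) by auto
  from smooth_map_onE[OF assms(1) this] obtain W F' where W: "open W" "p \<in> W" "W \<subseteq> chart_dom \<kappa> p"
    "\<And>q. q \<in> W \<Longrightarrow> q \<in> S \<Longrightarrow> F' q = F q" "F' ` W \<subseteq> chart_dom \<kappa>' (F p)"
    "smooth_on (coord \<kappa> p ` W) (coord \<kappa>' (F p) \<circ> F' \<circ> coord_inv \<kappa> p)"
    by blast
  have "F' q = G q" if "q \<in> W \<inter> T" for q
    using W(4)[of q] assms(2,3) that by auto
  with W show "\<exists>W F'. open W \<and> p \<in> W \<and> W \<subseteq> chart_dom \<kappa> p \<and> (\<forall>q\<in>W \<inter> T. F' q = G q) \<and>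
       F' ` W \<subseteq> chart_dom \<kappa>' (G p) \<and> smooth_on (coord \<kappa> p ` W) (coord \<kappa>' (G p) \<circ> F' \<circ> coord_inv \<kappa> p)"
    unfolding assms(3)[OF p] by blast
qed

lemma smooth_map_on_subset: "smooth_map_on S \<kappa> \<kappa>' F \<Longrightarrow> T \<subseteq> S \<Longrightarrow> smooth_map_on T \<kappa> \<kappa>' F"
  by (rule smooth_map_on_cong_subset) auto

lemma smooth_map_on_openI:
  assumes "\<And>p. p \<in> S \<Longrightarrow> \<exists>W. open W \<and> p \<in> W \<and> W \<subseteq> chart_dom \<kappa> p \<and> F ` W \<subseteq> chart_dom \<kappa>' (F p) \<and>
    smooth_on (coord \<kappa> p ` W) (coord \<kappa>' (F p) \<circ> F \<circ> coord_inv \<kappa> p)"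
  shows "smooth_map_on S \<kappa> \<kappa>' F"
proof (rule smooth_map_onI)
  fix p assume "p \<in> S"
  from assms[OF this] show "\<exists>W G. open W \<and> p \<in> W \<and> W \<subseteq> chart_dom \<kappa> p \<and> (\<forall>q\<in>W \<inter> S. G q = F q) \<and>
       G ` W \<subseteq> chart_dom \<kappa>' (F p) \<and> smooth_on (coord \<kappa> p ` W) (coord \<kappa>' (F p) \<circ> G \<circ> coord_inv \<kappa> p)"
    by (elim exE) (intro exI[of _ F] exI, auto)
qed

text \<open>On an open \<open>S\<close> the local extension can be cut down to
  \<open>W \<inter> S\<close>, where it equals \<open>F\<close>; so \<open>F\<close> itself has a
  smooth representation and no extension is left to carry along.\<close>

lemma smooth_map_on_openE:
  assumes "smooth_map_on S \<kappa> \<kappa>' F" "open S" "p \<in> S" "smooth_manifold \<kappa>"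
  obtains W where "open W" "p \<in> W" "W \<subseteq> S" "W \<subseteq> chart_dom \<kappa> p" "F ` W \<subseteq> chart_dom \<kappa>' (F p)"
    "smooth_on (coord \<kappa> p ` W) (coord \<kappa>' (F p) \<circ> F \<circ> coord_inv \<kappa> p)"
proof -
  obtain W G where W: "open W" "p \<in> W" "W \<subseteq> chart_dom \<kappa> p" "\<And>q. q \<in> W \<Longrightarrow> q \<in> S \<Longrightarrow> G q = F q"
    "G ` W \<subseteq> chart_dom \<kappa>' (F p)" "smooth_on (coord \<kappa> p ` W) (coord \<kappa>' (F p) \<circ> G \<circ> coord_inv \<kappa> p)"
    using smooth_map_onE[OF assms(1,3)] by blast
  have "smooth_on (coord \<kappa> p ` (W \<inter> S)) (coord \<kappa>' (F p) \<circ> F \<circ> coord_inv \<kappa> p)"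
  proof (rule smooth_on_cong)
    show "open (coord \<kappa> p ` (W \<inter> S))"
      using assms W by (intro open_coord_image open_Int) auto
    show "smooth_on (coord \<kappa> p ` (W \<inter> S)) (coord \<kappa>' (F p) \<circ> G \<circ> coord_inv \<kappa> p)"
      using W(6) by (rule smooth_on_subset) auto
    show "(coord \<kappa>' (F p) \<circ> F \<circ> coord_inv \<kappa> p) y = (coord \<kappa>' (F p) \<circ> G \<circ> coord_inv \<kappa> p) y"
      if "y \<in> coord \<kappa> p ` (W \<inter> S)" for y
      using that W by (auto simp: coord_inv_coord[OF assms(4)] subset_iff)
  qed
  moreover have "F ` (W \<inter> S) \<subseteq> chart_dom \<kappa>' (F p)"
    using W(4,5) by fastforce
  ultimately show thesis
    using W assms by (intro that[of "W \<inter> S"]) auto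
qed

text \<open>Smoothness as defined does not mention continuity. It follows because \<open>F\<close>
  maps \<open>W\<close> into a single chart domain and is recovered there from its continuous
  representation by the two charts, which are homeomorphisms.\<close>

lemma continuous_on_smooth_representation:
  assumes "smooth_manifold \<kappa>" "smooth_manifold \<kappa>'" "W \<subseteq> chart_dom \<kappa> p" "F ` W \<subseteq> chart_dom \<kappa>' q"
    and "smooth_on (coord \<kappa> p ` W) (coord \<kappa>' q \<circ> F \<circ> coord_inv \<kappa> p)"
  shows "continuous_on W F"
proof -
  have "continuous_on W (\<lambda>x. coord_inv \<kappa>' q ((coord \<kappa>' q \<circ> F \<circ> coord_inv \<kappa> p) (coord \<kappa> p x)))"
    using assms(3,4)
    by (intro continuous_on_compose2[OF continuous_on_coord_inv[OF assms(2)]]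
        continuous_on_compose2[OF smooth_on_imp_continuous_on[OF assms(5)]]
        continuous_on_subset[OF continuous_on_coord[OF assms(1)]])
       (auto simp: coord_inv_coord[OF assms(1)] subset_iff)
  then show ?thesis
    by (rule continuous_on_eq) (use assms(3,4) in \<open>auto simp: coord_inv_coord assms(1,2) subset_iff\<close>)
qed

lemma smooth_map_on_imp_continuous_on:
  assumes "smooth_manifold \<kappa>" "smooth_manifold \<kappa>'" "open S" "smooth_map_on S \<kappa> \<kappa>' F"
  shows "continuous_on S F"
proof (intro continuous_at_imp_continuous_on ballI)
  fix p assume "p \<in> S"
  from smooth_map_on_openE[OF assms(4,3) this assms(1)] show "isCont F p"
    by (metis assms(1,2) continuous_on_eq_continuous_at continuous_on_smooth_representation)
qed

text \<open>For arbitrary \<open>S\<close> and \<open>T\<close> only local extensions are available,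
  so the extensions are composed, not the maps.\<close>

lemma smooth_map_on_compose:
  assumes M: "smooth_manifold \<kappa>" and M': "smooth_manifold \<kappa>'"
    and F: "smooth_map_on S \<kappa> \<kappa>' F" and G: "smooth_map_on T \<kappa>' \<kappa>'' G" and ST: "F ` S \<subseteq> T"
  shows "smooth_map_on S \<kappa> \<kappa>'' (\<lambda>x. G (F x))"
proof (rule smooth_map_onI)
  fix p assume p: "p \<in> S"
  obtain W F' where W: "open W" "p \<in> W" "W \<subseteq> chart_dom \<kappa> p" "\<And>q. q \<in> W \<Longrightarrow> q \<in> S \<Longrightarrow> F' q = F q"
    "F' ` W \<subseteq> chart_dom \<kappa>' (F p)" "smooth_on (coord \<kappa> p ` W) (coord \<kappa>' (F p) \<circ> F' \<circ> coord_inv \<kappa> p)"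
    using smooth_map_onE[OF F p] by blast
  obtain V G' where V: "open V" "F p \<in> V" "V \<subseteq> chart_dom \<kappa>' (F p)" "\<And>q. q \<in> V \<Longrightarrow> q \<in> T \<Longrightarrow> G' q = G q"
    "G' ` V \<subseteq> chart_dom \<kappa>'' (G (F p))"
    "smooth_on (coord \<kappa>' (F p) ` V) (coord \<kappa>'' (G (F p)) \<circ> G' \<circ> coord_inv \<kappa>' (F p))"
    using smooth_map_onE[OF G, of "F p"] p ST by blast
  \<comment> \<open>Where the extension of \<open>F\<close> lands in the domain of the extension of
    \<open>G\<close>. This set is open because the extension of \<open>F\<close> is continuous on
    \<open>W\<close>.\<close>
  define U where "U = W \<inter> F' -` V"
  have "continuous_on W F'"
    using continuous_on_smooth_representation[OF M M' W(3,5,6)] .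
  then have U: "open U"
    using W(1) V(1) by (simp add: U_def Int_commute continuous_on_open_vimage)
  have "smooth_on (coord \<kappa> p ` U) (\<lambda>y. (coord \<kappa>'' (G (F p)) \<circ> G' \<circ> coord_inv \<kappa>' (F p))
      ((coord \<kappa>' (F p) \<circ> F' \<circ> coord_inv \<kappa> p) y))"
  proof (rule smooth_on_compose[OF _ _ _ _ V(6)])
    show oU: "open (coord \<kappa> p ` U)"
      using U W by (intro open_coord_image M) (auto simp: U_def)
    show "open (coord \<kappa>' (F p) ` V)"
      using V by (intro open_coord_image M') auto
    show "(coord \<kappa>' (F p) \<circ> F' \<circ> coord_inv \<kappa> p) ` coord \<kappa> p ` U \<subseteq> coord \<kappa>' (F p) ` V"
      using W(3) by (auto simp: U_def coord_inv_coord[OF M] subset_iff)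
    show "smooth_on (coord \<kappa> p ` U) (coord \<kappa>' (F p) \<circ> F' \<circ> coord_inv \<kappa> p)"
      using W(6) by (rule smooth_on_subset) (auto simp: U_def)
  qed
  then have "smooth_on (coord \<kappa> p ` U) (coord \<kappa>'' (G (F p)) \<circ> (\<lambda>x. G' (F' x)) \<circ> coord_inv \<kappa> p)"
  proof (rule smooth_on_cong[rotated])
    show "open (coord \<kappa> p ` U)"
      using U W by (intro open_coord_image M) (auto simp: U_def)
    fix y assume "y \<in> coord \<kappa> p ` U"
    then obtain x where x: "x \<in> W" "F' x \<in> V" "y = coord \<kappa> p x" by (auto simp: U_def)
    then have "coord_inv \<kappa>' (F p) (coord \<kappa>' (F p) (F' x)) = F' x" "coord_inv \<kappa> p y = x"
      using V(3) W(3) by (auto intro!: coord_inv_coord M M')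
    then show "(coord \<kappa>'' (G (F p)) \<circ> (\<lambda>x. G' (F' x)) \<circ> coord_inv \<kappa> p) y =
        (coord \<kappa>'' (G (F p)) \<circ> G' \<circ> coord_inv \<kappa>' (F p)) ((coord \<kappa>' (F p) \<circ> F' \<circ> coord_inv \<kappa> p) y)"
      by simp
  qed
  moreover have "\<forall>q\<in>U \<inter> S. G' (F' q) = G (F q)"
    using W(4) V(4) ST by (fastforce simp: U_def)
  moreover have "p \<in> U"
    using W(2,4) V(2) p by (simp add: U_def)
  moreover have "U \<subseteq> chart_dom \<kappa> p" "(\<lambda>x. G' (F' x)) ` U \<subseteq> chart_dom \<kappa>'' (G (F p))"
    using W(3) V(5) by (auto simp: U_def)
  ultimately show "\<exists>W G'. open W \<and> p \<in> W \<and> W \<subseteq> chart_dom \<kappa> p \<and> (\<forall>q\<in>W \<inter> S. G' q = G (F q)) \<and>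
       G' ` W \<subseteq> chart_dom \<kappa>'' (G (F p)) \<and>
       smooth_on (coord \<kappa> p ` W) (coord \<kappa>'' (G (F p)) \<circ> G' \<circ> coord_inv \<kappa> p)"
    using U by (intro exI[of _ U] exI[of _ "\<lambda>x. G' (F' x)"] conjI)
qed

section \<open>Basic smooth maps: constants, identity, pairs, projections, charts\<close>

lemma smooth_map_on_const:
  assumes "smooth_manifold \<kappa>" "smooth_manifold \<kappa>'"
  shows "smooth_map_on S \<kappa> \<kappa>' (\<lambda>x. c)"
proof (rule smooth_map_on_openI)
  fix p
  show "\<exists>W. open W \<and> p \<in> W \<and> W \<subseteq> chart_dom \<kappa> p \<and> (\<lambda>x. c) ` W \<subseteq> chart_dom \<kappa>' c \<and>
      smooth_on (coord \<kappa> p ` W) (coord \<kappa>' c \<circ> (\<lambda>x. c) \<circ> coord_inv \<kappa> p)"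
    using assms by (intro exI[of _ "chart_dom \<kappa> p"])
      (auto simp: chart_dom_mem open_chart_dom comp_def smooth_on_const)
qed

lemma smooth_map_on_ident:
  assumes "smooth_manifold \<kappa>"
  shows "smooth_map_on S \<kappa> \<kappa> (\<lambda>x. x)"
proof (rule smooth_map_on_openI)
  fix p
  show "\<exists>W. open W \<and> p \<in> W \<and> W \<subseteq> chart_dom \<kappa> p \<and> (\<lambda>x. x) ` W \<subseteq> chart_dom \<kappa> p \<and>
      smooth_on (coord \<kappa> p ` W) (coord \<kappa> p \<circ> (\<lambda>x. x) \<circ> coord_inv \<kappa> p)"
    using assms smooth_transition[OF assms, of p p] by (intro exI[of _ "chart_dom \<kappa> p"])
      (auto simp: chart_dom_mem open_chart_dom comp_def)
qed

lemma smooth_map_on_vec_vec: "open S \<Longrightarrow> smooth_on S f \<Longrightarrow> smooth_map_on S vec_charts vec_charts f"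
  by (rule smooth_map_on_openI) (auto simp: comp_def)

lemma smooth_map_on_Pair:
  assumes M: "smooth_manifold \<kappa>"
    and F: "smooth_map_on S \<kappa> \<kappa>\<^sub>1 F" and G: "smooth_map_on S \<kappa> \<kappa>\<^sub>2 G"
  shows "smooth_map_on S \<kappa> (prod_charts \<kappa>\<^sub>1 \<kappa>\<^sub>2) (\<lambda>x. (F x, G x))"
proof (rule smooth_map_onI)
  fix p assume p: "p \<in> S"
  obtain W F' where W: "open W" "p \<in> W" "W \<subseteq> chart_dom \<kappa> p" "\<And>q. q \<in> W \<Longrightarrow> q \<in> S \<Longrightarrow> F' q = F q"
    "F' ` W \<subseteq> chart_dom \<kappa>\<^sub>1 (F p)" "smooth_on (coord \<kappa> p ` W) (coord \<kappa>\<^sub>1 (F p) \<circ> F' \<circ> coord_inv \<kappa> p)"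
    using smooth_map_onE[OF F p] by blast
  obtain V G' where V: "open V" "p \<in> V" "V \<subseteq> chart_dom \<kappa> p" "\<And>q. q \<in> V \<Longrightarrow> q \<in> S \<Longrightarrow> G' q = G q"
    "G' ` V \<subseteq> chart_dom \<kappa>\<^sub>2 (G p)" "smooth_on (coord \<kappa> p ` V) (coord \<kappa>\<^sub>2 (G p) \<circ> G' \<circ> coord_inv \<kappa> p)"
    using smooth_map_onE[OF G p] by blast
  have "smooth_on (coord \<kappa> p ` (W \<inter> V)) (\<lambda>y. ((coord \<kappa>\<^sub>1 (F p) \<circ> F' \<circ> coord_inv \<kappa> p) y, (coord \<kappa>\<^sub>2 (G p) \<circ> G' \<circ> coord_inv \<kappa> p) y))"
    using W V by (intro smooth_on_Pair open_coord_image M smooth_on_subset[OF W(6)] smooth_on_subset[OF V(6)]) auto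
  then have "smooth_on (coord \<kappa> p ` (W \<inter> V)) (coord (prod_charts \<kappa>\<^sub>1 \<kappa>\<^sub>2) (F p, G p) \<circ> (\<lambda>x. (F' x, G' x)) \<circ> coord_inv \<kappa> p)"
    by (simp add: coord_prod comp_def)
  then show "\<exists>W G'. open W \<and> p \<in> W \<and> W \<subseteq> chart_dom \<kappa> p \<and> (\<forall>q\<in>W \<inter> S. G' q = (F q, G q)) \<and>
       G' ` W \<subseteq> chart_dom (prod_charts \<kappa>\<^sub>1 \<kappa>\<^sub>2) (F p, G p) \<and>
       smooth_on (coord \<kappa> p ` W) (coord (prod_charts \<kappa>\<^sub>1 \<kappa>\<^sub>2) (F p, G p) \<circ> G' \<circ> coord_inv \<kappa> p)"
    using W(1-5) V(1-5) by (intro exI[of _ "W \<inter> V"] exI[of _ "\<lambda>x. (F' x, G' x)"]) (auto simp: chart_dom_prod)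
qed

lemma smooth_map_on_fst:
  assumes M: "smooth_manifold \<kappa>" "smooth_manifold \<kappa>'"
  shows "smooth_map_on S (prod_charts \<kappa> \<kappa>') \<kappa> fst"
proof (rule smooth_map_on_openI)
  fix pq :: "'a \<times> 'c"
  obtain p q where pq: "pq = (p, q)" by force
  let ?W = "chart_dom (prod_charts \<kappa> \<kappa>') pq"
  note PM = smooth_manifold_prod_charts[OF M]
  have "smooth_on (coord (prod_charts \<kappa> \<kappa>') pq ` ?W) (coord \<kappa> (fst pq) \<circ> fst \<circ> coord_inv (prod_charts \<kappa> \<kappa>') pq)"
    by (rule smooth_on_cong[OF _ smooth_on_bounded_linear_compose[OF _ bounded_linear_fst smooth_on_id]])
       (auto simp: pq chart_dom_prod coord_prod coord_inv_prod_coord M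
         intro!: open_coord_image[OF PM, of _ "(p, q)", unfolded coord_prod chart_dom_prod] open_Times open_chart_dom)
  then show "\<exists>W. open W \<and> pq \<in> W \<and> W \<subseteq> ?W \<and> fst ` W \<subseteq> chart_dom \<kappa> (fst pq) \<and>
      smooth_on (coord (prod_charts \<kappa> \<kappa>') pq ` W) (coord \<kappa> (fst pq) \<circ> fst \<circ> coord_inv (prod_charts \<kappa> \<kappa>') pq)"
    by (intro exI[of _ ?W]) (auto simp: chart_dom_mem open_chart_dom PM, auto simp: pq chart_dom_prod)
qed

lemma smooth_map_on_snd:
  assumes M: "smooth_manifold \<kappa>" "smooth_manifold \<kappa>'"
  shows "smooth_map_on S (prod_charts \<kappa> \<kappa>') \<kappa>' snd"
proof (rule smooth_map_on_openI)
  fix pq :: "'a \<times> 'c"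
  obtain p q where pq: "pq = (p, q)" by force
  let ?W = "chart_dom (prod_charts \<kappa> \<kappa>') pq"
  note PM = smooth_manifold_prod_charts[OF M]
  have "smooth_on (coord (prod_charts \<kappa> \<kappa>') pq ` ?W) (coord \<kappa>' (snd pq) \<circ> snd \<circ> coord_inv (prod_charts \<kappa> \<kappa>') pq)"
    by (rule smooth_on_cong[OF _ smooth_on_bounded_linear_compose[OF _ bounded_linear_snd smooth_on_id]])
       (auto simp: pq chart_dom_prod coord_prod coord_inv_prod_coord M
         intro!: open_coord_image[OF PM, of _ "(p, q)", unfolded coord_prod chart_dom_prod] open_Times open_chart_dom)
  then show "\<exists>W. open W \<and> pq \<in> W \<and> W \<subseteq> ?W \<and> snd ` W \<subseteq> chart_dom \<kappa>' (snd pq) \<and>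
      smooth_on (coord (prod_charts \<kappa> \<kappa>') pq ` W) (coord \<kappa>' (snd pq) \<circ> snd \<circ> coord_inv (prod_charts \<kappa> \<kappa>') pq)"
    by (intro exI[of _ ?W]) (auto simp: chart_dom_mem open_chart_dom PM, auto simp: pq chart_dom_prod)
qed

text \<open>The definition looks at each point through its own preferred chart; smooth transition
  maps carry this over to an arbitrary chart. In this form, closure properties reduce to those of
  \<open>smooth_on\<close>.\<close>

lemma smooth_map_on_vec_iff:
  assumes M: "smooth_manifold \<kappa>" and S: "open S"
  shows "smooth_map_on S \<kappa> vec_charts u \<longleftrightarrow>
    (\<forall>q. smooth_on (coord \<kappa> q ` (chart_dom \<kappa> q \<inter> S)) (u \<circ> coord_inv \<kappa> q))"
proof (intro iffI allI)
  fix q assume u: "smooth_map_on S \<kappa> vec_charts u"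
  show "smooth_on (coord \<kappa> q ` (chart_dom \<kappa> q \<inter> S)) (u \<circ> coord_inv \<kappa> q)"
  proof (rule smooth_on_local)
    fix y assume "y \<in> coord \<kappa> q ` (chart_dom \<kappa> q \<inter> S)"
    then obtain x where x: "x \<in> chart_dom \<kappa> q" "x \<in> S" "y = coord \<kappa> q x" by auto
    obtain W where W: "open W" "x \<in> W" "W \<subseteq> S" "W \<subseteq> chart_dom \<kappa> x"
      "smooth_on (coord \<kappa> x ` W) (u \<circ> coord_inv \<kappa> x)"
      by (rule smooth_map_on_openE[OF u S x(2) M]) (rule that, auto simp: comp_def)
    let ?T = "coord \<kappa> q ` (W \<inter> chart_dom \<kappa> q)"
    have T: "open ?T"
      using W by (intro open_coord_image open_Int open_chart_dom M) auto
    have "smooth_on ?T (\<lambda>y. (u \<circ> coord_inv \<kappa> x) ((coord \<kappa> x \<circ> coord_inv \<kappa> q) y))"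
      using T W by (intro smooth_on_compose[OF _ _ _ _ W(5)] smooth_on_subset[OF smooth_transition[OF M]]
          open_coord_image M) (auto simp: coord_inv_coord[OF M] intro!: open_coord_image open_Int open_chart_dom M)
    then have "smooth_on ?T (u \<circ> coord_inv \<kappa> q)"
      using W(4) by (elim smooth_on_cong[OF T]) (auto simp: coord_inv_coord[OF M] subset_iff)
    then show "\<exists>T. open T \<and> y \<in> T \<and> smooth_on T (u \<circ> coord_inv \<kappa> q)"
      using T x W(2) by (intro exI[of _ ?T]) auto
  qed
next
  assume u: "\<forall>q. smooth_on (coord \<kappa> q ` (chart_dom \<kappa> q \<inter> S)) (u \<circ> coord_inv \<kappa> q)"
  show "smooth_map_on S \<kappa> vec_charts u"
  proof (rule smooth_map_on_openI)
    fix p assume p: "p \<in> S"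
    show "\<exists>W. open W \<and> p \<in> W \<and> W \<subseteq> chart_dom \<kappa> p \<and> u ` W \<subseteq> chart_dom vec_charts (u p) \<and>
      smooth_on (coord \<kappa> p ` W) (coord vec_charts (u p) \<circ> u \<circ> coord_inv \<kappa> p)"
      using u p by (intro exI[of _ "chart_dom \<kappa> p \<inter> S"])
        (auto simp: comp_def open_chart_dom[OF M] chart_dom_mem[OF M] S open_Int)
  qed
qed

lemma smooth_map_on_coord: "smooth_manifold \<kappa> \<Longrightarrow> smooth_map_on (chart_dom \<kappa> q) \<kappa> vec_charts (coord \<kappa> q)"
  by (simp add: smooth_map_on_vec_iff open_chart_dom smooth_transition)

lemma smooth_map_on_coord_inv:
  assumes M: "smooth_manifold \<kappa>"
  shows "smooth_map_on (coord \<kappa> q ` chart_dom \<kappa> q) vec_charts \<kappa> (coord_inv \<kappa> q)"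
proof (rule smooth_map_on_openI)
  fix y assume "y \<in> coord \<kappa> q ` chart_dom \<kappa> q"
  then obtain x where x: "x \<in> chart_dom \<kappa> q" "y = coord \<kappa> q x" by auto
  then show "\<exists>W. open W \<and> y \<in> W \<and> W \<subseteq> chart_dom vec_charts y \<and>
      coord_inv \<kappa> q ` W \<subseteq> chart_dom \<kappa> (coord_inv \<kappa> q y) \<and>
      smooth_on (coord vec_charts y ` W) (coord \<kappa> (coord_inv \<kappa> q y) \<circ> coord_inv \<kappa> q \<circ> coord_inv vec_charts y)"
    \<comment> \<open>As \<open>coord_inv \<kappa> q y\<close> is \<open>x\<close>, the
      representation in the preferred chart there is a transition map.\<close>
    using smooth_transition[OF M, of q x]
    by (intro exI[of _ "coord \<kappa> q ` (chart_dom \<kappa> q \<inter> chart_dom \<kappa> x)"])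
       (auto simp: coord_inv_coord[OF M] comp_def chart_dom_mem[OF M] intro!: open_coord_image open_Int open_chart_dom M)
qed

subsection \<open>Tangent maps\<close>

lemma tangent_map_vec_vec: "tangent_map vec_charts vec_charts f x = frechet_derivative f (at x)"
  by (simp add: tangent_map_def comp_def)

lemma smooth_map_on_has_derivative:
  assumes "smooth_manifold \<kappa>" "smooth_map_on S \<kappa> \<kappa>' F" "open S" "p \<in> S"
  shows "((coord \<kappa>' (F p) \<circ> F \<circ> coord_inv \<kappa> p) has_derivative tangent_map \<kappa> \<kappa>' F p) (at (coord \<kappa> p p))"
proof -
  obtain W where "p \<in> W" "smooth_on (coord \<kappa> p ` W) (coord \<kappa>' (F p) \<circ> F \<circ> coord_inv \<kappa> p)"
    by (rule smooth_map_on_openE[OF assms(2-4,1)]) (rule that)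
  then show ?thesis
    unfolding tangent_map_def by (intro smooth_on_has_derivative) auto
qed

lemma linear_tangent_map:
  assumes "smooth_manifold \<kappa>" "smooth_map_on S \<kappa> \<kappa>' F" "open S" "p \<in> S"
  shows "linear (tangent_map \<kappa> \<kappa>' F p)"
  using has_derivative_linear[OF smooth_map_on_has_derivative[OF assms]] .

lemma tangent_map_cong:
  assumes "smooth_manifold \<kappa>" "open W" "p \<in> W" "\<And>q. q \<in> W \<Longrightarrow> F q = G q"
  shows "tangent_map \<kappa> \<kappa>' F p = tangent_map \<kappa> \<kappa>' G p"
proof -
  have "frechet_derivative (coord \<kappa>' (G p) \<circ> F \<circ> coord_inv \<kappa> p) (at (coord \<kappa> p p)) =
      frechet_derivative (coord \<kappa>' (G p) \<circ> G \<circ> coord_inv \<kappa> p) (at (coord \<kappa> p p))"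
    using assms chart_dom_mem[OF assms(1), of p]
    by (intro frechet_derivative_cong_open[of "coord \<kappa> p ` (W \<inter> chart_dom \<kappa> p)"]
        open_coord_image open_Int open_chart_dom) (auto simp: coord_inv_coord)
  then show ?thesis
    using assms(3,4) by (simp add: tangent_map_def)
qed

text \<open>Both representations use the preferred chart at \<open>F p\<close>, so near
  \<open>p\<close> that chart cancels and the Euclidean chain rule applies.\<close>

lemma tangent_map_compose:
  assumes M: "smooth_manifold \<kappa>" and M': "smooth_manifold \<kappa>'"
    and F: "smooth_map_on S \<kappa> \<kappa>' F" "open S" "p \<in> S"
    and G: "smooth_map_on T \<kappa>' \<kappa>'' G" "open T" "F p \<in> T"
  shows "tangent_map \<kappa> \<kappa>'' (\<lambda>x. G (F x)) p a = tangent_map \<kappa>' \<kappa>'' G (F p) (tangent_map \<kappa> \<kappa>' F p a)"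
proof -
  obtain W where W: "open W" "p \<in> W" "W \<subseteq> chart_dom \<kappa> p" "F ` W \<subseteq> chart_dom \<kappa>' (F p)"
    by (rule smooth_map_on_openE[OF F M]) (rule that)
  let ?f = "coord \<kappa>' (F p) \<circ> F \<circ> coord_inv \<kappa> p" and ?g = "coord \<kappa>'' (G (F p)) \<circ> G \<circ> coord_inv \<kappa>' (F p)"
  have fp: "?f (coord \<kappa> p p) = coord \<kappa>' (F p) (F p)"
    by (simp add: coord_inv_coord chart_dom_mem M)
  have "((\<lambda>y. ?g (?f y)) has_derivative (\<lambda>a. tangent_map \<kappa>' \<kappa>'' G (F p) (tangent_map \<kappa> \<kappa>' F p a))) (at (coord \<kappa> p p))"
    using has_derivative_compose[OF smooth_map_on_has_derivative[OF M F]]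
      smooth_map_on_has_derivative[OF M' G] fp by metis
  then have "((coord \<kappa>'' (G (F p)) \<circ> (\<lambda>x. G (F x)) \<circ> coord_inv \<kappa> p) has_derivative
      (\<lambda>a. tangent_map \<kappa>' \<kappa>'' G (F p) (tangent_map \<kappa> \<kappa>' F p a))) (at (coord \<kappa> p p))"
  proof (rule has_derivative_transform_within_open)
    show "open (coord \<kappa> p ` W)" "coord \<kappa> p p \<in> coord \<kappa> p ` W"
      using W by (auto intro!: open_coord_image M)
    show "?g (?f y) = (coord \<kappa>'' (G (F p)) \<circ> (\<lambda>x. G (F x)) \<circ> coord_inv \<kappa> p) y"
      if "y \<in> coord \<kappa> p ` W" for y
      using that W by (auto simp: coord_inv_coord M M' subset_iff)
  qed
  from frechet_derivative_at[OF this] show ?thesis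
    by (simp add: tangent_map_def[of \<kappa> \<kappa>'']) metis
qed

lemma tangent_map_const: "tangent_map \<kappa> \<kappa>' (\<lambda>x. c) p a = 0"
  by (simp add: tangent_map_def comp_def)

lemma tangent_map_ident:
  assumes "smooth_manifold \<kappa>"
  shows "tangent_map \<kappa> \<kappa> (\<lambda>x. x) p a = a"
proof -
  have "frechet_derivative (coord \<kappa> p \<circ> (\<lambda>x. x) \<circ> coord_inv \<kappa> p) (at (coord \<kappa> p p)) =
      frechet_derivative (\<lambda>y. y) (at (coord \<kappa> p p))"
    by (rule frechet_derivative_cong_open[of "coord \<kappa> p ` chart_dom \<kappa> p"])
       (auto simp: coord_inv_coord chart_dom_mem assms intro!: open_coord_image open_chart_dom)
  then show ?thesis
    by (simp add: tangent_map_def)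
qed

lemma tangent_map_Pair:
  assumes "smooth_manifold \<kappa>" "open S" "p \<in> S" "smooth_map_on S \<kappa> \<kappa>\<^sub>1 F" "smooth_map_on S \<kappa> \<kappa>\<^sub>2 G"
  shows "tangent_map \<kappa> (prod_charts \<kappa>\<^sub>1 \<kappa>\<^sub>2) (\<lambda>x. (F x, G x)) p a = (tangent_map \<kappa> \<kappa>\<^sub>1 F p a, tangent_map \<kappa> \<kappa>\<^sub>2 G p a)"
proof -
  have "((coord (prod_charts \<kappa>\<^sub>1 \<kappa>\<^sub>2) (F p, G p) \<circ> (\<lambda>x. (F x, G x)) \<circ> coord_inv \<kappa> p) has_derivative
      (\<lambda>a. (tangent_map \<kappa> \<kappa>\<^sub>1 F p a, tangent_map \<kappa> \<kappa>\<^sub>2 G p a))) (at (coord \<kappa> p p))"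
    using has_derivative_Pair[OF smooth_map_on_has_derivative[OF assms(1,4,2,3)]
        smooth_map_on_has_derivative[OF assms(1,5,2,3)]]
    by (simp add: coord_prod comp_def)
  from frechet_derivative_at[OF this] show ?thesis
    by (simp add: tangent_map_def[of \<kappa> "prod_charts \<kappa>\<^sub>1 \<kappa>\<^sub>2"]) metis
qed

text \<open>This is the chain rule for \<open>u\<close> written as
  \<open>u \<circ> coord_inv \<kappa> q\<close> after \<open>coord \<kappa> q\<close>. It expresses
  the differential at every \<open>x\<close> of a chart domain in the one chart \<open>q\<close>,
  although vectors at \<open>x\<close> are written in the chart of \<open>x\<close>; this is how
  dependence on \<open>x\<close> is studied.\<close>

lemma tangent_map_in_chart:
  assumes M: "smooth_manifold \<kappa>" and u: "smooth_map_on S \<kappa> vec_charts u" "open S" "x \<in> S" "x \<in> chart_dom \<kappa> q"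
  shows "tangent_map \<kappa> vec_charts u x a =
    frechet_derivative (u \<circ> coord_inv \<kappa> q) (at (coord \<kappa> q x)) (tangent_map \<kappa> vec_charts (coord \<kappa> q) x a)"
proof -
  let ?T = "coord \<kappa> q ` (chart_dom \<kappa> q \<inter> S)"
  have T: "open ?T" by (intro open_coord_image M open_Int open_chart_dom u) auto
  have "tangent_map \<kappa> vec_charts u x a = tangent_map \<kappa> vec_charts (\<lambda>x. (u \<circ> coord_inv \<kappa> q) (coord \<kappa> q x)) x a"
    using u by (intro arg_cong[where f = "\<lambda>D. D a", OF tangent_map_cong[of \<kappa> "chart_dom \<kappa> q"]])
       (auto simp: coord_inv_coord M intro!: open_chart_dom)
  also have "\<dots> = tangent_map vec_charts vec_charts (u \<circ> coord_inv \<kappa> q) (coord \<kappa> q x) (tangent_map \<kappa> vec_charts (coord \<kappa> q) x a)"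
    using u T
    by (intro tangent_map_compose[OF M smooth_manifold_vec_charts smooth_map_on_coord[OF M] _ _
          smooth_map_on_vec_vec[OF T smooth_map_on_vec_iff[OF M u(2), THEN iffD1, OF u(1), THEN spec]]]
         open_chart_dom M) auto
  finally show ?thesis by (simp add: tangent_map_vec_vec)
qed

subsection \<open>Smooth functions\<close>

lemma smooth_map_on_local:
  assumes "smooth_manifold \<kappa>" "\<And>p. p \<in> S \<Longrightarrow> \<exists>T. open T \<and> p \<in> T \<and> smooth_map_on T \<kappa> \<kappa>' F"
  shows "smooth_map_on S \<kappa> \<kappa>' F"
proof (rule smooth_map_on_openI)
  fix p assume "p \<in> S"
  then obtain T where T: "open T" "p \<in> T" "smooth_map_on T \<kappa> \<kappa>' F"
    using assms(2) by blast
  obtain W where "open W" "p \<in> W" "W \<subseteq> chart_dom \<kappa> p" "F ` W \<subseteq> chart_dom \<kappa>' (F p)"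
    "smooth_on (coord \<kappa> p ` W) (coord \<kappa>' (F p) \<circ> F \<circ> coord_inv \<kappa> p)"
    by (rule smooth_map_on_openE[OF T(3,1,2) assms(1)]) (rule that)
  then show "\<exists>W. open W \<and> p \<in> W \<and> W \<subseteq> chart_dom \<kappa> p \<and> F ` W \<subseteq> chart_dom \<kappa>' (F p) \<and>
      smooth_on (coord \<kappa> p ` W) (coord \<kappa>' (F p) \<circ> F \<circ> coord_inv \<kappa> p)"
    by (intro exI[of _ W] conjI)
qed

lemma smooth_map_on_vec_compose:
  assumes "smooth_manifold \<kappa>" "smooth_map_on S \<kappa> vec_charts u" "open T" "smooth_on T \<phi>" "u ` S \<subseteq> T"
  shows "smooth_map_on S \<kappa> vec_charts (\<lambda>x. \<phi> (u x))"
  using smooth_map_on_compose[OF assms(1) smooth_manifold_vec_charts assms(2)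
      smooth_map_on_vec_vec[OF assms(3,4)] assms(5)] .

lemma smooth_map_on_add:
  assumes M: "smooth_manifold \<kappa>" "open S"
    and "smooth_map_on S \<kappa> vec_charts u" "smooth_map_on S \<kappa> vec_charts v"
  shows "smooth_map_on S \<kappa> vec_charts (\<lambda>x. u x + v x)"
  using assms(3,4) unfolding smooth_map_on_vec_iff[OF M] comp_def
  by (intro allI smooth_on_add open_coord_image open_Int open_chart_dom M) auto

lemma smooth_map_on_mult:
  fixes u v :: "'a::{t2_space, second_countable_topology} \<Rightarrow> real"
  assumes M: "smooth_manifold \<kappa>" "open S"
    and "smooth_map_on S \<kappa> vec_charts u" "smooth_map_on S \<kappa> vec_charts v"
  shows "smooth_map_on S \<kappa> vec_charts (\<lambda>x. u x * v x)"
  using assms(3,4) unfolding smooth_map_on_vec_iff[OF M] comp_def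
  by (intro allI smooth_on_mult open_coord_image open_Int open_chart_dom M) auto

lemma smooth_fun_inverse:
  fixes u :: "'a::{t2_space, second_countable_topology} \<Rightarrow> real"
  assumes "smooth_manifold \<kappa>" "smooth_fun \<kappa> u" "\<And>p. u p \<noteq> 0"
  shows "smooth_fun \<kappa> (\<lambda>p. inverse (u p))"
  using smooth_map_on_vec_compose[OF assms(1,2) _ smooth_on_inverse] assms(3)
  by (metis ComplI image_subsetI open_Compl closed_singleton singletonD)

lemma smooth_fun_ln:
  fixes u :: "'a::{t2_space, second_countable_topology} \<Rightarrow> real"
  assumes "smooth_manifold \<kappa>" "smooth_fun \<kappa> u" "\<And>p. u p > 0"
  shows "smooth_fun \<kappa> (\<lambda>p. ln (u p))"
  using smooth_map_on_vec_compose[OF assms(1,2) _ smooth_on_ln] assms(3) by auto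

section \<open>Differentials of real functions\<close>

lemma smooth_fun_has_derivative:
  assumes "smooth_manifold \<kappa>" "smooth_fun \<kappa> u"
  shows "((u \<circ> coord_inv \<kappa> p) has_derivative differential \<kappa> u p) (at (coord \<kappa> p p))"
  using smooth_map_on_has_derivative[OF assms open_UNIV UNIV_I] by (simp add: differential_def comp_def)

lemma differential_eqI:
  "((u \<circ> coord_inv \<kappa> p) has_derivative L) (at (coord \<kappa> p p)) \<Longrightarrow> differential \<kappa> u p = L"
  using frechet_derivative_at by (auto simp: differential_def tangent_map_def comp_def)

lemma linear_differential: "smooth_manifold \<kappa> \<Longrightarrow> smooth_fun \<kappa> u \<Longrightarrow> linear (differential \<kappa> u p)"
  using has_derivative_linear[OF smooth_fun_has_derivative] .

lemma differential_const: "differential \<kappa> (\<lambda>x. c) p a = 0"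
  by (simp add: differential_def tangent_map_const)

lemma differential_add:
  assumes "smooth_manifold \<kappa>" "smooth_fun \<kappa> u" "smooth_fun \<kappa> v"
  shows "differential \<kappa> (\<lambda>x. u x + v x) p a = differential \<kappa> u p a + differential \<kappa> v p a"
  using has_derivative_add[OF smooth_fun_has_derivative[OF assms(1,2)] smooth_fun_has_derivative[OF assms(1,3)]]
  by (subst differential_eqI) (auto simp: comp_def)

lemma differential_mult:
  assumes "smooth_manifold \<kappa>" "smooth_fun \<kappa> u" "smooth_fun \<kappa> v"
  shows "differential \<kappa> (\<lambda>x. u x * v x) p a = u p * differential \<kappa> v p a + differential \<kappa> u p a * v p"
proof -
  have "((\<lambda>y. (u \<circ> coord_inv \<kappa> p) y * (v \<circ> coord_inv \<kappa> p) y) has_derivative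
      (\<lambda>a. u p * differential \<kappa> v p a + differential \<kappa> u p a * v p)) (at (coord \<kappa> p p))"
    using has_derivative_mult[OF smooth_fun_has_derivative[OF assms(1,2)] smooth_fun_has_derivative[OF assms(1,3)], of p]
    by (simp add: coord_inv_coord chart_dom_mem assms(1))
  from differential_eqI[of "\<lambda>x. u x * v x", unfolded comp_def, OF this[unfolded comp_def]] show ?thesis
    by simp
qed

lemma differential_compose_real:
  assumes "smooth_manifold \<kappa>" "smooth_fun \<kappa> u" "(\<phi> has_real_derivative d) (at (u p))"
  shows "differential \<kappa> (\<lambda>x. \<phi> (u x)) p a = d * differential \<kappa> u p a"
proof -
  have "(\<phi> has_derivative (*) d) (at ((u \<circ> coord_inv \<kappa> p) (coord \<kappa> p p)))"
    using assms(3) by (simp add: coord_inv_coord chart_dom_mem assms(1) has_field_derivative_def)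
  from has_derivative_compose[OF smooth_fun_has_derivative[OF assms(1,2)] this]
  show ?thesis
    by (subst differential_eqI) (auto simp: comp_def)
qed

subsection \<open>Cutting off\<close>

text \<open>The cutoff is a bump function in coordinates, supported in the preimage of a closed
  ball. That preimage is compact, hence closed in a Hausdorff space, so its complement and the chart
  domain form an open cover; on the former the product with \<open>w\<close> vanishes, on the latter
  it is smooth. Thus functions smooth only on the chart domain become global.\<close>

lemma ex_cutoff:
  fixes \<kappa> :: "('a::{t2_space, second_countable_topology}, 'e::euclidean_space) charts"
  assumes M: "smooth_manifold \<kappa>" and p: "p \<in> chart_dom \<kappa> q"
  obtains \<theta> :: "'a \<Rightarrow> real" where "smooth_fun \<kappa> \<theta>" "\<theta> p = 1"
    "\<And>w :: 'a \<Rightarrow> real. smooth_map_on (chart_dom \<kappa> q) \<kappa> vec_charts w \<Longrightarrow>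
      smooth_fun \<kappa> (\<lambda>x. if x \<in> chart_dom \<kappa> q then \<theta> x * w x else 0)"
    "\<And>x. x \<notin> chart_dom \<kappa> q \<Longrightarrow> \<theta> x = 0"
proof -
  let ?U = "chart_dom \<kappa> q"
  have "open (coord \<kappa> q ` ?U)"
    by (intro open_coord_image open_chart_dom M) auto
  then obtain r where r: "r > 0" "cball (coord \<kappa> q p) r \<subseteq> coord \<kappa> q ` ?U"
    using p by (auto simp: open_contains_cball)
  obtain \<beta> :: "'e \<Rightarrow> real" where \<beta>: "smooth_on UNIV \<beta>" "\<beta> (coord \<kappa> q p) = 1"
    "\<And>y. y \<notin> cball (coord \<kappa> q p) r \<Longrightarrow> \<beta> y = 0"
    using ex_smooth_bump[OF r(1)] by blast
  define \<theta> where "\<theta> x = (if x \<in> ?U then \<beta> (coord \<kappa> q x) else 0)" for x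
  define K where "K = coord_inv \<kappa> q ` cball (coord \<kappa> q p) r"
  have "compact K"
    unfolding K_def
    by (intro compact_continuous_image continuous_on_subset[OF continuous_on_coord_inv[OF M] r(2)] compact_cball)
  then have K: "open (- K)"
    using compact_imp_closed by auto
  have KU: "K \<subseteq> ?U"
    using r(2) by (force simp: K_def coord_inv_coord[OF M])
  have ext: "smooth_fun \<kappa> (\<lambda>x. if x \<in> ?U then \<theta> x * w x else 0)" (is "smooth_fun \<kappa> ?g")
    if w: "smooth_map_on ?U \<kappa> vec_charts w" for w :: "'a \<Rightarrow> real"
  proof (rule smooth_map_on_local[OF M])
    fix x
    show "\<exists>T. open T \<and> x \<in> T \<and> smooth_map_on T \<kappa> vec_charts ?g"
    proof (cases "x \<in> ?U")
      case True
      have "smooth_map_on ?U \<kappa> vec_charts (\<lambda>x. \<beta> (coord \<kappa> q x) * w x)"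
        by (intro smooth_map_on_mult smooth_map_on_vec_compose[OF M smooth_map_on_coord[OF M] open_UNIV \<beta>(1)]
            open_chart_dom M w) auto
      then have "smooth_map_on ?U \<kappa> vec_charts ?g"
        by (rule smooth_map_on_cong_subset) (auto simp: \<theta>_def)
      then show ?thesis
        using True open_chart_dom[OF M] by blast
    next
      case False
      have "?g y = 0" if "y \<in> - K" for y
        using that \<beta>(3)[of "coord \<kappa> q y"] coord_inv_coord[OF M, of y q] by (force simp: K_def \<theta>_def)
      then have "smooth_map_on (- K) \<kappa> vec_charts ?g"
        by (intro smooth_map_on_cong_subset[OF smooth_map_on_const[OF M smooth_manifold_vec_charts]]) auto
      then show ?thesis
        using False K KU by blast
    qed
  qed
  \<comment> \<open>Smoothness of the cutoff itself is the case \<open>w = 1\<close>.\<close>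
  have "smooth_fun \<kappa> (\<lambda>x. if x \<in> ?U then \<theta> x * 1 else 0)"
    by (intro ext smooth_map_on_const M smooth_manifold_vec_charts)
  then have "smooth_fun \<kappa> \<theta>"
    by (rule smooth_map_on_cong_subset) (auto simp: \<theta>_def)
  then show thesis
    using ext \<beta>(2) p by (intro that[of \<theta>]) (auto simp: \<theta>_def)
qed

subsection \<open>Vector fields\<close>

text \<open>In the chart \<open>q\<close> this is the derivative of the representation of
  \<open>u\<close>, applied to the components of \<open>X\<close>, which are smooth by the
  definition of \<open>vector_field\<close>.\<close>

lemma smooth_fun_deriv_along:
  assumes M: "smooth_manifold \<kappa>" and X: "vector_field \<kappa> X" and u: "smooth_fun \<kappa> u"
  shows "smooth_fun \<kappa> (deriv_along \<kappa> X u)"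
  unfolding smooth_map_on_vec_iff[OF M open_UNIV]
proof
  fix q
  let ?U = "coord \<kappa> q ` chart_dom \<kappa> q"
  have U: "open ?U" by (intro open_coord_image open_chart_dom M) auto
  have "smooth_on ?U (u \<circ> coord_inv \<kappa> q)"
    using u by (simp add: smooth_map_on_vec_iff[OF M open_UNIV])
  moreover have "smooth_on ?U (\<lambda>y. tangent_map \<kappa> vec_charts (coord \<kappa> q) (coord_inv \<kappa> q y) (X (coord_inv \<kappa> q y)))"
    using X by (simp add: vector_field_def)
  ultimately have "smooth_on ?U (\<lambda>y. frechet_derivative (u \<circ> coord_inv \<kappa> q) (at y)
      (tangent_map \<kappa> vec_charts (coord \<kappa> q) (coord_inv \<kappa> q y) (X (coord_inv \<kappa> q y))))"
    by (intro smooth_on_frechet_derivative_apply[OF U U _ smooth_on_id]) auto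
  then show "smooth_on (coord \<kappa> q ` (chart_dom \<kappa> q \<inter> UNIV)) (deriv_along \<kappa> X u \<circ> coord_inv \<kappa> q)"
    unfolding Int_UNIV_right
  proof (rule smooth_on_cong[OF U])
    fix y assume "y \<in> ?U"
    then obtain x where x: "x \<in> chart_dom \<kappa> q" "y = coord \<kappa> q x" by auto
    then have inv: "coord_inv \<kappa> q y = x" by (simp add: coord_inv_coord M)
    show "(deriv_along \<kappa> X u \<circ> coord_inv \<kappa> q) y = frechet_derivative (u \<circ> coord_inv \<kappa> q) (at y)
        (tangent_map \<kappa> vec_charts (coord \<kappa> q) (coord_inv \<kappa> q y) (X (coord_inv \<kappa> q y)))"
      unfolding comp_apply differential_def inv
      unfolding x(2)
      by (rule tangent_map_in_chart[OF M u open_UNIV UNIV_I x(1), unfolded comp_def])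
  qed
qed

text \<open>The components of the field are recovered from its values on the coordinate functions,
  which become global functions after multiplication with a cutoff.\<close>

lemma vector_fieldI:
  assumes M: "smooth_manifold \<kappa>" and X: "\<And>u. smooth_fun \<kappa> u \<Longrightarrow> smooth_fun \<kappa> (deriv_along \<kappa> X u)"
  shows "vector_field \<kappa> X"
  unfolding vector_field_def
proof
  fix q
  let ?U = "chart_dom \<kappa> q"
  let ?X = "\<lambda>x. tangent_map \<kappa> vec_charts (coord \<kappa> q) x (X x)"
  have "smooth_map_on ?U \<kappa> vec_charts ?X"
  proof (rule smooth_map_on_local[OF M])
    fix p assume p: "p \<in> ?U"
    obtain \<theta> where \<theta>: "smooth_fun \<kappa> \<theta>" "\<theta> p = 1"
      "\<And>w :: _ \<Rightarrow> real. smooth_map_on ?U \<kappa> vec_charts w \<Longrightarrow> smooth_fun \<kappa> (\<lambda>x. if x \<in> ?U then \<theta> x * w x else 0)"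
      by (rule ex_cutoff[OF M p]) (rule that)
    \<comment> \<open>The component formula below divides by the cutoff, so it is confined to where
      the cutoff does not vanish.\<close>
    define T where "T = ?U \<inter> \<theta> -` (- {0})"
    have "continuous_on UNIV \<theta>"
      using smooth_map_on_imp_continuous_on[OF M smooth_manifold_vec_charts open_UNIV \<theta>(1)] .
    then have T: "open T" "p \<in> T" "T \<subseteq> ?U"
      using p \<theta>(2) by (auto simp: T_def intro!: open_Int open_chart_dom[OF M] open_vimage)
    define w where "w b x = (if x \<in> ?U then \<theta> x * (coord \<kappa> q x \<bullet> b) else 0)" for b x
    have lin: "smooth_map_on ?U \<kappa> vec_charts (\<lambda>x. coord \<kappa> q x \<bullet> b)" for b
      by (intro smooth_map_on_vec_compose[OF M smooth_map_on_coord[OF M] open_UNIV, where \<phi> = "\<lambda>y. y \<bullet> b"]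
          smooth_on_inner_right smooth_on_id) auto
    have w: "smooth_fun \<kappa> (w b)" for b
      unfolding w_def by (intro \<theta> lin)
    \<comment> \<open>The Leibniz rule for the cutoff times the coordinate function in direction
      \<open>b\<close>, solved for the derivative of that coordinate, which is the component of
      \<open>X\<close>.\<close>
    have comp: "?X x \<bullet> b = (deriv_along \<kappa> X (w b) x - (coord \<kappa> q x \<bullet> b) * deriv_along \<kappa> X \<theta> x) * inverse (\<theta> x)"
      if x: "x \<in> T" for x b
    proof -
      have xU: "x \<in> ?U" "\<theta> x \<noteq> 0" using x by (auto simp: T_def)
      let ?c = "coord \<kappa> q x"
      let ?d = "\<lambda>u. frechet_derivative (u \<circ> coord_inv \<kappa> q) (at ?c)"
      have d: "differential \<kappa> u x a = ?d u (tangent_map \<kappa> vec_charts (coord \<kappa> q) x a)" if "smooth_fun \<kappa> u" for u a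
        unfolding differential_def by (intro tangent_map_in_chart[OF M that] xU) auto
      have der: "((u \<circ> coord_inv \<kappa> q) has_derivative ?d u) (at ?c)" if "smooth_fun \<kappa> u" for u :: "_ \<Rightarrow> real"
        using that xU by (intro smooth_on_has_derivative[of "coord \<kappa> q ` ?U"])
          (auto simp: smooth_map_on_vec_iff[OF M open_UNIV])
      have "((\<lambda>y. (\<theta> \<circ> coord_inv \<kappa> q) y * (y \<bullet> b)) has_derivative
          (\<lambda>a. \<theta> x * (a \<bullet> b) + ?d \<theta> a * (?c \<bullet> b))) (at ?c)"
        using has_derivative_mult[OF der[OF \<theta>(1)] has_derivative_inner_left[OF has_derivative_ident, of b]]
        by (simp add: coord_inv_coord M xU)
      then have "((w b \<circ> coord_inv \<kappa> q) has_derivative (\<lambda>a. \<theta> x * (a \<bullet> b) + ?d \<theta> a * (?c \<bullet> b))) (at ?c)"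
        by (rule has_derivative_transform_within_open[where s = "coord \<kappa> q ` ?U"])
           (use xU in \<open>auto simp: w_def coord_inv_coord M intro!: open_coord_image open_chart_dom\<close>)
      note eq = frechet_derivative_at[OF this, symmetric]
      have "deriv_along \<kappa> X (w b) x = \<theta> x * (?X x \<bullet> b) + deriv_along \<kappa> X \<theta> x * (?c \<bullet> b)"
        unfolding d[OF w] d[OF \<theta>(1)] eq ..
      then show ?thesis
        using xU by (simp add: field_simps)
    qed
    have inv: "smooth_map_on T \<kappa> vec_charts (\<lambda>x. inverse (\<theta> x))"
      by (rule smooth_map_on_vec_compose[OF M smooth_map_on_subset[OF \<theta>(1)] _ smooth_on_inverse])
         (auto simp: T_def)
    have "smooth_map_on T \<kappa> vec_charts (\<lambda>x. (deriv_along \<kappa> X (w b) x + (coord \<kappa> q x \<bullet> b) * ((- 1) * deriv_along \<kappa> X \<theta> x)) * inverse (\<theta> x))" for b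
      using T by (intro smooth_map_on_mult smooth_map_on_add inv M smooth_map_on_subset[OF X[OF w]]
        smooth_map_on_subset[OF X[OF \<theta>(1)]] smooth_map_on_subset[OF lin] smooth_map_on_const smooth_manifold_vec_charts) auto
    then have "smooth_map_on T \<kappa> vec_charts (\<lambda>x. ?X x \<bullet> b)" for b
      by (rule smooth_map_on_cong_subset) (auto simp: comp)
    then have "smooth_on (coord \<kappa> r ` (chart_dom \<kappa> r \<inter> T)) (\<lambda>y. \<Sum>b\<in>Basis. ((\<lambda>x. ?X x \<bullet> b) \<circ> coord_inv \<kappa> r) y *\<^sub>R b)" for r
      unfolding smooth_map_on_vec_iff[OF M T(1)] comp_def
      by (intro smooth_on_sum smooth_on_scaleR smooth_on_const open_coord_image open_Int open_chart_dom M T) auto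
    then have "smooth_map_on T \<kappa> vec_charts ?X"
      by (simp add: smooth_map_on_vec_iff[OF M T(1)] comp_def euclidean_representation)
    then show "\<exists>T. open T \<and> p \<in> T \<and> smooth_map_on T \<kappa> vec_charts ?X"
      using T by blast
  qed
  then show "smooth_on (coord \<kappa> q ` ?U) (\<lambda>y. ?X (coord_inv \<kappa> q y))"
    by (auto simp: smooth_map_on_vec_iff[OF M open_chart_dom[OF M]] comp_def dest!: spec[of _ q])
qed

section \<open>Sums, multiples and coordinate frames of vector fields\<close>

lemma differential_linear:
  assumes "smooth_manifold \<kappa>" "smooth_fun \<kappa> u"
  shows "differential \<kappa> u p (a + b) = differential \<kappa> u p a + differential \<kappa> u p b"
    "differential \<kappa> u p (c *\<^sub>R a) = c * differential \<kappa> u p a"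
    "differential \<kappa> u p 0 = 0"
  using linear_differential[OF assms] by (simp_all add: linear_add linear_cmul linear_0)

lemma vector_field_add:
  assumes M: "smooth_manifold \<kappa>" and X: "vector_field \<kappa> X" and Y: "vector_field \<kappa> Y"
  shows "vector_field \<kappa> (\<lambda>p. X p + Y p)"
proof (rule vector_fieldI[OF M])
  fix u assume u: "smooth_fun \<kappa> u"
  show "smooth_fun \<kappa> (deriv_along \<kappa> (\<lambda>p. X p + Y p) u)"
    unfolding differential_linear(1)[OF M u]
    by (intro smooth_map_on_add smooth_fun_deriv_along M X Y u open_UNIV)
qed

lemma vector_field_scaleR:
  assumes M: "smooth_manifold \<kappa>" and w: "smooth_fun \<kappa> w" and X: "vector_field \<kappa> X"
  shows "vector_field \<kappa> (\<lambda>p. w p *\<^sub>R X p)"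
proof (rule vector_fieldI[OF M])
  fix u assume u: "smooth_fun \<kappa> u"
  show "smooth_fun \<kappa> (deriv_along \<kappa> (\<lambda>p. w p *\<^sub>R X p) u)"
    unfolding differential_linear(2)[OF M u]
    by (intro smooth_map_on_mult smooth_fun_deriv_along M X w u open_UNIV)
qed

lemma vector_field_zero:
  assumes M: "smooth_manifold \<kappa>"
  shows "vector_field \<kappa> (\<lambda>p. 0)"
  by (rule vector_fieldI[OF M])
     (simp add: differential_linear(3)[OF M] smooth_map_on_const[OF M smooth_manifold_vec_charts])

lemma vector_field_sum:
  assumes M: "smooth_manifold \<kappa>" and X: "\<And>i. i \<in> I \<Longrightarrow> vector_field \<kappa> (X i)"
  shows "vector_field \<kappa> (\<lambda>p. \<Sum>i\<in>I. X i p)"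
  using X by (induction I rule: infinite_finite_induct) (simp_all add: vector_field_zero[OF M] vector_field_add[OF M])

text \<open>For a basis vector \<open>v\<close> this is the coordinate vector field of the chart
  \<open>q\<close>, evaluated at \<open>x\<close> and written, like every tangent vector there, in
  the preferred chart of \<open>x\<close>.\<close>

definition frame_vector :: "('a, 'e::real_normed_vector) charts \<Rightarrow> 'a \<Rightarrow> 'e \<Rightarrow> 'a \<Rightarrow> 'e" where
  "frame_vector \<kappa> q v x = tangent_map vec_charts \<kappa> (coord_inv \<kappa> q) (coord \<kappa> q x) v"

text \<open>Everything is the chain rule: applied to \<open>coord_inv \<kappa> q\<close> after
  \<open>coord \<kappa> q\<close>, which is the identity near \<open>x\<close>, and to
  \<open>u\<close> after \<open>coord_inv \<kappa> q\<close>.\<close>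

lemma
  assumes M: "smooth_manifold \<kappa>" and x: "x \<in> chart_dom \<kappa> q"
  shows frame_vector_tangent_coord: "frame_vector \<kappa> q (tangent_map \<kappa> vec_charts (coord \<kappa> q) x a) x = a"
    and linear_frame_vector: "linear (\<lambda>v. frame_vector \<kappa> q v x)"
    and differential_frame_vector: "smooth_fun \<kappa> u \<Longrightarrow>
      differential \<kappa> u x (frame_vector \<kappa> q v x) = frechet_derivative (u \<circ> coord_inv \<kappa> q) (at (coord \<kappa> q x)) v"
proof -
  let ?U = "chart_dom \<kappa> q" and ?c = "coord \<kappa> q x"
  note V = smooth_manifold_vec_charts
  have U: "open (coord \<kappa> q ` ?U)" "?c \<in> coord \<kappa> q ` ?U"
    using x by (auto intro!: open_coord_image open_chart_dom M)
  have "tangent_map vec_charts \<kappa> (coord_inv \<kappa> q) ?c (tangent_map \<kappa> vec_charts (coord \<kappa> q) x a) =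
      tangent_map \<kappa> \<kappa> (\<lambda>x. coord_inv \<kappa> q (coord \<kappa> q x)) x a"
    by (rule tangent_map_compose[OF M V smooth_map_on_coord[OF M] open_chart_dom[OF M] x
          smooth_map_on_coord_inv[OF M] U, symmetric])
  also have "\<dots> = tangent_map \<kappa> \<kappa> (\<lambda>x. x) x a"
    by (rule arg_cong[where f = "\<lambda>D. D a", OF tangent_map_cong[OF M open_chart_dom[OF M] x]])
       (simp add: coord_inv_coord M)
  finally show "frame_vector \<kappa> q (tangent_map \<kappa> vec_charts (coord \<kappa> q) x a) x = a"
    by (simp add: frame_vector_def tangent_map_ident M)
  show "linear (\<lambda>v. frame_vector \<kappa> q v x)"
    unfolding frame_vector_def by (rule linear_tangent_map[OF V smooth_map_on_coord_inv[OF M] U])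
  assume u: "smooth_fun \<kappa> u"
  have "tangent_map vec_charts vec_charts (\<lambda>y. u (coord_inv \<kappa> q y)) ?c v =
      tangent_map \<kappa> vec_charts u (coord_inv \<kappa> q ?c) (tangent_map vec_charts \<kappa> (coord_inv \<kappa> q) ?c v)"
    by (rule tangent_map_compose[OF V M smooth_map_on_coord_inv[OF M] U u open_UNIV UNIV_I])
  then show "differential \<kappa> u x (frame_vector \<kappa> q v x) = frechet_derivative (u \<circ> coord_inv \<kappa> q) (at ?c) v"
    by (simp add: coord_inv_coord[OF M x] tangent_map_vec_vec frame_vector_def differential_def comp_def)
qed

text \<open>By \<open>vector_fieldI\<close> it suffices to differentiate global functions. The
  result is the cutoff times a directional derivative in the chart, a function smooth on the chart
  domain, to which \<open>\<theta>\<close> applies.\<close>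

lemma vector_field_cutoff_frame:
  assumes M: "smooth_manifold \<kappa>"
    and \<theta>: "\<And>w :: _ \<Rightarrow> real. smooth_map_on (chart_dom \<kappa> q) \<kappa> vec_charts w \<Longrightarrow>
      smooth_fun \<kappa> (\<lambda>x. if x \<in> chart_dom \<kappa> q then \<theta> x * w x else 0)"
  shows "vector_field \<kappa> (\<lambda>x. if x \<in> chart_dom \<kappa> q then \<theta> x *\<^sub>R frame_vector \<kappa> q v x else 0)"
proof (rule vector_fieldI[OF M])
  fix u assume u: "smooth_fun \<kappa> u"
  let ?U = "chart_dom \<kappa> q"
  let ?w = "\<lambda>x. frechet_derivative (u \<circ> coord_inv \<kappa> q) (at (coord \<kappa> q x)) v"
  have "smooth_on (coord \<kappa> q ` ?U) (u \<circ> coord_inv \<kappa> q)"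
    using u by (simp add: smooth_map_on_vec_iff[OF M open_UNIV])
  from smooth_map_on_vec_compose[OF M smooth_map_on_coord[OF M] open_coord_image[OF M open_chart_dom[OF M] order_refl]
      smooth_on_frechet_derivative[OF this] order_refl]
  have "smooth_map_on ?U \<kappa> vec_charts ?w" .
  then have "smooth_fun \<kappa> (\<lambda>x. if x \<in> ?U then \<theta> x * ?w x else 0)"
    by (rule \<theta>)
  then show "smooth_fun \<kappa> (deriv_along \<kappa> (\<lambda>x. if x \<in> ?U then \<theta> x *\<^sub>R frame_vector \<kappa> q v x else 0) u)"
    by (rule smooth_map_on_cong_subset)
       (auto simp: differential_linear[OF M u] differential_frame_vector[OF M _ u])
qed

text \<open>The field has constant components in the chart at \<open>p\<close>, apart from the
  cutoff. It extends single vectors to global fields, as the evaluation of \<open>hessian\<close>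
  requires.\<close>

lemma ex_vector_field:
  assumes M: "smooth_manifold \<kappa>"
  obtains Y where "vector_field \<kappa> Y" "Y p = b"
proof -
  obtain \<theta> where \<theta>: "smooth_fun \<kappa> \<theta>" "\<theta> p = 1"
    "\<And>w :: _ \<Rightarrow> real. smooth_map_on (chart_dom \<kappa> p) \<kappa> vec_charts w \<Longrightarrow>
      smooth_fun \<kappa> (\<lambda>x. if x \<in> chart_dom \<kappa> p then \<theta> x * w x else 0)"
    by (rule ex_cutoff[OF M chart_dom_mem[OF M]]) (rule that)
  show thesis
    by (rule that[OF vector_field_cutoff_frame[OF M \<theta>(3), of "tangent_map \<kappa> vec_charts (coord \<kappa> p) p b"]])
       (simp_all add: chart_dom_mem[OF M] \<theta>(2) frame_vector_tangent_coord[OF M])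
qed

text \<open>Multiplying \<open>Y\<close> by the square of a cutoff makes both the components of \<open>Y\<close> in a chart and
  the coordinate fields global.\<close>

lemma tensorial:
  fixes \<Phi> :: "('a::{t2_space, second_countable_topology} \<Rightarrow> 'e::euclidean_space) \<Rightarrow> real"
  assumes M: "smooth_manifold \<kappa>"
    and add: "\<And>X Y. vector_field \<kappa> X \<Longrightarrow> vector_field \<kappa> Y \<Longrightarrow> \<Phi> (\<lambda>q. X q + Y q) = \<Phi> X + \<Phi> Y"
    and scale: "\<And>u X. smooth_fun \<kappa> u \<Longrightarrow> vector_field \<kappa> X \<Longrightarrow> \<Phi> (\<lambda>q. u q *\<^sub>R X q) = u p * \<Phi> X"
    and Y: "vector_field \<kappa> Y" and Z: "vector_field \<kappa> Z" and eq: "Y p = Z p"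
  shows "\<Phi> Y = \<Phi> Z"
proof -
  note const = smooth_map_on_const[OF M smooth_manifold_vec_charts]
  have zero: "\<Phi> (\<lambda>q. 0) = 0"
    using scale[OF const Y, of 0] by simp
  have sum: "\<Phi> (\<lambda>q. \<Sum>i\<in>I. X i q) = (\<Sum>i\<in>I. \<Phi> (X i))" if "\<And>i. i \<in> I \<Longrightarrow> vector_field \<kappa> (X i)" for I :: "'e set" and X
    using that
    by (induction I rule: infinite_finite_induct) (simp_all add: zero add vector_field_sum[OF M])
  \<comment> \<open>By additivity it suffices to treat a field that vanishes at
    \<open>p\<close>.\<close>
  define V where "V q = Y q + (- 1) *\<^sub>R Z q" for q
  have V: "vector_field \<kappa> V" "V p = 0"
    unfolding V_def by (intro vector_field_add vector_field_scaleR const M Y Z, simp add: eq)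
  have YV: "\<Phi> V = \<Phi> Y - \<Phi> Z"
    unfolding V_def
    by (subst add[OF Y vector_field_scaleR[OF M const Z]]) (subst scale[OF const Z], simp)
  let ?U = "chart_dom \<kappa> p"
  obtain \<theta> where \<theta>: "smooth_fun \<kappa> \<theta>" "\<theta> p = 1"
    "\<And>w :: _ \<Rightarrow> real. smooth_map_on ?U \<kappa> vec_charts w \<Longrightarrow> smooth_fun \<kappa> (\<lambda>x. if x \<in> ?U then \<theta> x * w x else 0)"
    "\<And>x. x \<notin> ?U \<Longrightarrow> \<theta> x = 0"
    by (rule ex_cutoff[OF M chart_dom_mem[OF M]]) (rule that)
  define w where "w b x = (if x \<in> ?U then \<theta> x * (tangent_map \<kappa> vec_charts (coord \<kappa> p) x (V x) \<bullet> b) else 0)" for b x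
  define E where "E b x = (if x \<in> ?U then \<theta> x *\<^sub>R frame_vector \<kappa> p b x else 0)" for b x
  have E: "vector_field \<kappa> (E b)" for b
    unfolding E_def by (rule vector_field_cutoff_frame[OF M \<theta>(3)])
  have w: "smooth_fun \<kappa> (w b)" for b
    unfolding w_def
  proof (rule \<theta>(3))
    have oU: "open (coord \<kappa> p ` ?U)" by (intro open_coord_image open_chart_dom M) auto
    have "smooth_on (coord \<kappa> p ` ?U)
        (\<lambda>y. tangent_map \<kappa> vec_charts (coord \<kappa> p) (coord_inv \<kappa> p y) (V (coord_inv \<kappa> p y)) \<bullet> b)"
      using V(1) by (intro smooth_on_inner_right oU) (simp add: vector_field_def)
    from smooth_map_on_vec_compose[OF M smooth_map_on_coord[OF M] oU this order_refl]
    show "smooth_map_on ?U \<kappa> vec_charts (\<lambda>x. tangent_map \<kappa> vec_charts (coord \<kappa> p) x (V x) \<bullet> b)"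
      by (rule smooth_map_on_cong_subset) (simp_all add: coord_inv_coord[OF M])
  qed
  have wp: "w b p = 0" for b
    using linear_0[OF linear_tangent_map[OF M smooth_map_on_coord[OF M, of p] open_chart_dom[OF M] chart_dom_mem[OF M]]]
    by (simp add: w_def V)
  have "(\<theta> x * \<theta> x) *\<^sub>R V x = (\<Sum>b\<in>Basis. w b x *\<^sub>R E b x)" for x
  proof (cases "x \<in> ?U")
    case True
    have "V x = (\<Sum>b\<in>Basis. (tangent_map \<kappa> vec_charts (coord \<kappa> p) x (V x) \<bullet> b) *\<^sub>R frame_vector \<kappa> p b x)"
      using linear_expand_Basis[OF linear_frame_vector[OF M True]] frame_vector_tangent_coord[OF M True] by metis
    then have "(\<theta> x * \<theta> x) *\<^sub>R V x =
        (\<theta> x * \<theta> x) *\<^sub>R (\<Sum>b\<in>Basis. (tangent_map \<kappa> vec_charts (coord \<kappa> p) x (V x) \<bullet> b) *\<^sub>R frame_vector \<kappa> p b x)"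
      by (rule arg_cong)
    then show ?thesis
      using True by (simp add: w_def E_def scaleR_sum_right ac_simps)
  qed (simp add: \<theta>(4) w_def E_def)
  \<comment> \<open>The squared cutoff is 1 at \<open>p\<close>, so the multiplication is invisible
    to \<open>\<Phi>\<close>; after the expansion each coefficient vanishes at \<open>p\<close>, so
    the sum contributes 0.\<close>
  moreover have "\<Phi> (\<lambda>x. (\<theta> x * \<theta> x) *\<^sub>R V x) = \<Phi> V"
    using scale[OF smooth_map_on_mult[OF M open_UNIV \<theta>(1) \<theta>(1)] V(1)] \<theta>(2) by simp
  moreover have "\<Phi> (\<lambda>x. \<Sum>b\<in>Basis. w b x *\<^sub>R E b x) = 0"
    by (subst sum) (simp_all add: vector_field_scaleR[OF M w E] scale[OF w E] wp)
  ultimately show ?thesis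
    using YV by simp
qed

subsection \<open>Hessians\<close>

text \<open>The expression is tensorial in \<open>Y\<close>: on replacing \<open>Y\<close> by
  \<open>w Y\<close>, both terms produce dw(a) du(Y), and these cancel. Hence all fields with value
  \<open>b\<close> at \<open>p\<close> give the same number, and the definite description in
  \<open>hessian\<close> picks it.\<close>

lemma hessian_eq:
  assumes M: "smooth_manifold \<kappa>" and D: "connection \<kappa> D" and u: "smooth_fun \<kappa> u"
    and Y: "vector_field \<kappa> Y" "Y p = b"
  shows "hessian \<kappa> D u p a b = differential \<kappa> (deriv_along \<kappa> Y u) p a - differential \<kappa> u p (D p a Y)"
proof -
  define \<Phi> where "\<Phi> Y = differential \<kappa> (deriv_along \<kappa> Y u) p a - differential \<kappa> u p (D p a Y)" for Y
  have add: "\<Phi> (\<lambda>q. X q + Z q) = \<Phi> X + \<Phi> Z" if "vector_field \<kappa> X" "vector_field \<kappa> Z" for X Z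
  proof -
    have "D p a (\<lambda>q. X q + Z q) = D p a X + D p a Z"
      using D that by (simp add: connection_def)
    then show ?thesis
      using that by (simp add: \<Phi>_def differential_linear[OF M u] differential_add M smooth_fun_deriv_along u)
  qed
  have scale: "\<Phi> (\<lambda>q. w q *\<^sub>R X q) = w p * \<Phi> X" if "smooth_fun \<kappa> w" "vector_field \<kappa> X" for w X
  proof -
    have "D p a (\<lambda>q. w q *\<^sub>R X q) = differential \<kappa> w p a *\<^sub>R X p + w p *\<^sub>R D p a X"
      using D that by (simp add: connection_def)
    then show ?thesis
      using that
      by (simp add: \<Phi>_def differential_linear[OF M u] differential_mult M smooth_fun_deriv_along u algebra_simps)
  qed
  have "\<Phi> Y = \<Phi> Z" if "vector_field \<kappa> Z \<and> Z p = b" for Z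
    using that Y by (intro tensorial[OF M, of \<Phi> p] add scale) auto
  then have "\<forall>Z. vector_field \<kappa> Z \<and> Z p = b \<longrightarrow> \<Phi> Y = \<Phi> Z" by blast
  then have "(THE c. \<forall>Z. vector_field \<kappa> Z \<and> Z p = b \<longrightarrow> c = \<Phi> Z) = \<Phi> Y"
    using Y by (intro the_equality) blast+
  then show ?thesis
    by (simp add: hessian_def \<Phi>_def)
qed

text \<open>Along a field \<open>Y\<close> extending \<open>b\<close>, d(ln f)(Y) is df(Y) / f;
  differentiating the factor 1 / f once more produces the negative square term.\<close>

lemma hessian_ln:
  assumes M: "smooth_manifold \<kappa>" and D: "connection \<kappa> D" and f: "smooth_fun \<kappa> f" "\<And>p. f p > 0"
  shows "hessian \<kappa> D (\<lambda>q. ln (f q)) p a b =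
    hessian \<kappa> D f p a b / f p - differential \<kappa> f p a * differential \<kappa> f p b / (f p)\<^sup>2"
proof -
  obtain Y where Y: "vector_field \<kappa> Y" "Y p = b"
    by (rule ex_vector_field[OF M]) (rule that)
  note ln = smooth_fun_ln[OF M f]
  have fn: "f p \<noteq> 0" for p using f(2)[of p] by simp
  have d: "differential \<kappa> (\<lambda>q. ln (f q)) q v = inverse (f q) * differential \<kappa> f q v" for q v
    using differential_compose_real[OF M f(1) DERIV_ln[OF f(2)]] .
  have "differential \<kappa> (\<lambda>q. inverse (f q)) p a = - (inverse (f p) * inverse (f p)) * differential \<kappa> f p a"
    using differential_compose_real[OF M f(1) DERIV_inverse[OF fn[of p]]] by (simp add: power2_eq_square)
  then have dd: "differential \<kappa> (\<lambda>q. inverse (f q) * deriv_along \<kappa> Y f q) p a =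
      inverse (f p) * differential \<kappa> (deriv_along \<kappa> Y f) p a
      - inverse (f p) * inverse (f p) * differential \<kappa> f p a * differential \<kappa> f p b"
    by (simp add: differential_mult[OF M smooth_fun_inverse[OF M f(1) fn] smooth_fun_deriv_along[OF M Y(1) f(1)]] Y(2))
  show ?thesis
    unfolding hessian_eq[OF M D ln Y] hessian_eq[OF M D f(1) Y] d dd
    by (simp add: divide_inverse power2_eq_square algebra_simps)
qed

section \<open>Tangent vectors of products and submanifolds\<close>

text \<open>The vector splits as (a, 0) + (0, b), and each summand is the image of a vector under
  the inclusion of a slice.\<close>

lemma tangent_map_prod:
  assumes M: "smooth_manifold \<kappa>" "smooth_manifold \<kappa>'"
    and G: "smooth_map_on T (prod_charts \<kappa> \<kappa>') \<kappa>'' G" "open T" "(x, y) \<in> T"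
  shows "tangent_map (prod_charts \<kappa> \<kappa>') \<kappa>'' G (x, y) (a, b) =
    tangent_map \<kappa> \<kappa>'' (\<lambda>x. G (x, y)) x a + tangent_map \<kappa>' \<kappa>'' (\<lambda>y. G (x, y)) y b"
proof -
  note PM = smooth_manifold_prod_charts[OF M]
  let ?T = "tangent_map (prod_charts \<kappa> \<kappa>') \<kappa>'' G (x, y)"
  have "tangent_map \<kappa> \<kappa>'' (\<lambda>x. G (x, y)) x a = ?T (tangent_map \<kappa> (prod_charts \<kappa> \<kappa>') (\<lambda>x. (x, y)) x a)"
    by (rule tangent_map_compose[OF M(1) PM smooth_map_on_Pair[OF M(1) smooth_map_on_ident[OF M(1)]
          smooth_map_on_const[OF M]] open_UNIV UNIV_I G])
  also have "\<dots> = ?T (a, 0)"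
    by (simp add: tangent_map_Pair[OF M(1) open_UNIV UNIV_I smooth_map_on_ident[OF M(1)] smooth_map_on_const[OF M]]
        tangent_map_ident[OF M(1)] tangent_map_const)
  finally have 1: "tangent_map \<kappa> \<kappa>'' (\<lambda>x. G (x, y)) x a = ?T (a, 0)" .
  have "tangent_map \<kappa>' \<kappa>'' (\<lambda>y. G (x, y)) y b = ?T (tangent_map \<kappa>' (prod_charts \<kappa> \<kappa>') (\<lambda>y. (x, y)) y b)"
    by (rule tangent_map_compose[OF M(2) PM smooth_map_on_Pair[OF M(2) smooth_map_on_const[OF M(2,1)]
          smooth_map_on_ident[OF M(2)]] open_UNIV UNIV_I G])
  also have "\<dots> = ?T (0, b)"
    by (simp add: tangent_map_Pair[OF M(2) open_UNIV UNIV_I smooth_map_on_const[OF M(2,1)] smooth_map_on_ident[OF M(2)]]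
        tangent_map_ident[OF M(2)] tangent_map_const)
  finally have 2: "tangent_map \<kappa>' \<kappa>'' (\<lambda>y. G (x, y)) y b = ?T (0, b)" .
  have "?T ((a, 0) + (0, b)) = ?T (a, 0) + ?T (0, b)"
    by (rule linear_add[OF linear_tangent_map[OF PM G]])
  then show ?thesis
    by (simp add: 1 2)
qed

text \<open>This is the time direction on the product of the line with the manifold; its components
  are constant in every product chart. Differentiating the flow along it will give the smoothness of
  P.\<close>

lemma vector_field_horizontal:
  fixes \<kappa> :: "('a::{t2_space, second_countable_topology}, 'e::euclidean_space) charts"
  assumes M: "smooth_manifold \<kappa>"
  shows "vector_field (prod_charts (vec_charts :: (real, real) charts) \<kappa>) (\<lambda>_. (1, 0))"
  unfolding vector_field_def
proof
  fix tq :: "real \<times> 'a"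
  obtain t q where tq: "tq = (t, q)" by force
  let ?N = "prod_charts (vec_charts :: (real, real) charts) \<kappa>"
  note V = smooth_manifold_vec_charts
  note N = smooth_manifold_prod_charts[OF V M]
  show "smooth_on (coord ?N tq ` chart_dom ?N tq)
      (\<lambda>y. tangent_map ?N vec_charts (coord ?N tq) (coord_inv ?N tq y) (1, 0))"
  proof (rule smooth_on_cong[OF _ smooth_on_const])
    show "open (coord ?N tq ` chart_dom ?N tq)"
      by (intro open_coord_image N open_chart_dom) auto
    fix y assume "y \<in> coord ?N tq ` chart_dom ?N tq"
    then obtain s x where "(s, x) \<in> chart_dom ?N tq" "y = coord ?N tq (s, x)"
      by (elim imageE) (metis surj_pair)
    then have sx: "(s, x) \<in> chart_dom ?N tq" "coord_inv ?N tq y = (s, x)"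
      by (simp_all add: coord_inv_coord[OF N])
    have "x \<in> chart_dom \<kappa> q" using sx(1) by (simp add: tq chart_dom_prod)
    have "tangent_map ?N vec_charts (coord ?N tq) (s, x) (1, 0) =
        tangent_map vec_charts vec_charts (\<lambda>s. coord ?N tq (s, x)) s 1 +
        tangent_map \<kappa> vec_charts (\<lambda>x. coord ?N tq (s, x)) x 0"
      by (rule tangent_map_prod[OF V M smooth_map_on_coord[OF N] open_chart_dom[OF N] sx(1)])
    also have "tangent_map \<kappa> vec_charts (\<lambda>x. coord ?N tq (s, x)) x 0 = 0"
      unfolding tq coord_prod map_prod_simp
      using \<open>x \<in> chart_dom \<kappa> q\<close>
      by (intro linear_0 linear_tangent_map[OF M smooth_map_on_vec_compose[OF M smooth_map_on_coord[OF M] open_UNIV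
            smooth_on_Pair[OF open_UNIV smooth_on_const smooth_on_id] subset_UNIV]] open_chart_dom M)
    also have "tangent_map vec_charts vec_charts (\<lambda>s. coord ?N tq (s, x)) s 1 = (1, 0)"
      unfolding tangent_map_vec_vec tq coord_prod map_prod_simp
      using frechet_derivative_at[OF has_derivative_Pair[OF has_derivative_ident has_derivative_const[of "coord \<kappa> q x"]], of s]
      by (simp add: fun_eq_iff)
    finally show "tangent_map ?N vec_charts (coord ?N tq) (coord_inv ?N tq y) (1, 0) = (1, 0)"
      by (simp add: sx(2))
  qed
qed

lemma tangent_map_coord_self:
  assumes "smooth_manifold \<kappa>"
  shows "tangent_map \<kappa> vec_charts (coord \<kappa> p) p a = a"
  using tangent_map_ident[OF assms, of p a] by (simp add: tangent_map_def comp_def)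

text \<open>Membership in \<open>tangent_space\<close> asks for a curve in \<open>S\<close> with the
  given velocity; the image under \<open>F\<close> of a straight coordinate segment in direction
  \<open>a\<close> is one.\<close>

lemma tangent_map_in_tangent_space:
  fixes \<kappa> :: "('a::{t2_space, second_countable_topology}, 'e::euclidean_space) charts"
  assumes M: "smooth_manifold \<kappa>" and F: "smooth_map_on UNIV \<kappa> \<kappa>' F" and S: "range F \<subseteq> S"
  shows "tangent_map \<kappa> \<kappa>' F p a \<in> tangent_space \<kappa>' S (F p)"
proof -
  note V = smooth_manifold_vec_charts
  let ?U = "coord \<kappa> p ` chart_dom \<kappa> p"
  \<comment> \<open>A whole line in coordinates; only a short piece around time 0 stays in the image
    of the chart, which is what \<epsilon> is for.\<close>
  define \<gamma> where "\<gamma> t = coord \<kappa> p p + t *\<^sub>R a" for t :: real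
  have U: "open ?U" by (intro open_coord_image open_chart_dom M) auto
  have der: "(\<gamma> has_derivative (\<lambda>t. t *\<^sub>R a)) (at t)" for t
    unfolding \<gamma>_def by (auto intro!: derivative_eq_intros)
  have "isCont \<gamma> 0"
    using has_derivative_continuous[OF der] .
  moreover have "\<gamma> 0 \<in> ?U" using chart_dom_mem[OF M] by (simp add: \<gamma>_def)
  ultimately have "\<forall>\<^sub>F t in at 0. \<gamma> t \<in> ?U"
    unfolding isCont_def by (rule topological_tendstoD[OF _ U])
  then obtain \<epsilon> where \<epsilon>: "\<epsilon> > 0" "\<And>t. t \<noteq> 0 \<Longrightarrow> dist t 0 < \<epsilon> \<Longrightarrow> \<gamma> t \<in> ?U"
    by (auto simp: eventually_at)
  let ?I = "{-\<epsilon><..<\<epsilon>}"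
  have \<gamma>U: "\<gamma> ` ?I \<subseteq> ?U"
  proof (rule image_subsetI)
    fix t assume "t \<in> ?I"
    then show "\<gamma> t \<in> ?U"
      using \<epsilon>(2)[of t] \<open>\<gamma> 0 \<in> ?U\<close> by (cases "t = 0") (simp_all add: abs_less_iff)
  qed
  have "smooth_on ?I \<gamma>"
    unfolding \<gamma>_def by (intro smooth_on_add smooth_on_const smooth_on_scaleR smooth_on_id) auto
  then have \<gamma>: "smooth_map_on ?I vec_charts vec_charts \<gamma>"
    by (intro smooth_map_on_vec_vec) auto
  have c: "smooth_map_on ?I vec_charts \<kappa> (\<lambda>t. coord_inv \<kappa> p (\<gamma> t))"
    by (rule smooth_map_on_compose[OF V V \<gamma> smooth_map_on_coord_inv[OF M] \<gamma>U])
  have I: "open ?I" "0 \<in> ?I" using \<epsilon>(1) by auto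
  have "tangent_map vec_charts \<kappa>' (\<lambda>t. F (coord_inv \<kappa> p (\<gamma> t))) 0 1 =
      tangent_map \<kappa> \<kappa>' F (coord_inv \<kappa> p (\<gamma> 0)) (tangent_map vec_charts \<kappa> (\<lambda>t. coord_inv \<kappa> p (\<gamma> t)) 0 1)"
    by (rule tangent_map_compose[OF V M c I F open_UNIV UNIV_I])
  also have "coord_inv \<kappa> p (\<gamma> 0) = p"
    by (simp add: \<gamma>_def coord_inv_coord chart_dom_mem M)
  also have "tangent_map vec_charts \<kappa> (\<lambda>t. coord_inv \<kappa> p (\<gamma> t)) 0 1 =
      tangent_map vec_charts \<kappa> (coord_inv \<kappa> p) (\<gamma> 0) (tangent_map vec_charts vec_charts \<gamma> 0 1)"
    by (rule tangent_map_compose[OF V V \<gamma> I smooth_map_on_coord_inv[OF M] U \<open>\<gamma> 0 \<in> ?U\<close>])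
  \<comment> \<open>The velocity \<open>a\<close> is rewritten as its own image under the
    differential of the chart, the form that \<open>frame_vector_tangent_coord\<close>
    cancels.\<close>
  also have "tangent_map vec_charts vec_charts \<gamma> 0 1 = tangent_map \<kappa> vec_charts (coord \<kappa> p) p a"
    using frechet_derivative_at[OF der, of 0, symmetric] by (simp add: tangent_map_vec_vec tangent_map_coord_self[OF M])
  also have "tangent_map vec_charts \<kappa> (coord_inv \<kappa> p) (\<gamma> 0) (tangent_map \<kappa> vec_charts (coord \<kappa> p) p a) = a"
    using frame_vector_tangent_coord[OF M chart_dom_mem[OF M]] by (simp add: frame_vector_def \<gamma>_def)
  finally have T: "tangent_map \<kappa> \<kappa>' F p a = tangent_map vec_charts \<kappa>' (\<lambda>t. F (coord_inv \<kappa> p (\<gamma> t))) 0 1" ..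
  have "F (coord_inv \<kappa> p (\<gamma> 0)) = F p"
    by (simp add: \<gamma>_def coord_inv_coord chart_dom_mem M)
  moreover have "smooth_map_on ?I vec_charts \<kappa>' (\<lambda>t. F (coord_inv \<kappa> p (\<gamma> t)))"
    by (rule smooth_map_on_compose[OF V M c F]) auto
  ultimately show ?thesis
    unfolding tangent_space_def mem_Collect_eq
    using T S \<epsilon>(1) by (intro exI[of _ \<epsilon>] exI[of _ "\<lambda>t. F (coord_inv \<kappa> p (\<gamma> t))"] conjI) auto
qed

lemma differential_tangent_space:
  assumes M: "smooth_manifold \<kappa>" and u: "smooth_fun \<kappa> u" and a: "a \<in> tangent_space \<kappa> (u -` {l}) p"
  shows "differential \<kappa> u p a = 0"
proof -
  from a obtain \<epsilon> and c :: "real \<Rightarrow> _" where c: "\<epsilon> > 0" "smooth_map_on {-\<epsilon><..<\<epsilon>} vec_charts \<kappa> c"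
    "c ` {-\<epsilon><..<\<epsilon>} \<subseteq> u -` {l}" "c 0 = p" "a = tangent_map vec_charts \<kappa> c 0 1"
    unfolding tangent_space_def mem_Collect_eq by (elim exE conjE) (rule that)
  note V = smooth_manifold_vec_charts
  have I: "open {-\<epsilon><..<\<epsilon>}" "0 \<in> {-\<epsilon><..<\<epsilon>}" using c(1) by auto
  have "differential \<kappa> u p a = tangent_map vec_charts vec_charts (\<lambda>t. u (c t)) 0 1"
    unfolding differential_def c(5) c(4)[symmetric]
    by (rule tangent_map_compose[OF V M c(2) I u open_UNIV UNIV_I, symmetric])
  also have "tangent_map vec_charts vec_charts (\<lambda>t. u (c t)) 0 = tangent_map vec_charts vec_charts (\<lambda>t. l) 0"
    using c(3) by (intro tangent_map_cong[OF V I]) blast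
  finally show ?thesis
    by (simp add: tangent_map_const)
qed

section \<open>Actions of the positive reals\<close>

locale smooth_free_action =
  fixes \<kappa> :: "('a::{t2_space, second_countable_topology}, 'e::euclidean_space) charts"
    and m :: "real \<Rightarrow> 'a \<Rightarrow> 'a"
  assumes M: "smooth_manifold \<kappa>" and action: "smooth_action \<kappa> m" and free: "free_action m"
begin

abbreviation "line \<equiv> vec_charts :: (real, real) charts"

text \<open>With \<open>exp\<close> the multiplicative action becomes a flow whose time ranges over
  the whole manifold \<open>line\<close>, so smoothness and derivatives need no restriction to
  positive parameters.\<close>

definition flow :: "real \<Rightarrow> 'a \<Rightarrow> 'a" where
  "flow t = m (exp t)"

abbreviation "P \<equiv> generating_field \<kappa> m"

lemmas V = smooth_manifold_vec_charts
lemmas N = smooth_manifold_prod_charts[OF V M]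

lemma m_eq_flow: "c > 0 \<Longrightarrow> m c = flow (ln c)"
  by (simp add: flow_def)

lemma flow_0 [simp]: "flow 0 p = p"
  using action by (simp add: flow_def smooth_action_def)

lemma flow_add: "flow (s + t) p = flow s (flow t p)"
  using action by (simp add: flow_def smooth_action_def exp_add)

lemma flow_minus [simp]: "flow (- t) (flow t p) = p" "flow t (flow (- t) p) = p"
  using flow_add[of "- t" t p] flow_add[of t "- t" p] by simp_all

lemma smooth_flow: "smooth_map_on UNIV (prod_charts line \<kappa>) \<kappa> (\<lambda>x. flow (fst x) (snd x))"
proof -
  have "smooth_map_on UNIV (prod_charts line \<kappa>) line (\<lambda>x. exp (fst x))"
    by (rule smooth_map_on_compose[OF N V smooth_map_on_fst[OF V M] smooth_map_on_vec_vec[OF open_UNIV smooth_on_exp]]) auto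
  then have "smooth_map_on UNIV (prod_charts line \<kappa>) (prod_charts line \<kappa>) (\<lambda>x. (exp (fst x), snd x))"
    by (rule smooth_map_on_Pair[OF N _ smooth_map_on_snd[OF V M]])
  moreover have "smooth_map_on ({0<..} \<times> UNIV) (prod_charts line \<kappa>) \<kappa> (\<lambda>(c, p). m c p)"
    using action by (simp add: smooth_action_def)
  ultimately have "smooth_map_on UNIV (prod_charts line \<kappa>) \<kappa> (\<lambda>x. (\<lambda>(c, p). m c p) (exp (fst x), snd x))"
    by (rule smooth_map_on_compose[OF N N]) auto
  then show ?thesis
    by (simp add: flow_def)
qed

lemma smooth_flow_compose:
  assumes "smooth_manifold \<kappa>'" "smooth_map_on S \<kappa>' line \<tau>" "smooth_map_on S \<kappa>' \<kappa> F"
  shows "smooth_map_on S \<kappa>' \<kappa> (\<lambda>x. flow (\<tau> x) (F x))"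
  using smooth_map_on_compose[OF assms(1) N smooth_map_on_Pair[OF assms] smooth_flow] by simp

lemma smooth_flow_map: "smooth_map_on UNIV \<kappa> \<kappa> (flow t)"
  by (rule smooth_flow_compose[OF M smooth_map_on_const[OF M V] smooth_map_on_ident[OF M]])

lemma smooth_flow_curve: "smooth_map_on UNIV line \<kappa> (\<lambda>t. flow t p)"
  by (rule smooth_flow_compose[OF V smooth_map_on_ident[OF V] smooth_map_on_const[OF V M]])

text \<open>P is defined as a velocity at time 0; the group law moves time t to time 0 of the orbit
  through \<open>flow t p\<close>.\<close>

lemma tangent_flow_curve: "tangent_map line \<kappa> (\<lambda>t. flow t p) t r = r *\<^sub>R P (flow t p)"
proof -
  have "smooth_on UNIV (\<lambda>s. s - t)"
    by (intro smooth_on_diff smooth_on_id smooth_on_const open_UNIV)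
  then have sh: "smooth_map_on UNIV line line (\<lambda>s. s - t)"
    by (rule smooth_map_on_vec_vec[OF open_UNIV])
  have "((\<lambda>s. s - t) has_derivative (\<lambda>r. r)) (at t)"
    by (auto intro!: derivative_eq_intros)
  then have d: "tangent_map line line (\<lambda>s. s - t) t r = r"
    unfolding tangent_map_vec_vec by (metis frechet_derivative_at)
  have "tangent_map line \<kappa> (\<lambda>s. flow (s - t) (flow t p)) t r =
      tangent_map line \<kappa> (\<lambda>s. flow s (flow t p)) (t - t) (tangent_map line line (\<lambda>s. s - t) t r)"
    by (rule tangent_map_compose[OF V V sh open_UNIV UNIV_I smooth_flow_curve open_UNIV UNIV_I])
  also have "\<dots> = tangent_map line \<kappa> (\<lambda>s. flow s (flow t p)) 0 (r *\<^sub>R 1)"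
    by (simp add: d)
  also have "\<dots> = r *\<^sub>R tangent_map line \<kappa> (\<lambda>s. flow s (flow t p)) 0 1"
    by (rule linear_cmul[OF linear_tangent_map[OF V smooth_flow_curve open_UNIV UNIV_I]])
  also have "tangent_map line \<kappa> (\<lambda>s. flow s (flow t p)) 0 1 = P (flow t p)"
    by (simp add: generating_field_def flow_def)
  finally show ?thesis
    by (simp add: flow_add[symmetric])
qed

lemma tangent_flow:
  "tangent_map (prod_charts line \<kappa>) \<kappa> (\<lambda>x. flow (fst x) (snd x)) (t, p) (r, a) =
    r *\<^sub>R P (flow t p) + tangent_map \<kappa> \<kappa> (flow t) p a"
  using tangent_map_prod[OF V M smooth_flow open_UNIV UNIV_I, of t p r a] by (simp add: tangent_flow_curve)

text \<open>The map is the joint flow after x \<mapsto> (\<tau> x, x). The change of the flow time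
  contributes the multiple of P.\<close>

lemma tangent_flow_compose:
  assumes "smooth_fun \<kappa> \<tau>"
  shows "tangent_map \<kappa> \<kappa> (\<lambda>x. flow (\<tau> x) x) p a =
    differential \<kappa> \<tau> p a *\<^sub>R P (flow (\<tau> p) p) + tangent_map \<kappa> \<kappa> (flow (\<tau> p)) p a"
proof -
  have "tangent_map \<kappa> \<kappa> (\<lambda>x. flow (fst (\<tau> x, x)) (snd (\<tau> x, x))) p a =
      tangent_map (prod_charts line \<kappa>) \<kappa> (\<lambda>x. flow (fst x) (snd x)) (\<tau> p, p)
        (tangent_map \<kappa> (prod_charts line \<kappa>) (\<lambda>x. (\<tau> x, x)) p a)"
    by (rule tangent_map_compose[OF M N smooth_map_on_Pair[OF M assms smooth_map_on_ident[OF M]] open_UNIV UNIV_I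
          smooth_flow open_UNIV UNIV_I])
  then show ?thesis
    by (simp add: tangent_map_Pair[OF M open_UNIV UNIV_I assms smooth_map_on_ident[OF M]] tangent_map_ident[OF M]
        tangent_flow differential_def)
qed

lemma differential_generating_field:
  assumes u: "smooth_fun \<kappa> u" and "((\<lambda>t. u (flow t p)) has_real_derivative d) (at 0)"
  shows "differential \<kappa> u p (P p) = d"
proof -
  have "tangent_map line vec_charts (\<lambda>t. u (flow t p)) 0 1 =
      tangent_map \<kappa> vec_charts u (flow 0 p) (tangent_map line \<kappa> (\<lambda>t. flow t p) 0 1)"
    by (rule tangent_map_compose[OF V M smooth_flow_curve open_UNIV UNIV_I u open_UNIV UNIV_I])
  then have "differential \<kappa> u p (P p) = frechet_derivative (\<lambda>t. u (flow t p)) (at 0) 1"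
    by (simp add: tangent_flow_curve differential_def tangent_map_vec_vec)
  also have "\<dots> = d"
    using frechet_derivative_at[OF assms(2)[unfolded has_field_derivative_def], symmetric] by simp
  finally show ?thesis .
qed

text \<open>The derivative of \<open>u\<close> along P is the time derivative at 0 of (t, p)
  \<mapsto> u (flow t p). This function is smooth in both variables, so the derivative is smooth in
  \<open>p\<close>.\<close>

lemma vector_field_generating_field: "vector_field \<kappa> P"
proof (rule vector_fieldI[OF M])
  fix u assume u: "smooth_fun \<kappa> u"
  let ?N = "prod_charts line \<kappa>"
  let ?u = "\<lambda>x. u (flow (fst x) (snd x))"
  have su: "smooth_fun ?N ?u"
    by (rule smooth_map_on_compose[OF N M smooth_flow u]) auto
  then have "smooth_fun ?N (deriv_along ?N (\<lambda>_. (1, 0)) ?u)"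
    by (rule smooth_fun_deriv_along[OF N vector_field_horizontal[OF M]])
  then have "smooth_fun \<kappa> (\<lambda>p. deriv_along ?N (\<lambda>_. (1, 0)) ?u (0, p))"
    by (rule smooth_map_on_compose[OF M N smooth_map_on_Pair[OF M smooth_map_on_const[OF M V] smooth_map_on_ident[OF M]]]) auto
  moreover have "deriv_along ?N (\<lambda>_. (1, 0)) ?u (0, p) = deriv_along \<kappa> P u p" for p
  proof -
    have "tangent_map ?N vec_charts ?u (0, p) (1, 0) =
        tangent_map \<kappa> vec_charts u (flow (fst (0, p)) (snd (0 :: real, p)))
          (tangent_map ?N \<kappa> (\<lambda>x. flow (fst x) (snd x)) (0, p) (1, 0))"
      by (rule tangent_map_compose[OF N M smooth_flow open_UNIV UNIV_I u open_UNIV UNIV_I])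
    then show ?thesis
      by (simp add: differential_def tangent_flow linear_0[OF linear_tangent_map[OF M smooth_flow_map open_UNIV UNIV_I]])
  qed
  ultimately show "smooth_fun \<kappa> (deriv_along \<kappa> P u)"
    by simp
qed

text \<open>A zero of \<open>P\<close> would be a zero along its whole orbit, which would therefore be constant.\<close>

lemma generating_field_nonzero: "P p \<noteq> 0"
proof
  assume P0: "P p = 0"
  \<comment> \<open>The flow maps commute, so \<open>flow t\<close> carries the orbit of
    \<open>p\<close> to the orbit of \<open>flow t p\<close> and P at one point to P at the
    other.\<close>
  have Pt: "P (flow t p) = 0" for t
  proof -
    have "tangent_map line \<kappa> (\<lambda>s. flow t (flow s p)) 0 1 =
        tangent_map \<kappa> \<kappa> (flow t) (flow 0 p) (tangent_map line \<kappa> (\<lambda>s. flow s p) 0 1)"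
      by (rule tangent_map_compose[OF V M smooth_flow_curve open_UNIV UNIV_I smooth_flow_map open_UNIV UNIV_I])
    also have "\<dots> = 0"
      by (simp add: tangent_flow_curve P0 linear_0[OF linear_tangent_map[OF M smooth_flow_map open_UNIV UNIV_I]])
    also have "(\<lambda>s. flow t (flow s p)) = (\<lambda>s. flow s (flow t p))"
      by (simp add: flow_add[symmetric] add.commute)
    finally show ?thesis
      by (simp add: tangent_flow_curve)
  qed
  let ?U = "chart_dom \<kappa> p"
  have "continuous_on UNIV (\<lambda>t. flow t p)"
    by (rule smooth_map_on_imp_continuous_on[OF V M open_UNIV smooth_flow_curve])
  then have "open ((\<lambda>t. flow t p) -` ?U)"
    by (intro open_vimage open_chart_dom M)
  then obtain \<epsilon> where \<epsilon>: "\<epsilon> > 0" "ball 0 \<epsilon> \<subseteq> (\<lambda>t. flow t p) -` ?U"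
    using chart_dom_mem[OF M, of p] by (metis flow_0 open_contains_ball vimageI)
  have "((\<lambda>t. coord \<kappa> p (flow t p)) has_derivative (\<lambda>r. 0)) (at t)" if t: "t \<in> ball 0 \<epsilon>" for t
  proof -
    have tU: "flow t p \<in> ?U" using \<epsilon>(2) t by auto
    have c: "smooth_map_on (ball 0 \<epsilon>) line vec_charts (\<lambda>t. coord \<kappa> p (flow t p))"
      by (rule smooth_map_on_compose[OF V M smooth_map_on_subset[OF smooth_flow_curve subset_UNIV] smooth_map_on_coord[OF M]])
         (use \<epsilon>(2) in auto)
    have "tangent_map line vec_charts (\<lambda>t. coord \<kappa> p (flow t p)) t r =
        tangent_map \<kappa> vec_charts (coord \<kappa> p) (flow t p) (tangent_map line \<kappa> (\<lambda>t. flow t p) t r)" for r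
      by (rule tangent_map_compose[OF V M smooth_flow_curve open_UNIV UNIV_I smooth_map_on_coord[OF M] open_chart_dom[OF M] tU])
    then have "tangent_map line vec_charts (\<lambda>t. coord \<kappa> p (flow t p)) t = (\<lambda>r. 0)"
      by (simp add: tangent_flow_curve Pt fun_eq_iff
          linear_0[OF linear_tangent_map[OF M smooth_map_on_coord[OF M] open_chart_dom[OF M] tU]])
    then show ?thesis
      using smooth_map_on_has_derivative[OF V c open_ball t] by (simp add: comp_def)
  qed
  then have "((\<lambda>t. coord \<kappa> p (flow t p)) has_derivative (\<lambda>r. 0)) (at t within ball 0 \<epsilon>)" if "t \<in> ball 0 \<epsilon>" for t
    using that has_derivative_at_withinI by blast
  then obtain k where k: "\<And>t. t \<in> ball 0 \<epsilon> \<Longrightarrow> coord \<kappa> p (flow t p) = k"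
    using has_derivative_zero_constant[OF convex_ball, of 0 \<epsilon> "\<lambda>t. coord \<kappa> p (flow t p)"] by blast
  \<comment> \<open>\<open>\<epsilon> / 2\<close> is merely some positive time for which the orbit
    is still in the chart; there equal coordinates mean equal points, against freeness.\<close>
  have "coord \<kappa> p (flow (\<epsilon> / 2) p) = coord \<kappa> p p"
    using k[of "\<epsilon> / 2"] k[of 0] \<epsilon>(1) by simp
  moreover have "\<epsilon> / 2 \<in> ball 0 \<epsilon>"
    using \<epsilon>(1) by simp
  then have "flow (\<epsilon> / 2) p \<in> ?U"
    using \<epsilon>(2) by blast
  ultimately have "flow (\<epsilon> / 2) p = p"
    by (metis M chart_dom_mem coord_inv_coord)
  then have "exp (\<epsilon> / 2) = 1"
    using free exp_gt_zero unfolding free_action_def flow_def by blast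
  then show False
    using \<epsilon>(1) by simp
qed

section \<open>Push-forward of fields by the flow\<close>

lemma inv_flow: "inv (flow t) = flow (- t)"
  by (rule inv_unique_comp) (simp_all add: fun_eq_iff)

lemma pushforward_flow: "pushforward \<kappa> (flow t) X (flow t p) = tangent_map \<kappa> \<kappa> (flow t) p (X p)"
  by (simp add: pushforward_def inv_flow)

lemma deriv_along_pushforward_flow:
  assumes "smooth_fun \<kappa> u"
  shows "deriv_along \<kappa> (pushforward \<kappa> (flow t) X) u (flow t p) = deriv_along \<kappa> X (\<lambda>q. u (flow t q)) p"
  unfolding pushforward_flow differential_def
  by (rule tangent_map_compose[OF M M smooth_flow_map open_UNIV UNIV_I assms open_UNIV UNIV_I, symmetric])

text \<open>Differentiating \<open>u\<close> along the pushed field amounts to differentiating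
  \<open>u\<close> after \<open>flow t\<close> along \<open>X\<close> and flowing back by
  \<open>- t\<close>, both smooth operations.\<close>

lemma vector_field_pushforward_flow:
  assumes X: "vector_field \<kappa> X"
  shows "vector_field \<kappa> (pushforward \<kappa> (flow t) X)"
proof (rule vector_fieldI[OF M])
  fix u assume u: "smooth_fun \<kappa> u"
  have "smooth_fun \<kappa> (\<lambda>q. u (flow t q))"
    by (rule smooth_map_on_compose[OF M M smooth_flow_map u]) auto
  then have "smooth_fun \<kappa> (deriv_along \<kappa> X (\<lambda>q. u (flow t q)))"
    by (rule smooth_fun_deriv_along[OF M X])
  then have "smooth_fun \<kappa> (\<lambda>p. deriv_along \<kappa> X (\<lambda>q. u (flow t q)) (flow (- t) p))"
    by (rule smooth_map_on_compose[OF M M smooth_flow_map]) auto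
  then show "smooth_fun \<kappa> (deriv_along \<kappa> (pushforward \<kappa> (flow t) X) u)"
    by (rule smooth_map_on_cong_subset)
       (auto simp: deriv_along_pushforward_flow[OF u, symmetric])
qed

end

section \<open>Homogeneous functions with nondegenerate Hessian\<close>

locale homogeneous_hessian = smooth_free_action \<kappa> m
  for \<kappa> :: "('a::{t2_space, second_countable_topology}, 'e::euclidean_space) charts" and m +
  fixes D :: "('a, 'e) covariant_derivative" and f :: "'a \<Rightarrow> real" and \<alpha> :: real
  assumes D: "connection \<kappa> D" and f: "smooth_fun \<kappa> f" and f_pos: "\<And>p. f p > 0"
    and h: "pseudo_riemannian \<kappa> (hessian \<kappa> D f)"
    and hom: "homogeneous_fun m \<alpha> f"
    and pres: "preserves_connection \<kappa> m D"
    and radiant: "\<And>p a. D p a (generating_field \<kappa> m) = a"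
begin

section \<open>Behaviour of f, df and h along the flow\<close>

abbreviation "h \<equiv> hessian \<kappa> D f"
abbreviation "df \<equiv> differential \<kappa> f"

lemma h_bilinear: "bilinear (h p)" and h_sym: "h p a b = h p b a"
  and h_nondegenerate: "(\<And>b. h p a b = 0) \<Longrightarrow> a = 0"
  and h_smooth: "vector_field \<kappa> X \<Longrightarrow> vector_field \<kappa> Y \<Longrightarrow> smooth_fun \<kappa> (\<lambda>p. h p (X p) (Y p))"
  using h unfolding pseudo_riemannian_def by blast+

lemmas h_simps = bilinear_ladd[OF h_bilinear] bilinear_radd[OF h_bilinear]
  bilinear_lmul[OF h_bilinear] bilinear_rmul[OF h_bilinear]

lemma f_nonzero [simp]: "f p \<noteq> 0"
  using f_pos[of p] by simp

lemma f_flow: "f (flow t p) = exp (\<alpha> * t) * f p"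
  using hom by (simp add: homogeneous_fun_def flow_def powr_def)

text \<open>Euler's identity: the time derivative of \<open>f_flow\<close> at 0.\<close>

lemma df_P: "df p (P p) = \<alpha> * f p"
  by (rule differential_generating_field[OF f]) (auto simp: f_flow intro!: derivative_eq_intros)

text \<open>P is put into the second slot, the one that the Hessian differentiates: there
  \<open>df_P\<close> evaluates the first term and \<open>radiant\<close> the second. Symmetry moves
  P to the front.\<close>

lemma h_P: "h p (P p) b = (\<alpha> - 1) * df p b"
proof -
  have "h p b (P p) = differential \<kappa> (deriv_along \<kappa> P f) p b - df p (D p b P)"
    by (rule hessian_eq[OF M D f vector_field_generating_field refl])
  also have "deriv_along \<kappa> P f = (\<lambda>p. \<alpha> * f p)"
    by (simp add: df_P)
  also have "differential \<kappa> (\<lambda>p. \<alpha> * f p) p b = \<alpha> * df p b"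
    by (simp add: differential_mult[OF M smooth_map_on_const[OF M V] f] differential_const)
  finally show ?thesis
    by (simp add: radiant h_sym[of p b] left_diff_distrib)
qed

lemma df_flow: "df (flow t p) (tangent_map \<kappa> \<kappa> (flow t) p a) = exp (\<alpha> * t) * df p a"
proof -
  have "df (flow t p) (tangent_map \<kappa> \<kappa> (flow t) p a) = differential \<kappa> (\<lambda>q. f (flow t q)) p a"
    unfolding differential_def
    by (rule tangent_map_compose[OF M M smooth_flow_map open_UNIV UNIV_I f open_UNIV UNIV_I, symmetric])
  also have "\<dots> = exp (\<alpha> * t) * df p a"
    by (simp add: f_flow differential_mult[OF M smooth_map_on_const[OF M V] f] differential_const)
  finally show ?thesis .
qed

text \<open>Invariance of \<open>D\<close> is stated for fields, so both vectors are extended and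
  pushed forward. Each of the two terms of the Hessian then contains one df, and picks up its factor
  from \<open>df_flow\<close>.\<close>

lemma h_flow:
  "h (flow t p) (tangent_map \<kappa> \<kappa> (flow t) p a) (tangent_map \<kappa> \<kappa> (flow t) p b) = exp (\<alpha> * t) * h p a b"
proof -
  obtain A where A: "vector_field \<kappa> A" "A p = a" by (rule ex_vector_field[OF M]) (rule that)
  obtain B where B: "vector_field \<kappa> B" "B p = b" by (rule ex_vector_field[OF M]) (rule that)
  let ?T = "tangent_map \<kappa> \<kappa> (flow t)" and ?push = "pushforward \<kappa> (flow t)"
  have B': "vector_field \<kappa> (?push B)" "?push B (flow t p) = ?T p b"
    by (simp_all add: vector_field_pushforward_flow[OF B(1)] pushforward_flow B(2))
  have Bf: "deriv_along \<kappa> (?push B) f (flow t q) = exp (\<alpha> * t) * deriv_along \<kappa> B f q" for q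
    by (simp add: pushforward_flow df_flow)
  have "differential \<kappa> (deriv_along \<kappa> (?push B) f) (flow t p) (?T p a) =
      differential \<kappa> (\<lambda>q. deriv_along \<kappa> (?push B) f (flow t q)) p a"
    unfolding differential_def[of \<kappa> "deriv_along \<kappa> (?push B) f"] differential_def[of \<kappa> "\<lambda>q. deriv_along \<kappa> (?push B) f (flow t q)"]
    by (rule tangent_map_compose[OF M M smooth_flow_map open_UNIV UNIV_I
          smooth_fun_deriv_along[OF M B'(1) f] open_UNIV UNIV_I, symmetric])
  also have "\<dots> = exp (\<alpha> * t) * differential \<kappa> (deriv_along \<kappa> B f) p a"
    unfolding Bf
    by (simp add: differential_mult[OF M smooth_map_on_const[OF M V] smooth_fun_deriv_along[OF M B(1) f]] differential_const)
  finally have 1: "differential \<kappa> (deriv_along \<kappa> (?push B) f) (flow t p) (?T p a) =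
      exp (\<alpha> * t) * differential \<kappa> (deriv_along \<kappa> B f) p a" .
  have "cov D (?push A) (?push B) = ?push (cov D A B)"
    using pres A(1) B(1) by (simp add: preserves_connection_def flow_def)
  then have "cov D (?push A) (?push B) (flow t p) = ?push (cov D A B) (flow t p)"
    by (rule fun_cong)
  then have "D (flow t p) (?T p a) (?push B) = ?T p (D p a B)"
    by (simp add: cov_def pushforward_flow A(2))
  then have "df (flow t p) (D (flow t p) (?T p a) (?push B)) = exp (\<alpha> * t) * df p (D p a B)"
    by (simp add: df_flow)
  with 1 show ?thesis
    unfolding hessian_eq[OF M D f B] hessian_eq[OF M D f B'] by (simp add: right_diff_distrib)
qed

section \<open>The excluded degrees 1 and 0\<close>

lemma alpha_neq_1: "\<alpha> \<noteq> 1"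
proof
  assume "\<alpha> = 1"
  then have "P p = 0" for p
    by (intro h_nondegenerate[of p]) (simp add: h_P)
  then show False
    using generating_field_nonzero by blast
qed

lemma alpha_neq_0:
  assumes "nondegenerate_on \<kappa> (f -` {l}) (induced_metric \<kappa> (f -` {l}) h)" and p: "f p = l"
  shows "\<alpha> \<noteq> 0"
proof
  assume \<alpha>: "\<alpha> = 0"
  have "range (\<lambda>t. flow t p) \<subseteq> f -` {l}"
    using p \<alpha> by (auto simp: f_flow)
  from tangent_map_in_tangent_space[OF V smooth_flow_curve this, of 0 1]
  have "P p \<in> tangent_space \<kappa> (f -` {l}) p"
    by (simp add: tangent_flow_curve)
  \<comment> \<open>Both branches of \<open>induced_metric\<close> give 0: by \<open>h_P\<close> the
    form is a multiple of df, and df kills vectors tangent to the level.\<close>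
  moreover have "induced_metric \<kappa> (f -` {l}) h p (P p) b = 0" if "b \<in> tangent_space \<kappa> (f -` {l}) p" for b
    by (simp add: induced_metric_def h_P differential_tangent_space[OF M f that])
  ultimately have "P p = 0"
    using assms unfolding nondegenerate_on_def by blast
  then show False
    using generating_field_nonzero by blast
qed

section \<open>The two homogeneous pairs\<close>

lemma homogeneous_pairI:
  assumes "\<alpha> \<noteq> 0" and "pseudo_riemannian \<kappa> g" and P: "\<And>p b. g p (P p) b = df p b"
    and flow: "\<And>t p a b. g (flow t p) (tangent_map \<kappa> \<kappa> (flow t) p a) (tangent_map \<kappa> \<kappa> (flow t) p b) =
      exp (\<alpha> * t) * g p a b"
  shows "homogeneous_pair \<kappa> m \<alpha> g f"
proof -
  have "pullback_metric \<kappa> \<kappa> (m c) g = (\<lambda>p a b. c powr \<alpha> * g p a b)" if "c > 0" for c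
    using flow[of "ln c"] that by (simp add: pullback_metric_def fun_eq_iff m_eq_flow powr_def)
  then show ?thesis
    using assms f f_pos hom by (simp add: homogeneous_pair_def fun_eq_iff)
qed

lemma homogeneous_pair_hessian:
  assumes "\<alpha> \<noteq> 0"
  shows "homogeneous_pair \<kappa> m \<alpha> (\<lambda>p a b. h p a b / (\<alpha> - 1)) f"
proof (rule homogeneous_pairI[OF assms])
  show "pseudo_riemannian \<kappa> (\<lambda>p a b. h p a b / (\<alpha> - 1))"
    unfolding pseudo_riemannian_def
  proof (intro conjI allI impI)
    show "bilinear (\<lambda>a b. h p a b / (\<alpha> - 1))" for p
      unfolding bilinear_def
      by (intro conjI allI linearI) (simp_all add: h_simps add_divide_distrib)
    show "h p a b / (\<alpha> - 1) = h p b a / (\<alpha> - 1)" for p a b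
      by (simp add: h_sym[of p a])
    show "a = 0" if "\<forall>b. h p a b / (\<alpha> - 1) = 0" for p a
      using that alpha_neq_1 by (intro h_nondegenerate[of p]) simp
    show "smooth_fun \<kappa> (\<lambda>p. h p (X p) (Y p) / (\<alpha> - 1))" if "vector_field \<kappa> X \<and> vector_field \<kappa> Y" for X Y
      unfolding divide_inverse
      using that by (intro smooth_map_on_mult smooth_map_on_const V M h_smooth open_UNIV) auto
  qed
qed (use alpha_neq_1 in \<open>simp_all add: h_P h_flow\<close>)

lemma hessian_ln_eq: "- f p * hessian \<kappa> D (\<lambda>q. ln (f q)) p a b = df p a * df p b * inverse (f p) - h p a b"
  unfolding hessian_ln[OF M D f f_pos] by (simp add: field_simps power2_eq_square)

lemma homogeneous_pair_hessian_ln: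
  assumes "\<alpha> \<noteq> 0"
  shows "homogeneous_pair \<kappa> m \<alpha> (\<lambda>p a b. - f p * hessian \<kappa> D (\<lambda>q. ln (f q)) p a b) f"
  unfolding hessian_ln_eq
proof (rule homogeneous_pairI[OF assms])
  \<comment> \<open>The first term gives \<alpha> df by Euler's identity, the second takes away
    (\<alpha> - 1) df.\<close>
  show gP: "df p (P p) * df p b * inverse (f p) - h p (P p) b = df p b" for p b
    by (simp add: h_P df_P left_diff_distrib)
  show "pseudo_riemannian \<kappa> (\<lambda>p a b. df p a * df p b * inverse (f p) - h p a b)"
    unfolding pseudo_riemannian_def
  proof (intro conjI allI impI)
    show "bilinear (\<lambda>a b. df p a * df p b * inverse (f p) - h p a b)" for p
      unfolding bilinear_def
      by (intro conjI allI linearI) (simp_all add: h_simps differential_linear[OF M f] algebra_simps)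
    show sym: "df p a * df p b * inverse (f p) - h p a b = df p b * df p a * inverse (f p) - h p b a" for p a b
      by (simp add: h_sym[of p a])
    show "a = 0" if a: "\<forall>b. df p a * df p b * inverse (f p) - h p a b = 0" for p a
    proof -
      \<comment> \<open>A vector in the kernel is paired with P, which by \<open>gP\<close> kills df
        on it; then only -h remains, and \<open>h\<close> is nondegenerate.\<close>
      have "df p a = 0"
        using a gP[of p a] sym[of p a "P p"] by metis
      then show ?thesis
        using a by (intro h_nondegenerate[of p]) simp
    qed
    show "smooth_fun \<kappa> (\<lambda>p. df p (X p) * df p (Y p) * inverse (f p) - h p (X p) (Y p))"
      if XY: "vector_field \<kappa> X \<and> vector_field \<kappa> Y" for X Y
    proof -
      have "smooth_fun \<kappa> (\<lambda>p. df p (X p) * df p (Y p) * inverse (f p) + (- 1) * h p (X p) (Y p))"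
        using XY by (intro smooth_map_on_add smooth_map_on_mult smooth_fun_deriv_along f smooth_fun_inverse
            smooth_map_on_const V M h_smooth open_UNIV f_nonzero) auto
      then show ?thesis by simp
    qed
  qed
  show "df (flow t p) (tangent_map \<kappa> \<kappa> (flow t) p a) * df (flow t p) (tangent_map \<kappa> \<kappa> (flow t) p b) * inverse (f (flow t p)) -
      h (flow t p) (tangent_map \<kappa> \<kappa> (flow t) p a) (tangent_map \<kappa> \<kappa> (flow t) p b) =
      exp (\<alpha> * t) * (df p a * df p b * inverse (f p) - h p a b)" for t p a b
    by (simp add: df_flow h_flow f_flow right_diff_distrib)
qed

text \<open>As df(P) = \<alpha> f has no zeros, f - l is a defining function on the whole
  manifold.\<close>

lemma embedded_hypersurface_level:
  assumes "\<alpha> \<noteq> 0"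
  shows "embedded_hypersurface \<kappa> (f -` {l})"
  unfolding embedded_hypersurface_def
proof
  fix p
  have u: "smooth_fun \<kappa> (\<lambda>q. f q + - l)"
    by (intro smooth_map_on_add smooth_map_on_const f M V open_UNIV)
  have "differential \<kappa> (\<lambda>q. f q + - l) q (P q) \<noteq> 0" for q
    using assms
    by (subst differential_add[OF M f smooth_map_on_const[OF M V]]) (simp add: differential_const df_P)
  then show "\<exists>W u. open W \<and> p \<in> W \<and> smooth_map_on W \<kappa> (vec_charts :: (real, real) charts) u \<and>
       (\<forall>q\<in>W. \<exists>a. differential \<kappa> u q a \<noteq> 0) \<and> f -` {l} \<inter> W = {q\<in>W. u q = 0}"
    using u by (intro exI[of _ UNIV] exI[of _ "\<lambda>q. f q + - l"]) auto
qed

subsection \<open>The splitting along a level set\<close>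

text \<open>The time t with exp(\<alpha> t) r = l, at which the flow carries the level r to the
  level l.\<close>

definition time_to_level :: "real \<Rightarrow> real \<Rightarrow> real" where
  "time_to_level l r = (ln l - ln r) / \<alpha>"

definition level_proj :: "real \<Rightarrow> 'a \<Rightarrow> 'a" where
  "level_proj l p = flow (time_to_level l (f p)) p"

context
  fixes l :: real
  assumes \<alpha>: "\<alpha> \<noteq> 0" and l: "l > 0"
begin

lemma smooth_on_time_to_level: "smooth_on {0<..} (time_to_level l)"
proof -
  have "smooth_on {0<..} (\<lambda>r. (ln l - ln r) * inverse \<alpha>)"
    by (intro smooth_on_mult smooth_on_diff smooth_on_const smooth_on_ln open_greaterThan)
  then show ?thesis
    by (simp add: time_to_level_def[abs_def] divide_inverse)
qed

lemma smooth_time_to_level: "smooth_fun \<kappa> (\<lambda>p. time_to_level l (f p))"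
  by (rule smooth_map_on_vec_compose[OF M f open_greaterThan smooth_on_time_to_level]) (auto simp: f_pos)

lemma exp_time_to_level: "r > 0 \<Longrightarrow> exp (\<alpha> * time_to_level l r) = l / r"
  using \<alpha> l by (simp add: time_to_level_def exp_diff)

lemma f_level_proj [simp]: "f (level_proj l p) = l"
  by (simp add: level_proj_def f_flow exp_time_to_level f_pos)

lemma smooth_level_proj: "smooth_map_on UNIV \<kappa> \<kappa> (level_proj l)"
  unfolding level_proj_def[abs_def]
  by (rule smooth_flow_compose[OF M smooth_time_to_level smooth_map_on_ident[OF M]])

text \<open>The flow time depends on the point, so moving the point also slides along the orbit; the
  coefficient of P is the differential of \<open>time_to_level\<close> after \<open>f\<close>, with
  derivative -1 / (\<alpha> r).\<close>

lemma tangent_level_proj: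
  "tangent_map \<kappa> \<kappa> (level_proj l) p a =
    (- df p a / (\<alpha> * f p)) *\<^sub>R P (level_proj l p) + tangent_map \<kappa> \<kappa> (flow (time_to_level l (f p))) p a"
proof -
  have "(time_to_level l has_real_derivative (- 1 / (\<alpha> * f p))) (at (f p))"
    unfolding time_to_level_def[abs_def] using \<alpha> by (auto intro!: derivative_eq_intros simp: f_pos field_simps)
  from differential_compose_real[OF M f this]
  have "differential \<kappa> (\<lambda>p. time_to_level l (f p)) p a = - df p a / (\<alpha> * f p)" by simp
  then show ?thesis
    unfolding level_proj_def[abs_def] tangent_flow_compose[OF smooth_time_to_level] by simp
qed

text \<open>Put K = (\<alpha> - 1) l df(a) df(b) / (\<alpha> f^2). Expanding with
  \<open>tangent_level_proj\<close>, the term with P in both slots is K and each of the two mixed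
  terms is -K, so -K remains besides the rescaled \<open>h\<close>.\<close>

lemma h_level_proj:
  "h (level_proj l p) (tangent_map \<kappa> \<kappa> (level_proj l) p a) (tangent_map \<kappa> \<kappa> (level_proj l) p b) =
    l / f p * (h p a b - (\<alpha> - 1) / \<alpha> * (df p a * df p b) / f p)"
proof -
  let ?t = "time_to_level l (f p)" and ?q = "level_proj l p"
  let ?T = "tangent_map \<kappa> \<kappa> (flow ?t) p"
  have e: "exp (\<alpha> * ?t) = l / f p" by (simp add: exp_time_to_level f_pos)
  have q: "?q = flow ?t p" by (simp add: level_proj_def)
  have 1: "h ?q (?T a) (?T b) = l / f p * h p a b" for a b
    unfolding q h_flow e ..
  have 2: "df ?q (?T a) = l / f p * df p a" for a
    unfolding q df_flow e ..
  have 3: "h ?q (P ?q) (?T a) = (\<alpha> - 1) * (l / f p * df p a)" "h ?q (?T a) (P ?q) = (\<alpha> - 1) * (l / f p * df p a)" for a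
    by (simp_all add: h_sym[of _ "?T a"] h_P 2)
  have 4: "h ?q (P ?q) (P ?q) = (\<alpha> - 1) * (\<alpha> * l)"
    by (simp add: h_P df_P)
  have "f p \<noteq> 0" by simp
  then show ?thesis
    unfolding tangent_level_proj h_simps 1 3 4 using \<alpha>
    by (simp add: field_simps)
qed

definition splitting :: "'a \<Rightarrow> real \<times> 'a" where
  "splitting p = (f p, level_proj l p)"

text \<open>The inverse of the splitting: it flows a point of level l to level r. The formula
  accepts every point of the manifold, which provides the ambient extension required for smoothness
  on the product with the level set.\<close>

definition joining :: "real \<times> 'a \<Rightarrow> 'a" where
  "joining x = flow (- time_to_level l (fst x)) (snd x)"

lemma joining_splitting: "joining (splitting p) = p"
  by (simp add: joining_def splitting_def level_proj_def)

lemma splitting_joining: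
  assumes "x \<in> {0<..} \<times> f -` {l}"
  shows "splitting (joining x) = x"
proof -
  obtain r q where x: "x = (r, q)" "r > 0" "f q = l" using assms by auto
  \<comment> \<open>The joined point has level r, so \<open>level_proj\<close> flows it for exactly
    the time that \<open>joining\<close> went backwards.\<close>
  have "f (joining x) = r"
    using x l by (simp add: joining_def f_flow exp_minus exp_time_to_level)
  then show ?thesis
    using x by (simp add: splitting_def level_proj_def) (simp add: joining_def)
qed

lemma smooth_splitting: "smooth_map_on UNIV \<kappa> (prod_charts line \<kappa>) splitting"
  unfolding splitting_def[abs_def] by (rule smooth_map_on_Pair[OF M f smooth_level_proj])

lemma smooth_joining: "smooth_map_on ({0<..} \<times> UNIV) (prod_charts line \<kappa>) \<kappa> joining"
proof -
  have "smooth_on {0<..} (\<lambda>r. (- 1) * time_to_level l r)"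
    by (intro smooth_on_mult smooth_on_const smooth_on_time_to_level open_greaterThan)
  then have "smooth_map_on {0<..} line line (\<lambda>r. - time_to_level l r)"
    by (intro smooth_map_on_vec_vec) auto
  from smooth_map_on_compose[OF N V smooth_map_on_fst[OF V M] this]
  have "smooth_map_on ({0<..} \<times> UNIV) (prod_charts line \<kappa>) line (\<lambda>x. - time_to_level l (fst x))"
    by auto
  from smooth_flow_compose[OF N this smooth_map_on_snd[OF V M]]
  show ?thesis
    unfolding joining_def[abs_def] .
qed

lemma tangent_splitting:
  "tangent_map \<kappa> (prod_charts line \<kappa>) splitting p a = (df p a, tangent_map \<kappa> \<kappa> (level_proj l) p a)"
  unfolding splitting_def[abs_def] differential_def
  by (rule tangent_map_Pair[OF M open_UNIV UNIV_I f smooth_level_proj])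

text \<open>By \<open>h_level_proj\<close> the right-hand side of the hypothesis is the pullback of
  the warped metric. Both coefficient functions stay free, so that the two metrics of the theorem
  become instances.\<close>

lemma isometry_onto_splitting:
  assumes "\<And>p a b. g p a b = \<phi> (f p) * (df p a * df p b) +
    \<psi> (f p) * (l / f p * (h p a b - (\<alpha> - 1) / \<alpha> * (df p a * df p b) / f p))"
  shows "isometry_onto \<kappa> g (prod_charts line \<kappa>) ({0<..} \<times> f -` {l})
    (warped_metric \<phi> \<psi> (induced_metric \<kappa> (f -` {l}) h)) splitting"
  unfolding isometry_onto_def
proof (intro conjI)
  let ?S = "{0<..} \<times> f -` {l}"
  show bij: "bij_betw splitting UNIV ?S"
  proof (rule bij_betw_byWitness[where f' = joining])
    show "\<forall>x\<in>?S. splitting (joining x) = x"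
      using splitting_joining by blast
    show "range splitting \<subseteq> ?S"
      by (auto simp: splitting_def f_pos)
  qed (simp_all add: joining_splitting)
  show "smooth_map_on UNIV \<kappa> (prod_charts line \<kappa>) splitting"
    by (rule smooth_splitting)
  have "inv splitting x = joining x" if "x \<in> ?S" for x
    using splitting_joining[OF that] joining_splitting by (metis inv_f_f injI)
  then show "smooth_map_on ?S (prod_charts line \<kappa>) \<kappa> (inv splitting)"
    by (intro smooth_map_on_cong_subset[OF smooth_joining]) auto
  \<comment> \<open>The projected vectors are tangent to the level, so \<open>induced_metric\<close>
    returns \<open>h\<close> on them and not its default value 0.\<close>
  have t: "tangent_map \<kappa> \<kappa> (level_proj l) p a \<in> tangent_space \<kappa> (f -` {l}) (level_proj l p)" for p a
    by (rule tangent_map_in_tangent_space[OF M smooth_level_proj]) auto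
  show "pullback_metric \<kappa> (prod_charts line \<kappa>) splitting
      (warped_metric \<phi> \<psi> (induced_metric \<kappa> (f -` {l}) h)) = g"
    unfolding pullback_metric_def tangent_splitting fun_eq_iff assms h_level_proj[symmetric]
    by (simp add: splitting_def warped_metric_def induced_metric_def t)
qed

end

end

theorem proposition4p1:
  fixes \<kappa> :: "('a::{t2_space, second_countable_topology}, 'e::euclidean_space) charts"
    and D :: "('a, 'e) covariant_derivative"
    and f :: "'a \<Rightarrow> real"
    and m :: "real \<Rightarrow> 'a \<Rightarrow> 'a"
    and \<alpha> :: real
  assumes "smooth_manifold \<kappa>"
    and "connection \<kappa> D" and "torsion_free \<kappa> D"
    and "smooth_fun \<kappa> f" and "\<And>p. f p > 0"
    and "pseudo_riemannian \<kappa> (hessian \<kappa> D f)"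
    and "smooth_action \<kappa> m" and "free_action m"
    and "homogeneous_fun m \<alpha> f"
    and "preserves_connection \<kappa> m D"
    and "\<And>p a. D p a (generating_field \<kappa> m) = a"
    and "\<And>l. l > 0 \<Longrightarrow>
          nondegenerate_on \<kappa> (f -` {l}) (induced_metric \<kappa> (f -` {l}) (hessian \<kappa> D f))"
  shows "\<alpha> \<noteq> 0 \<and> \<alpha> \<noteq> 1 \<and>
    homogeneous_pair \<kappa> m \<alpha> (\<lambda>p a b. hessian \<kappa> D f p a b / (\<alpha> - 1)) f \<and>
    homogeneous_pair \<kappa> m \<alpha> (\<lambda>p a b. - f p * hessian \<kappa> D (\<lambda>q. ln (f q)) p a b) f \<and>
    (\<forall>l>0. \<forall>v::real \<Rightarrow> real. smooth_on {0<..} v \<and> (\<forall>r>0. v r > 0) \<longrightarrow>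
      embedded_hypersurface \<kappa> (f -` {l}) \<and>
      (\<exists>F. isometry_onto
         \<kappa> (\<lambda>p a b. v (f p) * hessian \<kappa> D f p a b)
         (prod_charts vec_charts \<kappa>) ({0<..} \<times> (f -` {l}))
         (warped_metric (\<lambda>r. (\<alpha> - 1) / \<alpha> * (v r / r)) (\<lambda>r. r * v r / l)
            (induced_metric \<kappa> (f -` {l}) (hessian \<kappa> D f))) F) \<and>
      (\<exists>F. isometry_onto
         \<kappa> (\<lambda>p a b. - v (f p) * hessian \<kappa> D (\<lambda>q. ln (f q)) p a b)
         (prod_charts vec_charts \<kappa>) ({0<..} \<times> (f -` {l}))
         (warped_metric (\<lambda>r. 1 / \<alpha> * (v r / r\<^sup>2)) (\<lambda>r. - v r / l)
            (induced_metric \<kappa> (f -` {l}) (hessian \<kappa> D f))) F))"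
proof -
  interpret homogeneous_hessian \<kappa> m D f \<alpha>
    by unfold_locales (use assms in auto)
  have \<alpha>: "\<alpha> \<noteq> 0"
    \<comment> \<open>The level is that of an arbitrary point; one exists because types are
      nonempty.\<close>
    using alpha_neq_0[OF assms(12)[OF f_pos] refl] .
  show ?thesis
  proof (intro conjI allI impI)
    fix l :: real and v :: "real \<Rightarrow> real"
    assume l: "l > 0"
    show "\<exists>F. isometry_onto \<kappa> (\<lambda>p a b. v (f p) * h p a b) (prod_charts vec_charts \<kappa>) ({0<..} \<times> (f -` {l}))
         (warped_metric (\<lambda>r. (\<alpha> - 1) / \<alpha> * (v r / r)) (\<lambda>r. r * v r / l) (induced_metric \<kappa> (f -` {l}) h)) F"
    proof (rule exI, rule isometry_onto_splitting[OF \<alpha> l])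
      fix p a b
      \<comment> \<open>The factor r v / l cancels l / f and leaves v h; the coefficient of dr^2
        restores the df^2 term that the projection removes.\<close>
      show "v (f p) * h p a b = (\<alpha> - 1) / \<alpha> * (v (f p) / f p) * (df p a * df p b) +
          f p * v (f p) / l * (l / f p * (h p a b - (\<alpha> - 1) / \<alpha> * (df p a * df p b) / f p))"
        using l \<alpha> by (simp add: field_simps)
    qed
    show "\<exists>F. isometry_onto \<kappa> (\<lambda>p a b. - v (f p) * hessian \<kappa> D (\<lambda>q. ln (f q)) p a b)
         (prod_charts vec_charts \<kappa>) ({0<..} \<times> (f -` {l}))
         (warped_metric (\<lambda>r. 1 / \<alpha> * (v r / r\<^sup>2)) (\<lambda>r. - v r / l) (induced_metric \<kappa> (f -` {l}) h)) F"
    proof (rule exI, rule isometry_onto_splitting[OF \<alpha> l])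
      fix p a b
      \<comment> \<open>Here -v / l leaves -v h / f, and the df^2 coefficients v / (\<alpha> f^2)
        and (\<alpha> - 1) v / (\<alpha> f^2) add up to v / f^2, as in the Hessian of ln f.\<close>
      show "- v (f p) * hessian \<kappa> D (\<lambda>q. ln (f q)) p a b = 1 / \<alpha> * (v (f p) / (f p)\<^sup>2) * (df p a * df p b) +
          - v (f p) / l * (l / f p * (h p a b - (\<alpha> - 1) / \<alpha> * (df p a * df p b) / f p))"
        using l \<alpha> unfolding hessian_ln[OF M D f f_pos] by (simp add: field_simps power2_eq_square)
    qed
  qed (use \<alpha> alpha_neq_1 homogeneous_pair_hessian homogeneous_pair_hessian_ln embedded_hypersurface_level in auto)
qed

end
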